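(* Let $(X,d,\varphi)$ be an irreducible Smale space with periodic orbits $P,Q$. For every metric $d'\in\mathrm{sM}_d(X,\varphi)$ there are compatible metrics $D_{s,d'}$ on $G^s(Q)$ and $\widetilde{D_{s,d'}}$ on $X^u(Q)$ such that, with respect to these metrics, (1) the groupoid automorphism $\Phi=\varphi\times\varphi:G^s(Q)\to G^s(Q)$ is bi-Lipschitz with $$4^{-1}D_{s,d'}(a,b)\le D_{s,d'}(\Phi(a),\Phi(b))\le8D_{s,d'}(a,b)$$ for every $a,b\in G^s(Q)$; (2) the inversion map $i(x,y)=(y,x)$ on $G^s(Q)$ is bi-Lipschitz, and for every base set $V\in\mathcal B(G^s(Q))$ the restrictions $r_V:V\to r(V)$ and $s_V:V\to s(V)$ of the range and source maps are bi-Lipschitz. Specifically, the maps $r,s:G^s(Q)\to X^u(Q)$ are locally bi-Lipschitz. Similarly, for every $d'\in\mathrm{sM}_d(X,\varphi)$, there are compatible metrics $D_{u,d'}$ on $G^u(P)$ and $\widetilde{D_{u,d'}}$ on $X^s(P)$ for which the automorphism $\Phi=\varphi\times\varphi:G^u(P)\to G^u(P)$ satisfies $$4^{-1}D_{u,d'}(a,b)\le D_{u,d'}(\Phi^{-1}(a),\Phi^{-1}(b))\le8D_{u,d'}(a,b)$$ for every $a,b\in G^u(P)$, the inversion map is bi-Lipschitz, and the restrictions of the range and source maps on base sets are also bi-Lipschitz.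
   Context: All Smale spaces have infinite underlying space. A Smale space $(X,d,\varphi)$ is a compact metric space $(X,d)$ with a homeomorphism $\varphi:X\to X$, constants $\varepsilon_X>0$, $\lambda_X>1$ and a continuous map $[\cdot,\cdot]:\{(x,y)\in X\times X:d(x,y)\le\varepsilon_X\}\to X$ satisfying $[x,x]=x$, $[x,[y,z]]=[x,z]$, $[[x,y],z]=[x,z]$, $\varphi([x,y])=[\varphi(x),\varphi(y)]$ whenever both sides are defined, and such that, writing for $0<\varepsilon\le\varepsilon_X$ $$X^s(x,\varepsilon)=\{y:d(x,y)<\varepsilon,\ [x,y]=y\},\qquad X^u(x,\varepsilon)=\{y:d(x,y)<\varepsilon,\ [y,x]=y\},$$ one has $d(\varphi(y),\varphi(z))\le\lambda_X^{-1}d(y,z)$ for $y,z\in X^s(x,\varepsilon)$ and $d(\varphi^{-1}(y),\varphi^{-1}(z))\le\lambda_X^{-1}d(y,z)$ for $y,z\in X^u(x,\varepsilon)$. Fix $0<\varepsilon_X'\le\varepsilon_X/2$ such that $d(x,y)\le\varepsilon_X'$ implies $d(x,[x,y]),d(y,[x,y])<\varepsilon_X/2$. It is irreducible if for all non-empty open $U,V\subset X$ there is $n\in\mathbb N$ with $\varphi^n(U)\cap V\ne\varnothing$. It is self-similar if $\varphi,\varphi^{-1}$ are both $\lambda_X$-Lipschitz. $\mathrm{hM}_d(X,\varphi)$ is the set of metrics $d'$ on $X$ inducing the same topology as $d$ for which $(X,d',\varphi)$ is a Smale space, and $\mathrm{sM}_d(X,\varphi)\subset\mathrm{hM}_d(X,\varphi)$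 is the (non-empty) subset of those $d'$ for which $(X,d',\varphi)$ is self-similar. $X^s(x)=\{y:\lim_{n\to+\infty}d(\varphi^n(x),\varphi^n(y))=0\}$, $X^u(x)=\{y:\lim_{n\to-\infty}d(\varphi^n(x),\varphi^n(y))=0\}$, $X^s(P)=\bigcup_{p\in P}X^s(p)$, $X^u(Q)=\bigcup_{q\in Q}X^u(q)$. Set $G^s(Q)=\{(v,w):v,w\in X^u(Q),\ w\in X^s(v)\}$, $G^u(P)=\{(v,w):v,w\in X^s(P),\ w\in X^u(v)\}$, with equivalence-relation groupoid structure, range $r(x,y)=x$ and source $s(x,y)=y$. For $(v,w)\in G^s(Q)$, an integer $N\ge0$ with $\varphi^N(w)\in X^s(\varphi^N(v),\varepsilon_X'/2)$ and $\eta\in(0,\varepsilon_X/2]$ with $\varphi^N(X^u(w,\eta))\subset X^u(\varphi^N(w),\varepsilon_X'/2)$, let $h^s(z)=\varphi^{-N}[\varphi^N(z),\varphi^N(v)]$ and $V^s(v,w,h^s,\eta,N)=\{(h^s(z),z):z\in X^u(w,\eta)\}$. These sets form a base of a second countable, locally compact, Hausdorff étale topology on $G^s(Q)$. The same topology is obtained from any $d'\in\mathrm{hM}_d(X,\varphi)$ in place of $d$; $\mathcal B^s(Q,d')$ denotes the base formed by the sets $V^s(v,w,h^s,\eta,N)$ built from $(X,d',\varphi)$, and $\mathcal B(G^s(Q))=\bigcup_{d'\in\mathrm{hM}_d(X,\varphi)}\mathcal B^s(Q,d')$. $G^u(P)$ is topologised likewise, with base sets $\{(h^u(z),z):z\in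 X^s(w,\eta)\}$, $h^u(z)=\varphi^N[\varphi^{-N}(v),\varphi^{-N}(z)]$. $X^u(Q)$ and $X^s(P)$ carry the topologies for which the unit maps $x\mapsto(x,x)$ are homeomorphisms onto their (open) images in $G^s(Q)$ and $G^u(P)$. A metric is compatible if it induces the given topology. A map $f$ between metric spaces is bi-Lipschitz if it and its inverse on the image are Lipschitz (in particular injective), and locally bi-Lipschitz if every point $a$ has $\ell_a>0$ and $\Lambda_a\ge1$ with $\Lambda_a^{-1}D(a,b)\le\widetilde D(f(a),f(b))\le\Lambda_aD(a,b)$ for all $b\in B_D(a,\ell_a)$. *)

theory Defs
  imports "HOL-Analysis.Analysis"
begin

section \<open>Lipschitz notions\<close>

definition bi_lipschitz_map :: "'a metric \<Rightarrow> 'b metric \<Rightarrow> ('a \<Rightarrow> 'b) \<Rightarrow> bool" where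
  "bi_lipschitz_map m1 m2 f \<longleftrightarrow>
     inj_on f (mspace m1) \<and>
     Lipschitz_continuous_map m1 m2 f \<and>
     Lipschitz_continuous_map (submetric m2 (f ` mspace m1)) m1 (inv_into (mspace m1) f)"

definition locally_bi_lipschitz_map :: "'a metric \<Rightarrow> 'b metric \<Rightarrow> ('a \<Rightarrow> 'b) \<Rightarrow> bool" where
  "locally_bi_lipschitz_map m1 m2 f \<longleftrightarrow>
     f \<in> mspace m1 \<rightarrow> mspace m2 \<and>
     (\<forall>a \<in> mspace m1. \<exists>l > 0. \<exists>\<Lambda> \<ge> 1. \<forall>b \<in> mspace m1. mdist m1 a b < l \<longrightarrow>
        inverse \<Lambda> * mdist m1 a b \<le> mdist m2 (f a) (f b) \<and>
        mdist m2 (f a) (f b) \<le> \<Lambda> * mdist m1 a b)"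

definition compatible_metric :: "'a metric \<Rightarrow> 'a set \<Rightarrow> 'a topology \<Rightarrow> bool" where
  "compatible_metric D S T \<longleftrightarrow> mspace D = S \<and> mtopology_of D = T"


section \<open>Smale spaces\<close>

text \<open>The underlying space is the carrier of the metric \<open>m\<close>.  The bracket \<open>br\<close> is a total
  function whose values matter only on pairs at distance at most \<open>\<epsilon>X\<close>; all axioms below are
  guarded accordingly.\<close>

definition local_stable :: "'a metric \<Rightarrow> ('a \<Rightarrow> 'a \<Rightarrow> 'a) \<Rightarrow> 'a \<Rightarrow> real \<Rightarrow> 'a set" where
  "local_stable m br x \<epsilon> = {y \<in> mspace m. mdist m x y < \<epsilon> \<and> br x y = y}"

definition local_unstable :: "'a metric \<Rightarrow> ('a \<Rightarrow> 'a \<Rightarrow> 'a) \<Rightarrow> 'a \<Rightarrow> real \<Rightarrow> 'a set" where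
  "local_unstable m br x \<epsilon> = {y \<in> mspace m. mdist m x y < \<epsilon> \<and> br y x = y}"

locale smale_space =
  fixes m :: "'a metric" and \<phi> :: "'a \<Rightarrow> 'a"
    and \<epsilon>X lamX :: real and br :: "'a \<Rightarrow> 'a \<Rightarrow> 'a"
  assumes infinite_space: "infinite (mspace m)"
    and compact: "compact_space (mtopology_of m)"
    and homeo: "homeomorphic_map (mtopology_of m) (mtopology_of m) \<phi>"
    and eps_pos: "\<epsilon>X > 0"
    and lambda_gt_1: "lamX > 1"
    and bracket_continuous:
      "continuous_map
         (subtopology (prod_topology (mtopology_of m) (mtopology_of m)) {(x, y). mdist m x y \<le> \<epsilon>X})
         (mtopology_of m) (\<lambda>(x, y). br x y)"
    and bracket_idem: "x \<in> mspace m \<Longrightarrow> br x x = x"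
    and bracket_right:
      "\<lbrakk>x \<in> mspace m; y \<in> mspace m; z \<in> mspace m;
        mdist m y z \<le> \<epsilon>X; mdist m x (br y z) \<le> \<epsilon>X; mdist m x z \<le> \<epsilon>X\<rbrakk>
       \<Longrightarrow> br x (br y z) = br x z"
    and bracket_left:
      "\<lbrakk>x \<in> mspace m; y \<in> mspace m; z \<in> mspace m;
        mdist m x y \<le> \<epsilon>X; mdist m (br x y) z \<le> \<epsilon>X; mdist m x z \<le> \<epsilon>X\<rbrakk>
       \<Longrightarrow> br (br x y) z = br x z"
    and bracket_equivariant:
      "\<lbrakk>x \<in> mspace m; y \<in> mspace m; mdist m x y \<le> \<epsilon>X; mdist m (\<phi> x) (\<phi> y) \<le> \<epsilon>X\<rbrakk>
       \<Longrightarrow> \<phi> (br x y) = br (\<phi> x) (\<phi> y)"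
    and stable_contraction:
      "\<lbrakk>x \<in> mspace m; 0 < \<epsilon>; \<epsilon> \<le> \<epsilon>X; y \<in> local_stable m br x \<epsilon>; z \<in> local_stable m br x \<epsilon>\<rbrakk>
       \<Longrightarrow> mdist m (\<phi> y) (\<phi> z) \<le> inverse lamX * mdist m y z"
    and unstable_contraction:
      "\<lbrakk>x \<in> mspace m; 0 < \<epsilon>; \<epsilon> \<le> \<epsilon>X; y \<in> local_unstable m br x \<epsilon>; z \<in> local_unstable m br x \<epsilon>\<rbrakk>
       \<Longrightarrow> mdist m (inv_into (mspace m) \<phi> y) (inv_into (mspace m) \<phi> z) \<le> inverse lamX * mdist m y z"

text \<open>The admissible choices of the secondary constant \<open>\<epsilon>X'\<close>.\<close>

definition bracket_radius :: "'a metric \<Rightarrow> real \<Rightarrow> ('a \<Rightarrow> 'a \<Rightarrow> 'a) \<Rightarrow> real \<Rightarrow> bool" where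
  "bracket_radius m \<epsilon>X br \<epsilon>X' \<longleftrightarrow>
     0 < \<epsilon>X' \<and> \<epsilon>X' \<le> \<epsilon>X / 2 \<and>
     (\<forall>x \<in> mspace m. \<forall>y \<in> mspace m. mdist m x y \<le> \<epsilon>X' \<longrightarrow>
        mdist m x (br x y) < \<epsilon>X / 2 \<and> mdist m y (br x y) < \<epsilon>X / 2)"

definition irreducible_system :: "'a metric \<Rightarrow> ('a \<Rightarrow> 'a) \<Rightarrow> bool" where
  "irreducible_system m \<phi> \<longleftrightarrow>
     (\<forall>U V. openin (mtopology_of m) U \<and> openin (mtopology_of m) V \<and> U \<noteq> {} \<and> V \<noteq> {} \<longrightarrow>
        (\<exists>n::nat. (\<phi> ^^ n) ` U \<inter> V \<noteq> {}))"

definition periodic_orbit :: "'a metric \<Rightarrow> ('a \<Rightarrow> 'a) \<Rightarrow> 'a set \<Rightarrow> bool" where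
  "periodic_orbit m \<phi> P \<longleftrightarrow>
     (\<exists>p \<in> mspace m. \<exists>n > 0. (\<phi> ^^ n) p = p \<and> P = range (\<lambda>k. (\<phi> ^^ k) p))"

definition self_similar :: "'a metric \<Rightarrow> ('a \<Rightarrow> 'a) \<Rightarrow> real \<Rightarrow> bool" where
  "self_similar m \<phi> lamX \<longleftrightarrow>
     (\<forall>x \<in> mspace m. \<forall>y \<in> mspace m.
        mdist m (\<phi> x) (\<phi> y) \<le> lamX * mdist m x y \<and>
        mdist m (inv_into (mspace m) \<phi> x) (inv_into (mspace m) \<phi> y) \<le> lamX * mdist m x y)"

definition hM :: "'a metric \<Rightarrow> ('a \<Rightarrow> 'a) \<Rightarrow> 'a metric set" where
  "hM m \<phi> = {m'. compatible_metric m' (mspace m) (mtopology_of m) \<and>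
                  (\<exists>\<epsilon>X lamX br. smale_space m' \<phi> \<epsilon>X lamX br)}"

definition sM :: "'a metric \<Rightarrow> ('a \<Rightarrow> 'a) \<Rightarrow> 'a metric set" where
  "sM m \<phi> = {m' \<in> hM m \<phi>. \<exists>\<epsilon>X lamX br. smale_space m' \<phi> \<epsilon>X lamX br \<and> self_similar m' \<phi> lamX}"


section \<open>Global stable and unstable sets, and their groupoids\<close>

definition global_stable :: "'a metric \<Rightarrow> ('a \<Rightarrow> 'a) \<Rightarrow> 'a \<Rightarrow> 'a set" where
  "global_stable m \<phi> x =
     {y \<in> mspace m. (\<lambda>n. mdist m ((\<phi> ^^ n) x) ((\<phi> ^^ n) y)) \<longlonglongrightarrow> 0}"

definition global_unstable :: "'a metric \<Rightarrow> ('a \<Rightarrow> 'a) \<Rightarrow> 'a \<Rightarrow> 'a set" where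
  "global_unstable m \<phi> x =
     {y \<in> mspace m. (\<lambda>n. mdist m ((inv_into (mspace m) \<phi> ^^ n) x)
                                   ((inv_into (mspace m) \<phi> ^^ n) y)) \<longlonglongrightarrow> 0}"

definition stable_union :: "'a metric \<Rightarrow> ('a \<Rightarrow> 'a) \<Rightarrow> 'a set \<Rightarrow> 'a set" where
  "stable_union m \<phi> P = (\<Union>p \<in> P. global_stable m \<phi> p)"

definition unstable_union :: "'a metric \<Rightarrow> ('a \<Rightarrow> 'a) \<Rightarrow> 'a set \<Rightarrow> 'a set" where
  "unstable_union m \<phi> Q = (\<Union>q \<in> Q. global_unstable m \<phi> q)"

text \<open>These are equivalence relations seen as groupoids: range is \<open>fst\<close>, source is \<open>snd\<close>,
  inversion is \<open>prod.swap\<close>.\<close>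

definition Gs :: "'a metric \<Rightarrow> ('a \<Rightarrow> 'a) \<Rightarrow> 'a set \<Rightarrow> ('a \<times> 'a) set" where
  "Gs m \<phi> Q = {(v, w). v \<in> unstable_union m \<phi> Q \<and> w \<in> unstable_union m \<phi> Q \<and>
                        w \<in> global_stable m \<phi> v}"

definition Gu :: "'a metric \<Rightarrow> ('a \<Rightarrow> 'a) \<Rightarrow> 'a set \<Rightarrow> ('a \<times> 'a) set" where
  "Gu m \<phi> P = {(v, w). v \<in> stable_union m \<phi> P \<and> w \<in> stable_union m \<phi> P \<and>
                        w \<in> global_unstable m \<phi> v}"

definition holonomy_s ::
  "'a metric \<Rightarrow> ('a \<Rightarrow> 'a) \<Rightarrow> ('a \<Rightarrow> 'a \<Rightarrow> 'a) \<Rightarrow> 'a \<Rightarrow> nat \<Rightarrow> 'a \<Rightarrow> 'a" where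
  "holonomy_s m \<phi> br v N z =
     (inv_into (mspace m) \<phi> ^^ N) (br ((\<phi> ^^ N) z) ((\<phi> ^^ N) v))"

definition holonomy_u ::
  "'a metric \<Rightarrow> ('a \<Rightarrow> 'a) \<Rightarrow> ('a \<Rightarrow> 'a \<Rightarrow> 'a) \<Rightarrow> 'a \<Rightarrow> nat \<Rightarrow> 'a \<Rightarrow> 'a" where
  "holonomy_u m \<phi> br v N z =
     (\<phi> ^^ N) (br ((inv_into (mspace m) \<phi> ^^ N) v) ((inv_into (mspace m) \<phi> ^^ N) z))"

definition base_s ::
  "'a metric \<Rightarrow> ('a \<Rightarrow> 'a) \<Rightarrow> real \<Rightarrow> ('a \<Rightarrow> 'a \<Rightarrow> 'a) \<Rightarrow> real \<Rightarrow> 'a set \<Rightarrow> ('a \<times> 'a) set set" where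
  "base_s m \<phi> \<epsilon>X br \<epsilon>X' Q =
     {(\<lambda>z. (holonomy_s m \<phi> br v N z, z)) ` local_unstable m br w \<eta> | v w N \<eta>.
        (v, w) \<in> Gs m \<phi> Q \<and>
        (\<phi> ^^ N) w \<in> local_stable m br ((\<phi> ^^ N) v) (\<epsilon>X' / 2) \<and>
        0 < \<eta> \<and> \<eta> \<le> \<epsilon>X / 2 \<and>
        (\<phi> ^^ N) ` local_unstable m br w \<eta> \<subseteq> local_unstable m br ((\<phi> ^^ N) w) (\<epsilon>X' / 2)}"

definition base_u ::
  "'a metric \<Rightarrow> ('a \<Rightarrow> 'a) \<Rightarrow> real \<Rightarrow> ('a \<Rightarrow> 'a \<Rightarrow> 'a) \<Rightarrow> real \<Rightarrow> 'a set \<Rightarrow> ('a \<times> 'a) set set" where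
  "base_u m \<phi> \<epsilon>X br \<epsilon>X' P =
     {(\<lambda>z. (holonomy_u m \<phi> br v N z, z)) ` local_stable m br w \<eta> | v w N \<eta>.
        (v, w) \<in> Gu m \<phi> P \<and>
        (inv_into (mspace m) \<phi> ^^ N) w
          \<in> local_unstable m br ((inv_into (mspace m) \<phi> ^^ N) v) (\<epsilon>X' / 2) \<and>
        0 < \<eta> \<and> \<eta> \<le> \<epsilon>X / 2 \<and>
        (inv_into (mspace m) \<phi> ^^ N) ` local_stable m br w \<eta>
          \<subseteq> local_stable m br ((inv_into (mspace m) \<phi> ^^ N) w) (\<epsilon>X' / 2)}"

definition Gs_topology ::
  "'a metric \<Rightarrow> ('a \<Rightarrow> 'a) \<Rightarrow> real \<Rightarrow> ('a \<Rightarrow> 'a \<Rightarrow> 'a) \<Rightarrow> real \<Rightarrow> 'a set \<Rightarrow> ('a \<times> 'a) topology" where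
  "Gs_topology m \<phi> \<epsilon>X br \<epsilon>X' Q = topology_generated_by (base_s m \<phi> \<epsilon>X br \<epsilon>X' Q)"

definition Gu_topology ::
  "'a metric \<Rightarrow> ('a \<Rightarrow> 'a) \<Rightarrow> real \<Rightarrow> ('a \<Rightarrow> 'a \<Rightarrow> 'a) \<Rightarrow> real \<Rightarrow> 'a set \<Rightarrow> ('a \<times> 'a) topology" where
  "Gu_topology m \<phi> \<epsilon>X br \<epsilon>X' P = topology_generated_by (base_u m \<phi> \<epsilon>X br \<epsilon>X' P)"

text \<open>The unit spaces carry the topology making the unit map \<open>x \<mapsto> (x, x)\<close> a homeomorphism onto
  its image, i.e. the pullback topology along it.\<close>

definition Xu_topology ::
  "'a metric \<Rightarrow> ('a \<Rightarrow> 'a) \<Rightarrow> real \<Rightarrow> ('a \<Rightarrow> 'a \<Rightarrow> 'a) \<Rightarrow> real \<Rightarrow> 'a set \<Rightarrow> 'a topology" where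
  "Xu_topology m \<phi> \<epsilon>X br \<epsilon>X' Q =
     pullback_topology (unstable_union m \<phi> Q) (\<lambda>x. (x, x)) (Gs_topology m \<phi> \<epsilon>X br \<epsilon>X' Q)"

definition Xs_topology ::
  "'a metric \<Rightarrow> ('a \<Rightarrow> 'a) \<Rightarrow> real \<Rightarrow> ('a \<Rightarrow> 'a \<Rightarrow> 'a) \<Rightarrow> real \<Rightarrow> 'a set \<Rightarrow> 'a topology" where
  "Xs_topology m \<phi> \<epsilon>X br \<epsilon>X' P =
     pullback_topology (stable_union m \<phi> P) (\<lambda>x. (x, x)) (Gu_topology m \<phi> \<epsilon>X br \<epsilon>X' P)"

text \<open>All base sets obtained from all metrics in \<open>hM m \<phi>\<close>; for each metric every choice of the
  auxiliary data (constants and bracket) of a Smale space structure is allowed.\<close>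

definition all_base_s :: "'a metric \<Rightarrow> ('a \<Rightarrow> 'a) \<Rightarrow> 'a set \<Rightarrow> ('a \<times> 'a) set set" where
  "all_base_s m \<phi> Q =
     \<Union>{base_s m' \<phi> \<epsilon>X br \<epsilon>X' Q | m' \<epsilon>X lamX br \<epsilon>X'.
          m' \<in> hM m \<phi> \<and> smale_space m' \<phi> \<epsilon>X lamX br \<and> bracket_radius m' \<epsilon>X br \<epsilon>X'}"

definition all_base_u :: "'a metric \<Rightarrow> ('a \<Rightarrow> 'a) \<Rightarrow> 'a set \<Rightarrow> ('a \<times> 'a) set set" where
  "all_base_u m \<phi> P =
     \<Union>{base_u m' \<phi> \<epsilon>X br \<epsilon>X' P | m' \<epsilon>X lamX br \<epsilon>X'.
          m' \<in> hM m \<phi> \<and> smale_space m' \<phi> \<epsilon>X lamX br \<and> bracket_radius m' \<epsilon>X br \<epsilon>X'}"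

end

theory Submission
  imports Defs
begin

text \<open>
  The topologies involved do not depend on the metric, so any self-similar metric may be used to build
  the groupoid metric.  Write \<open>f\<close> for the homeomorphism, \<open>\<Phi> = f \<times> f\<close>, \<open>d\<close> for a self-similar metric with expansion factor
  \<open>\<lambda>\<close> and \<open>E\<close> for the size of its brackets.  Replacing \<open>d\<close> by a power of exponent at most one
  (\<open>selfsim_small_expansion\<close>) makes \<open>\<lambda> \<le> 8\<close>.  Self-similarity means that \<open>f\<close> expands local unstable
  distances by exactly \<open>\<lambda>\<close>.

  On unit spaces let \<open>leaf_dist x y\<close> be \<open>d x y\<close> when \<open>x\<close> and \<open>y\<close> lie in a common local unstable set of
  size \<open>E\<close>, and \<open>E\<close> otherwise.  This is a metric, and \<open>leaf_dist x y \<le> leaf_dist (f x) (f y) \<le> \<lambda> leaf_dist x y\<close>.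

  On the groupoid, call a pair \<open>(v, w)\<close> a core element if \<open>w\<close> is in the local stable set of \<open>v\<close> of a small
  radius.  On the core the sum \<open>pair_dist\<close> of the two leaf distances induces the right topology, since a
  core element near a given one is determined by its source.  Every element of the groupoid enters the
  core under some \<open>\<Phi>^n\<close> and stays there.  Collapsing the complement of the core to a point turns
  \<open>pair_dist\<close> into a pseudometric \<open>core_dist\<close> on all pairs, and the metric \<open>D\<close>, called \<open>groupoid_dist\<close> below, is
  \<open>D a b = sup\<^sub>n \<lambda>^(-n) core_dist (\<Phi>^n a) (\<Phi>^n b)\<close>.
  Because \<open>core_dist\<close> does not decrease under \<open>\<Phi>\<close>, shifting the index in the supremum gives
  \<open>D a b \<le> D (\<Phi> a) (\<Phi> b) \<le> \<lambda> D a b\<close>.  Inversion is an isometry by symmetry.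

  The geometric heart is the holonomy estimate \<open>holonomy_d\<close>: for core elements \<open>(x, y)\<close> and \<open>(x', y')\<close> with
  \<open>x'\<close> on the local unstable leaf of \<open>x\<close> one has \<open>d x x' \<le> 2 d y y'\<close>.  Indeed, iterate \<open>f\<close> until \<open>d x x'\<close> has grown to
  a definite size; the stable gaps \<open>d x y\<close> and \<open>d x' y'\<close> have not grown, so the distance of the images of
  \<open>y\<close> and \<open>y'\<close> is comparable, and \<open>f\<close> stretches the latter by at most \<open>\<lambda>\<close> in each step.  Hence
  near an element whose \<open>n\<close>-th image is in the core, \<open>D\<close> is comparable to the leaf distance of
  sources, with constants depending on \<open>n\<close> only (\<open>snd_local_bilip\<close>).

  A basic set built from another Smale structure is pushed into the core by one common iterate, as
  stable distances shrink uniformly, and its holonomy is uniformly continuous for the leaf distance.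
  This makes range and source bi-Lipschitz on it (\<open>chart_bilip\<close>), makes it open for \<open>D\<close>
  (\<open>base_chart_open\<close>) and makes small basic sets small for \<open>D\<close> (\<open>base_chart_small\<close>).  The two structures are compared
  through a purely dynamical description of local stable sets: points whose forward orbits stay close
  (\<open>close_orbits_stable\<close>).  The statement for \<open>G\<^sup>u(P)\<close> is the one for \<open>G\<^sup>s(P)\<close> after reversing time.
\<close>

section \<open>Time-symmetric Smale systems\<close>

text \<open>
  A Smale space with its inverse map \<open>g\<close> named.  The axioms are invariant under exchanging \<open>f\<close> and \<open>g\<close> and
  flipping the bracket, so that everything about stable sets also holds for unstable sets.  Compactness is
  represented by its consequences, the uniform continuity of \<open>f\<close>, \<open>g\<close> and the bracket.
\<close>

locale smale_pair =
  fixes m :: "'a metric" and f g :: "'a \<Rightarrow> 'a"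
    and E lam :: real and br :: "'a \<Rightarrow> 'a \<Rightarrow> 'a"
  assumes f_in: "x \<in> mspace m \<Longrightarrow> f x \<in> mspace m"
    and g_in: "x \<in> mspace m \<Longrightarrow> g x \<in> mspace m"
    and gf: "x \<in> mspace m \<Longrightarrow> g (f x) = x"
    and fg: "x \<in> mspace m \<Longrightarrow> f (g x) = x"
    and E_pos: "0 < E"
    and lam_gt_1: "1 < lam"
    and f_uc: "0 < e \<Longrightarrow> \<exists>t>0. \<forall>x\<in>mspace m. \<forall>y\<in>mspace m. mdist m x y < t \<longrightarrow> mdist m (f x) (f y) < e"
    and g_uc: "0 < e \<Longrightarrow> \<exists>t>0. \<forall>x\<in>mspace m. \<forall>y\<in>mspace m. mdist m x y < t \<longrightarrow> mdist m (g x) (g y) < e"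
    and br_in: "\<lbrakk>x \<in> mspace m; y \<in> mspace m; mdist m x y \<le> E\<rbrakk> \<Longrightarrow> br x y \<in> mspace m"
    and br_uc: "0 < e \<Longrightarrow> \<exists>t>0. \<forall>x\<in>mspace m. \<forall>y\<in>mspace m. \<forall>x'\<in>mspace m. \<forall>y'\<in>mspace m.
        mdist m x y \<le> E \<longrightarrow> mdist m x' y' \<le> E \<longrightarrow> mdist m x x' < t \<longrightarrow> mdist m y y' < t \<longrightarrow>
        mdist m (br x y) (br x' y') < e"
    and br_idem: "x \<in> mspace m \<Longrightarrow> br x x = x"
    and br_right: "\<lbrakk>x \<in> mspace m; y \<in> mspace m; z \<in> mspace m;
        mdist m y z \<le> E; mdist m x (br y z) \<le> E; mdist m x z \<le> E\<rbrakk> \<Longrightarrow> br x (br y z) = br x z"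
    and br_left: "\<lbrakk>x \<in> mspace m; y \<in> mspace m; z \<in> mspace m;
        mdist m x y \<le> E; mdist m (br x y) z \<le> E; mdist m x z \<le> E\<rbrakk> \<Longrightarrow> br (br x y) z = br x z"
    and br_f: "\<lbrakk>x \<in> mspace m; y \<in> mspace m; mdist m x y \<le> E; mdist m (f x) (f y) \<le> E\<rbrakk>
        \<Longrightarrow> f (br x y) = br (f x) (f y)"
    and stable_step: "\<lbrakk>x \<in> mspace m; y \<in> mspace m; mdist m x y < E; br x y = y\<rbrakk>
        \<Longrightarrow> mdist m (f x) (f y) \<le> inverse lam * mdist m x y"
    and unstable_step: "\<lbrakk>x \<in> mspace m; y \<in> mspace m; mdist m x y < E; br y x = y\<rbrakk>
        \<Longrightarrow> mdist m (g x) (g y) \<le> inverse lam * mdist m x y"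
begin

abbreviation "X \<equiv> mspace m"
abbreviation "d \<equiv> mdist m"

lemma br_g:
  assumes "x \<in> X" "y \<in> X" "d x y \<le> E" "d (g x) (g y) \<le> E"
  shows "g (br x y) = br (g x) (g y)"
proof -
  have "f (br (g x) (g y)) = br x y"
    using br_f[of "g x" "g y"] assms by (simp add: g_in fg)
  then have "g (f (br (g x) (g y))) = g (br x y)" by simp
  then show ?thesis using gf br_in g_in assms by simp
qed

lemma dual: "smale_pair m g f E lam (\<lambda>x y. br y x)"
proof
  fix e :: real assume "0 < e"
  then obtain t where t: "t > 0" "\<forall>x\<in>X. \<forall>y\<in>X. \<forall>x'\<in>X. \<forall>y'\<in>X.
        d x y \<le> E \<longrightarrow> d x' y' \<le> E \<longrightarrow> d x x' < t \<longrightarrow> d y y' < t \<longrightarrow> d (br x y) (br x' y') < e"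
    using br_uc by blast
  then show "\<exists>t>0. \<forall>x\<in>X. \<forall>y\<in>X. \<forall>x'\<in>X. \<forall>y'\<in>X.
        d x y \<le> E \<longrightarrow> d x' y' \<le> E \<longrightarrow> d x x' < t \<longrightarrow> d y y' < t \<longrightarrow> d (br y x) (br y' x') < e"
    by (metis mdist_commute)
qed (use f_in g_in gf fg E_pos lam_gt_1 f_uc g_uc br_in br_idem br_right br_left br_g
      stable_step unstable_step in \<open>auto simp: mdist_commute\<close>)

lemma funpow_f_in: "x \<in> X \<Longrightarrow> (f ^^ n) x \<in> X"
  by (induction n) (auto simp: f_in)

lemma funpow_gf: "x \<in> X \<Longrightarrow> (g ^^ n) ((f ^^ n) x) = x"
proof (induction n arbitrary: x)
  case (Suc n)
  have "(g ^^ Suc n) ((f ^^ Suc n) x) = (g ^^ n) (g (f ((f ^^ n) x)))"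
    by (simp add: funpow_swap1)
  then show ?case using Suc by (simp add: gf funpow_f_in)
qed simp

lemma d_self [simp]: "x \<in> X \<Longrightarrow> d x x = 0"
  by simp

lemma inverse_lam_mult_le: "inverse lam * d x y \<le> d x y"
  using lam_gt_1 by (simp add: field_simps mult_le_cancel_right1 not_less)

lemma stable_sym:
  assumes "x \<in> X" "y \<in> X" "br x y = y" "d x y \<le> E"
  shows "br y x = x"
  using br_left[of x y x] assms br_idem E_pos d_self[of x] by (simp add: mdist_commute)

lemma stable_trans:
  assumes "x \<in> X" "y \<in> X" "z \<in> X" "br x y = y" "br y z = z"
    "d x y \<le> E" "d y z \<le> E" "d x z \<le> E"
  shows "br x z = z"
  using br_left[of x y z] assms by simp

text \<open>
  Once two points are in stable position at distance less than \<open>E\<close>, all forward images are, because the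
  contraction keeps the brackets defined.
\<close>

lemma stable_iter:
  assumes "x \<in> X" "y \<in> X" "br x y = y" "d x y < E"
  shows "d ((f ^^ n) x) ((f ^^ n) y) \<le> d x y / lam ^ n \<and>
    br ((f ^^ n) x) ((f ^^ n) y) = (f ^^ n) y \<and> d ((f ^^ n) x) ((f ^^ n) y) < E"
proof (induction n)
  case (Suc n)
  let ?x = "(f ^^ n) x" and ?y = "(f ^^ n) y"
  have X: "?x \<in> X" "?y \<in> X" using assms funpow_f_in by auto
  have le: "d (f ?x) (f ?y) \<le> inverse lam * d ?x ?y"
    using stable_step X Suc by auto
  then have less: "d (f ?x) (f ?y) < E" using inverse_lam_mult_le[of ?x ?y] Suc by linarith
  have "br (f ?x) (f ?y) = f (br ?x ?y)" using br_f[of ?x ?y] X Suc less by auto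
  moreover have "inverse lam * d ?x ?y \<le> inverse lam * (d x y / lam ^ n)"
    using Suc lam_gt_1 by (intro mult_left_mono) auto
  moreover have "inverse lam * (d x y / lam ^ n) = d x y / lam ^ Suc n"
    using lam_gt_1 by (simp add: field_simps)
  ultimately show ?case using Suc le less by auto
qed (use assms in auto)

lemma ex_bracket_radius: "\<exists>r. bracket_radius m E br r"
proof -
  obtain t where t: "t > 0" "\<forall>x\<in>X. \<forall>y\<in>X. \<forall>x'\<in>X. \<forall>y'\<in>X.
        d x y \<le> E \<longrightarrow> d x' y' \<le> E \<longrightarrow> d x x' < t \<longrightarrow> d y y' < t \<longrightarrow> d (br x y) (br x' y') < E/2"
    using br_uc[of "E/2"] E_pos by auto
  let ?r = "min (t/2) (E/2)"
  have "d x (br x y) < E/2" "d y (br x y) < E/2"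
    if "x \<in> X" "y \<in> X" "d x y \<le> ?r" for x y
  proof -
    have "d x y \<le> E" "d x x \<le> E" "d y y \<le> E" "d x x < t" "d y y < t" "d x y < t" "d y x < t"
      using t that E_pos mdist_commute[of m y x] by auto
    note c = this
    have "d (br x y) (br x x) < E/2" using t(2) that c by blast
    then show "d x (br x y) < E/2" by (simp add: br_idem that mdist_commute)
    have "d (br x y) (br y y) < E/2" using t(2) that c by blast
    then show "d y (br x y) < E/2" by (simp add: br_idem that mdist_commute)
  qed
  then show ?thesis unfolding bracket_radius_def using t E_pos by (intro exI[of _ ?r]) auto
qed

lemma le_div_pow_imp_le_0:
  fixes a b :: real
  assumes "\<And>n. a \<le> b / lam ^ n"
  shows "a \<le> 0"
proof -
  have "(\<lambda>n. b / lam ^ n) \<longlonglongrightarrow> 0"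
    using lam_gt_1 LIMSEQ_divide_realpow_zero by blast
  then show ?thesis using assms LIMSEQ_le_const by blast
qed

text \<open>
  Let \<open>z = [x, y]\<close>.  By equivariance \<open>f\<^sup>n z = [f\<^sup>n x, f\<^sup>n y]\<close> lies in the local unstable set of \<open>f\<^sup>n y\<close>, at
  distance less than \<open>E/2\<close>.  Applying \<open>g\<^sup>n\<close> contracts this distance by \<open>lam\<^sup>n\<close>, so \<open>z = y\<close>.  The hypothesis
  mentions only distances along orbits, which is what allows brackets of different metrics to be compared.
\<close>

lemma close_orbits_stable:
  assumes r: "bracket_radius m E br r" and X: "x \<in> X" "y \<in> X"
    and close: "\<And>n. d ((f ^^ n) x) ((f ^^ n) y) \<le> r"
  shows "br x y = y"
proof -
  let ?z = "br x y"
  interpret du: smale_pair m g f E lam "\<lambda>x y. br y x" by (rule dual)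
  have rE: "0 < r" "r \<le> E/2" using r by (auto simp: bracket_radius_def)
  have c: "d ((f ^^ n) x) ((f ^^ n) y) \<le> E" for n using close[of n] rE E_pos by linarith
  have in': "(f ^^ n) x \<in> X" "(f ^^ n) y \<in> X" for n using X funpow_f_in by auto
  have z: "?z \<in> X" using br_in[OF X] c[of 0] by simp
  have eq: "(f ^^ n) ?z = br ((f ^^ n) x) ((f ^^ n) y)" for n
  proof (induction n)
    case (Suc n)
    then show ?case using br_f[OF in'(1)[of n] in'(2)[of n]] c[of n] c[of "Suc n"] by simp
  qed simp
  have "d y ?z \<le> (E/2) / lam ^ n" for n
  proof -
    let ?y = "(f ^^ n) y" and ?w = "(f ^^ n) ?z"
    have dd: "d ?y ?w < E/2" using r in' close by (simp add: bracket_radius_def eq)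
    have "br ?w ?y = ?w"
      using br_left[of "(f ^^ n) x" ?y ?y] in' c[of n] dd E_pos br_in[OF in'(1)[of n] in'(2)[of n] c[of n]]
      by (simp add: eq mdist_commute)
    then have "d ((g ^^ n) ?y) ((g ^^ n) ?w) \<le> d ?y ?w / lam ^ n"
      using du.stable_iter[of ?y ?w n] dd E_pos in' z funpow_f_in by auto
    also have "\<dots> \<le> (E/2) / lam ^ n" using dd lam_gt_1 by (intro divide_right_mono) auto
    finally show ?thesis using funpow_gf z X by simp
  qed
  then have "d y ?z \<le> 0" by (rule le_div_pow_imp_le_0)
  then show ?thesis using X z by (metis mdist_nonneg mdist_zero order_antisym)
qed

lemma funpow_f_uc:
  "0 < e \<Longrightarrow> \<exists>t>0. \<forall>x\<in>X. \<forall>y\<in>X. d x y < t \<longrightarrow> d ((f ^^ n) x) ((f ^^ n) y) < e"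
proof (induction n arbitrary: e)
  case (Suc n)
  obtain t where t: "t > 0" "\<forall>x\<in>X. \<forall>y\<in>X. d x y < t \<longrightarrow> d (f x) (f y) < e"
    using f_uc Suc by blast
  obtain s where s: "s > 0" "\<forall>x\<in>X. \<forall>y\<in>X. d x y < s \<longrightarrow> d ((f ^^ n) x) ((f ^^ n) y) < t"
    using Suc t by blast
  then show ?case using t by (intro exI[of _ s]) (auto simp: funpow_f_in)
qed auto

end

section \<open>Two structures with the same topology\<close>

text \<open>
  Compatible metrics on a compact space are uniformly finer than each other; this is how metrics are
  compared below.
\<close>

definition unif_finer :: "'a metric \<Rightarrow> 'a metric \<Rightarrow> bool" where
  "unif_finer m1 m2 \<longleftrightarrow> mspace m1 = mspace m2 \<and>
     (\<forall>e>0. \<exists>t>0. \<forall>x\<in>mspace m1. \<forall>y\<in>mspace m1. mdist m1 x y < t \<longrightarrow> mdist m2 x y < e)"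

lemma global_stable_unif_finer:
  assumes "unif_finer m1 m2" "\<And>x. x \<in> mspace m1 \<Longrightarrow> f x \<in> mspace m1" "x \<in> mspace m1"
  shows "global_stable m1 f x \<subseteq> global_stable m2 f x"
proof
  fix y assume y: "y \<in> global_stable m1 f x"
  have pw: "(f ^^ n) z \<in> mspace m1" if "z \<in> mspace m1" for n z
    using that assms(2) by (induction n) auto
  have yX: "y \<in> mspace m1" using y by (auto simp: global_stable_def)
  have "(\<lambda>n. mdist m2 ((f ^^ n) x) ((f ^^ n) y)) \<longlonglongrightarrow> 0"
  proof (rule LIMSEQ_I)
    fix e :: real assume "e > 0"
    then obtain t where t: "t > 0"
        "\<forall>x\<in>mspace m1. \<forall>y\<in>mspace m1. mdist m1 x y < t \<longrightarrow> mdist m2 x y < e"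
      using assms(1) by (auto simp: unif_finer_def)
    obtain N where "\<forall>n\<ge>N. norm (mdist m1 ((f ^^ n) x) ((f ^^ n) y) - 0) < t"
      using y t(1) LIMSEQ_D unfolding global_stable_def by blast
    then show "\<exists>N. \<forall>n\<ge>N. norm (mdist m2 ((f ^^ n) x) ((f ^^ n) y) - 0) < e"
      using t pw yX assms(3) by (intro exI[of _ N]) auto
  qed
  then show "y \<in> global_stable m2 f x"
    using yX assms(1) by (auto simp: global_stable_def unif_finer_def)
qed

text \<open>
  In the second structure the distance along forward orbits is bounded by the initial one; this
  smallness passes to the first metric, where \<open>close_orbits_stable\<close> applies.
\<close>

lemma stable_transfer:
  assumes A: "smale_pair m1 f g E1 lam1 br1" and B: "smale_pair m2 f g E2 lam2 br2"
    and u: "unif_finer m2 m1" and k: "0 < k"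
  shows "\<exists>t>0. \<forall>x\<in>mspace m1. \<forall>y\<in>mspace m1.
     br2 x y = y \<longrightarrow> mdist m2 x y < t \<longrightarrow> br1 x y = y \<and> mdist m1 x y < k"
proof -
  interpret A: smale_pair m1 f g E1 lam1 br1 by fact
  interpret B: smale_pair m2 f g E2 lam2 br2 by fact
  obtain r where r: "bracket_radius m1 E1 br1 r" using A.ex_bracket_radius by blast
  then have "0 < min r k" using k by (auto simp: bracket_radius_def)
  then obtain t where t: "t > 0"
     "\<forall>x\<in>mspace m1. \<forall>y\<in>mspace m1. mdist m2 x y < t \<longrightarrow> mdist m1 x y < min r k"
    using u unfolding unif_finer_def by metis
  have sp: "mspace m2 = mspace m1" using u by (auto simp: unif_finer_def)
  show ?thesis
  proof (intro exI[of _ "min t E2"] conjI ballI impI)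
    fix x y assume xy: "x \<in> mspace m1" "y \<in> mspace m1" "br2 x y = y" "mdist m2 x y < min t E2"
    have "mdist m1 ((f ^^ n) x) ((f ^^ n) y) < min r k" for n
    proof -
      have "mdist m2 ((f ^^ n) x) ((f ^^ n) y) \<le> mdist m2 x y / lam2 ^ n"
        using B.stable_iter[of x y n] xy sp by auto
      also have "\<dots> \<le> mdist m2 x y / 1"
        using B.lam_gt_1 by (intro divide_left_mono) auto
      finally show ?thesis using t xy A.funpow_f_in by auto
    qed
    note c = this
    show "br1 x y = y"
      using A.close_orbits_stable[OF r xy(1,2)] c by (simp add: less_imp_le)
    show "mdist m1 x y < k" using c[of 0] by simp
  qed (use t B.E_pos in auto)
qed

lemma unstable_transfer:
  assumes A: "smale_pair m1 f g E1 lam1 br1" and B: "smale_pair m2 f g E2 lam2 br2"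
    and u: "unif_finer m2 m1" and k: "0 < k"
  shows "\<exists>t>0. \<forall>x\<in>mspace m1. \<forall>y\<in>mspace m1.
     br2 y x = y \<longrightarrow> mdist m2 x y < t \<longrightarrow> br1 y x = y \<and> mdist m1 x y < k"
  using stable_transfer[OF smale_pair.dual[OF A] smale_pair.dual[OF B] u k] by simp

section \<open>A groupoid metric from a self-similar metric\<close>

text \<open>
  Together with \<open>unstable_step\<close> the Lipschitz bound says that \<open>f\<close> multiplies small local unstable
  distances by exactly \<open>lam\<close>.
\<close>

locale selfsim_pair = smale_pair +
  assumes f_lip: "\<lbrakk>x \<in> mspace m; y \<in> mspace m\<rbrakk> \<Longrightarrow> mdist m (f x) (f y) \<le> lam * mdist m x y"
begin

text \<open>
  The cut-off value \<open>E\<close> is assigned to all pairs which are not visibly on a common local leaf, and to pairs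
  outside the space so that the function is symmetric everywhere.
\<close>

definition leaf_dist :: "'a \<Rightarrow> 'a \<Rightarrow> real" where
  "leaf_dist x y = (if x \<in> X \<and> y \<in> X \<and> br y x = y \<and> d x y < E then d x y else E)"

text \<open>
  Two stable gaps of this size add up to half of \<open>E / lam\<close>.  An expanding leaf distance takes a value in
  \<open>[E / lam, E)\<close>, and there the gaps cost at most a factor \<open>2\<close> (see \<open>holonomy_expanded\<close>).
\<close>

definition core_radius :: real where "core_radius = E / (4 * lam)"

definition in_core :: "'a \<times> 'a \<Rightarrow> bool" where
  "in_core a \<longleftrightarrow> br (fst a) (snd a) = snd a \<and> d (fst a) (snd a) < core_radius"

text \<open>
  The height above the boundary of the core.  It is \<open>1\<close>-Lipschitz on the core for \<open>pair_dist\<close>, which is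
  what the triangle inequality of \<open>core_dist\<close> rests on.
\<close>

definition margin :: "'a \<times> 'a \<Rightarrow> real" where
  "margin a = (if in_core a then core_radius - d (fst a) (snd a) else 0)"

definition pair_dist :: "'a \<times> 'a \<Rightarrow> 'a \<times> 'a \<Rightarrow> real" where
  "pair_dist a b = leaf_dist (fst a) (fst b) + leaf_dist (snd a) (snd b)"

text \<open>
  The quotient pseudometric obtained from \<open>pair_dist\<close> on the core when everything outside of it is collapsed to
  a single point: two elements are joined directly or through that point.
\<close>

definition core_dist :: "'a \<times> 'a \<Rightarrow> 'a \<times> 'a \<Rightarrow> real" where
  "core_dist a b = (if in_core a \<and> in_core b then min (pair_dist a b) (margin a + margin b) else margin a + margin b)"

definition Phi :: "nat \<Rightarrow> 'a \<times> 'a \<Rightarrow> 'a \<times> 'a" where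
  "Phi n = map_prod (f ^^ n) (f ^^ n)"

definition groupoid_dist :: "'a \<times> 'a \<Rightarrow> 'a \<times> 'a \<Rightarrow> real" where
  "groupoid_dist a b = (SUP n. core_dist (Phi n a) (Phi n b) / lam ^ n)"

lemma lam_pos: "0 < lam" using lam_gt_1 by simp

lemma lam_pow_pos [simp]: "0 < lam ^ n" using lam_pos by simp

lemma lam_pow_ge_1: "1 \<le> lam ^ n" using lam_gt_1 by (simp add: one_le_power)

lemma core_radius_pos: "0 < core_radius" using E_pos lam_pos by (simp add: core_radius_def)

lemma core_radius_lam: "4 * lam * core_radius = E" using lam_pos by (simp add: core_radius_def)

lemma core_radius_less_E: "core_radius < E"
proof -
  have "1 * core_radius < (4 * lam) * core_radius" using core_radius_pos lam_gt_1 by (intro mult_strict_right_mono) auto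
  then show ?thesis using core_radius_lam by simp
qed

subsection \<open>The leaf metric\<close>

lemma leaf_dist_nonneg: "0 \<le> leaf_dist x y" using E_pos by (simp add: leaf_dist_def)

lemma leaf_dist_le_E: "leaf_dist x y \<le> E" by (simp add: leaf_dist_def)

lemma leaf_dist_less_E: "leaf_dist x y < E \<Longrightarrow> x \<in> X \<and> y \<in> X \<and> br y x = y \<and> d x y < E \<and> leaf_dist x y = d x y"
  by (auto simp: leaf_dist_def split: if_splits)

lemma leaf_dist_eq_d: "x \<in> X \<Longrightarrow> y \<in> X \<Longrightarrow> br y x = y \<Longrightarrow> d x y < E \<Longrightarrow> leaf_dist x y = d x y"
  by (simp add: leaf_dist_def)

text \<open>
  The triangle inequality is only at stake when both summands are genuine leaf distances with sum less
  than \<open>E\<close>; then the bracket identity \<open>[z, [y, x]] = [z, x]\<close> puts \<open>x\<close> and \<open>z\<close> on the same local leaf.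
\<close>

lemma leaf_dist_metric: "Metric_space X leaf_dist"
proof
  show "0 \<le> leaf_dist x y" for x y by (rule leaf_dist_nonneg)
  show "leaf_dist x y = leaf_dist y x" for x y
    using smale_pair.stable_sym[OF dual, of x y] smale_pair.stable_sym[OF dual, of y x]
    by (auto simp: leaf_dist_def mdist_commute)
  show "leaf_dist x z \<le> leaf_dist x y + leaf_dist y z" if "x \<in> X" "y \<in> X" "z \<in> X" for x y z
  proof (cases "leaf_dist x y + leaf_dist y z < E")
    case True
    then have "leaf_dist x y < E" "leaf_dist y z < E" using leaf_dist_nonneg[of x y] leaf_dist_nonneg[of y z] by auto
    note xy = leaf_dist_less_E[OF this(1)] and yz = leaf_dist_less_E[OF this(2)]
    have le: "d x z \<le> d x y + d y z" using that by (rule mdist_triangle)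
    then have "d x z < E" using True xy yz by simp
    moreover have "br z x = z"
      using smale_pair.stable_trans[OF dual, of x y z] that xy yz calculation by simp
    ultimately show ?thesis using le xy yz by (simp add: leaf_dist_def)
  next
    case False
    then show ?thesis using leaf_dist_le_E[of x z] by simp
  qed
  show "leaf_dist x y = 0 \<longleftrightarrow> x = y" if "x \<in> X" "y \<in> X" for x y
    using that E_pos by (auto simp: leaf_dist_def br_idem)
qed

interpretation leaf_dist: Metric_space X leaf_dist by (rule leaf_dist_metric)

lemma leaf_dist_f_le: assumes "x \<in> X" "y \<in> X" shows "leaf_dist (f x) (f y) \<le> lam * leaf_dist x y"
proof (cases "leaf_dist x y < E \<and> d (f x) (f y) < E")
  case True
  then have xy: "br y x = y" "d x y < E" "leaf_dist x y = d x y" using leaf_dist_less_E by blast+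
  have "br (f y) (f x) = f y"
    using br_f[of y x] True assms xy by (simp add: mdist_commute)
  then have "leaf_dist (f x) (f y) = d (f x) (f y)" using True assms f_in by (simp add: leaf_dist_def)
  then show ?thesis using f_lip[OF assms] xy by simp
next
  case False
  have "E \<le> lam * leaf_dist x y"
  proof (cases "leaf_dist x y < E")
    case True
    then show ?thesis using f_lip[OF assms] False leaf_dist_less_E[OF True] by simp
  next
    case False
    then show ?thesis using leaf_dist_le_E[of x y] lam_gt_1 E_pos by simp
  qed
  then show ?thesis using leaf_dist_le_E[of "f x" "f y"] by simp
qed

lemma leaf_dist_expand:
  assumes "x \<in> X" "y \<in> X" "leaf_dist (f x) (f y) < E"
  shows "lam * leaf_dist x y \<le> leaf_dist (f x) (f y)"
proof -
  note xy = leaf_dist_less_E[OF assms(3)]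
  have le: "lam * d x y \<le> d (f x) (f y)"
    using unstable_step[of "f x" "f y"] xy assms lam_pos by (simp add: gf field_simps)
  have "d x y < E" using le inverse_lam_mult_le[of x y] xy lam_pos
    by (smt (verit) lam_gt_1 mdist_nonneg mult_le_cancel_right1)
  moreover have "br y x = y"
    using br_g[of "f y" "f x"] xy assms calculation by (simp add: gf mdist_commute)
  ultimately show ?thesis using le xy assms by (simp add: leaf_dist_def)
qed

lemma leaf_dist_le_f: assumes "x \<in> X" "y \<in> X" shows "leaf_dist x y \<le> leaf_dist (f x) (f y)"
proof (cases "leaf_dist (f x) (f y) < E")
  case True
  have "1 * leaf_dist x y \<le> lam * leaf_dist x y" using lam_gt_1 leaf_dist_nonneg by (intro mult_right_mono) auto
  then show ?thesis using leaf_dist_expand[OF assms True] by simp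
next
  case False
  then show ?thesis using leaf_dist_le_E[of x y] by simp
qed

lemma leaf_dist_funpow_le: "x \<in> X \<Longrightarrow> y \<in> X \<Longrightarrow> leaf_dist ((f ^^ n) x) ((f ^^ n) y) \<le> lam ^ n * leaf_dist x y"
proof (induction n)
  case (Suc n)
  have "leaf_dist (f ((f ^^ n) x)) (f ((f ^^ n) y)) \<le> lam * leaf_dist ((f ^^ n) x) ((f ^^ n) y)"
    using Suc funpow_f_in by (intro leaf_dist_f_le) auto
  also have "\<dots> \<le> lam * (lam ^ n * leaf_dist x y)" using Suc lam_pos by (intro mult_left_mono) auto
  finally show ?case by (simp add: mult.assoc)
qed simp

lemma leaf_dist_le_funpow: "x \<in> X \<Longrightarrow> y \<in> X \<Longrightarrow> leaf_dist x y \<le> leaf_dist ((f ^^ n) x) ((f ^^ n) y)"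
proof (induction n)
  case (Suc n)
  then have "leaf_dist ((f ^^ n) x) ((f ^^ n) y) \<le> leaf_dist (f ((f ^^ n) x)) (f ((f ^^ n) y))"
    using funpow_f_in by (intro leaf_dist_le_f) auto
  then show ?case using Suc by simp
qed simp

subsection \<open>Holonomy\<close>

lemma in_core_f:
  assumes "a \<in> X \<times> X" "in_core a"
  shows "in_core (map_prod f f a) \<and> margin a \<le> margin (map_prod f f a)"
proof -
  obtain v w where a: "a = (v, w)" by (cases a)
  have vw: "v \<in> X" "w \<in> X" "br v w = w" "d v w < core_radius" using assms by (auto simp: a in_core_def)
  then have "d (f v) (f w) \<le> inverse lam * d v w"
    using stable_step core_radius_less_E by simp
  then have le: "d (f v) (f w) \<le> d v w" using inverse_lam_mult_le[of v w] by linarith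
  then have "br (f v) (f w) = f w" using br_f[of v w] vw core_radius_less_E by simp
  then show ?thesis using le vw by (simp add: a in_core_def margin_def)
qed

text \<open>
  Induction on the number \<open>k\<close> of expansion steps that bring \<open>d x x'\<close> to size \<open>E\<close>.  If one step suffices,
  the stable gaps account for at most half of \<open>d x x'\<close>.  Otherwise the estimate holds for the
  images; on the side of \<open>x\<close> the map expands by at least \<open>lam\<close> and on the side of \<open>y\<close> by at most \<open>lam\<close>.
\<close>

lemma holonomy_expanded:
  "\<lbrakk>E \<le> lam ^ k * d x x'; x \<in> X; x' \<in> X; y \<in> X; y' \<in> X; in_core (x, y); in_core (x', y'); leaf_dist x x' < E\<rbrakk>
    \<Longrightarrow> d x x' \<le> 2 * d y y'"
proof (induction k arbitrary: x x' y y')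
  case 0
  then show ?case using leaf_dist_less_E[of x x'] by simp
next
  case (Suc k)
  have s: "d x y < core_radius" "d x' y' < core_radius" using Suc.prems by (auto simp: in_core_def)
  have xx: "leaf_dist x x' = d x x'" using leaf_dist_less_E Suc.prems by blast
  show ?case
  proof (cases "E \<le> lam * d x x'")
    case True
    then have "lam * (4 * core_radius) \<le> lam * d x x'" using core_radius_lam by (simp add: algebra_simps)
    then have "4 * core_radius \<le> d x x'" using lam_pos mult_le_cancel_left_pos by blast
    moreover have "d x x' \<le> d x y + d y y' + d y' x'"
      using mdist_triangle[of x m y x'] mdist_triangle[of y m y' x'] Suc.prems by simp
    moreover have "d y' x' < core_radius" using s by (simp add: mdist_commute)
    ultimately show ?thesis using s by linarith
  next
    case False
    have le: "leaf_dist (f x) (f x') \<le> lam * d x x'" using leaf_dist_f_le[of x x'] Suc.prems xx by simp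
    then have small: "leaf_dist (f x) (f x') < E" using False by simp
    have ge: "lam * d x x' \<le> d (f x) (f x')"
      using leaf_dist_expand[OF _ _ small] leaf_dist_less_E[OF small] Suc.prems xx by simp
    have "E \<le> lam ^ k * (lam * d x x')" using Suc.prems by (simp add: algebra_simps)
    also have "\<dots> \<le> lam ^ k * d (f x) (f x')"
      using ge by (intro mult_left_mono) (auto intro: less_imp_le)
    finally have "d (f x) (f x') \<le> 2 * d (f y) (f y')"
      using Suc.IH[of "f x" "f x'" "f y" "f y'"] Suc.prems small f_in
        in_core_f[of "(x, y)"] in_core_f[of "(x', y')"] by simp
    also have "\<dots> \<le> 2 * (lam * d y y')" using f_lip Suc.prems by simp
    finally have "lam * d x x' \<le> lam * (2 * d y y')" using ge by linarith
    then show ?thesis using lam_pos mult_le_cancel_left_pos by blast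
  qed
qed

lemma holonomy_d:
  assumes "x \<in> X" "x' \<in> X" "y \<in> X" "y' \<in> X" "in_core (x, y)" "in_core (x', y')" "leaf_dist x x' < E"
  shows "d x x' \<le> 2 * d y y'"
proof (cases "d x x' = 0")
  case False
  then have pos: "0 < d x x'" using mdist_nonneg[of m x x'] by linarith
  obtain k where "E / d x x' < lam ^ k" using real_arch_pow[OF lam_gt_1] by blast
  then have "E \<le> lam ^ k * d x x'" using pos by (simp add: field_simps)
  then show ?thesis using holonomy_expanded assms by blast
qed simp

lemma in_core_swap: "a \<in> X \<times> X \<Longrightarrow> in_core (prod.swap a) \<longleftrightarrow> in_core a"
  using stable_sym core_radius_less_E by (fastforce simp: in_core_def mdist_commute)

lemma holonomy_fst:
  assumes "a \<in> X \<times> X" "b \<in> X \<times> X" "in_core a" "in_core b" "leaf_dist (fst a) (fst b) < E"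
  shows "leaf_dist (fst a) (fst b) \<le> 2 * leaf_dist (snd a) (snd b)"
proof (cases "leaf_dist (snd a) (snd b) < E")
  case True
  then show ?thesis
    using holonomy_d[of "fst a" "fst b" "snd a" "snd b"] assms leaf_dist_less_E[OF True]
      leaf_dist_less_E[OF assms(5)] by auto
next
  case False
  then show ?thesis using assms E_pos by simp
qed

subsection \<open>The one-scale pseudometric\<close>

lemma margin_bounds: "0 \<le> margin a \<and> margin a \<le> core_radius"
  using core_radius_pos by (auto simp: margin_def in_core_def)

lemma margin_pos: "in_core a \<Longrightarrow> 0 < margin a" by (simp add: margin_def in_core_def)

lemma pair_dist_nonneg: "0 \<le> pair_dist a b" by (simp add: pair_dist_def leaf_dist_nonneg)

lemma leaf_dist_le_pair_dist: "leaf_dist (fst a) (fst b) \<le> pair_dist a b" "leaf_dist (snd a) (snd b) \<le> pair_dist a b"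
  by (simp_all add: pair_dist_def)

lemma pair_dist_tri: "a \<in> X \<times> X \<Longrightarrow> b \<in> X \<times> X \<Longrightarrow> c \<in> X \<times> X \<Longrightarrow> pair_dist a c \<le> pair_dist a b + pair_dist b c"
  using leaf_dist.triangle[of "fst a" "fst b" "fst c"] leaf_dist.triangle[of "snd a" "snd b" "snd c"]
  by (auto simp: pair_dist_def)

lemma pair_dist_sym: "pair_dist a b = pair_dist b a" by (simp add: pair_dist_def leaf_dist.commute)

lemma d_change:
  assumes "pair_dist a b < E"
  shows "\<bar>d (fst a) (snd a) - d (fst b) (snd b)\<bar> \<le> pair_dist a b"
proof -
  obtain v w v' w' where ab: "a = (v, w)" "b = (v', w')" by (cases a, cases b)
  have "leaf_dist v v' < E" "leaf_dist w w' < E"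
    using assms leaf_dist_le_pair_dist[of a b] by (auto simp: ab)
  note v = leaf_dist_less_E[OF this(1)] and w = leaf_dist_less_E[OF this(2)]
  have "d v w \<le> d v v' + d v' w' + d w' w" "d v' w' \<le> d v' v + d v w + d w w'"
    using mdist_triangle[of v m v' w] mdist_triangle[of v' m w' w]
      mdist_triangle[of v' m v w'] mdist_triangle[of v m w w'] v w by linarith+
  then show ?thesis using v w by (auto simp: pair_dist_def ab mdist_commute)
qed

lemma margin_lipschitz:
  assumes "in_core a" "in_core b"
  shows "margin a \<le> pair_dist a b + margin b"
proof (cases "pair_dist a b < E")
  case True
  then show ?thesis using d_change[OF True] assms by (auto simp: margin_def)
next
  case False
  then show ?thesis using margin_bounds[of a] margin_bounds[of b] core_radius_less_E by linarith
qed

lemma core_dist_sym: "core_dist a b = core_dist b a" by (simp add: core_dist_def pair_dist_sym add.commute)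

lemma core_dist_nonneg: "0 \<le> core_dist a b"
  using margin_bounds[of a] margin_bounds[of b] pair_dist_nonneg[of a b] by (auto simp: core_dist_def)

lemma core_dist_le: "core_dist a b \<le> 2 * core_radius"
  using margin_bounds[of a] margin_bounds[of b] by (auto simp: core_dist_def)

lemma core_dist_tri:
  assumes "a \<in> X \<times> X" "b \<in> X \<times> X" "c \<in> X \<times> X"
  shows "core_dist a c \<le> core_dist a b + core_dist b c"
proof -
  have n: "\<not> in_core x \<Longrightarrow> margin x = 0" for x by (simp add: margin_def)
  note b = margin_bounds[of a] margin_bounds[of b] margin_bounds[of c]
  have le: "core_dist a c \<le> margin a + margin c" by (simp add: core_dist_def)
  show ?thesis
  proof (cases "in_core b")
    case False
    then have "core_dist a b = margin a + margin b" "core_dist b c = margin b + margin c" by (auto simp: core_dist_def)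
    then show ?thesis using le b by linarith
  next
    case b_in_core: True
    have ab: "in_core a \<Longrightarrow> core_dist a b = min (pair_dist a b) (margin a + margin b)" "\<not> in_core a \<Longrightarrow> core_dist a b = margin b"
      and bc: "in_core c \<Longrightarrow> core_dist b c = min (pair_dist b c) (margin b + margin c)" "\<not> in_core c \<Longrightarrow> core_dist b c = margin b"
      using b_in_core n by (auto simp: core_dist_def)
    show ?thesis
    proof (cases "in_core a")
      case a_in_core: True
      have la: "margin a \<le> pair_dist a b + margin b" by (rule margin_lipschitz[OF a_in_core b_in_core])
      show ?thesis
      proof (cases "in_core c")
        case True
        then have lc: "margin c \<le> pair_dist b c + margin b" using margin_lipschitz[OF True b_in_core] pair_dist_sym by simp
        have "core_dist a c \<le> pair_dist a c" using True a_in_core by (simp add: core_dist_def)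
        then show ?thesis using ab(1)[OF a_in_core] bc(1)[OF True] la lc le b pair_dist_tri[OF assms] by linarith
      next
        case False
        then show ?thesis using ab(1)[OF a_in_core] bc(2)[OF False] la le b n[OF False] by linarith
      qed
    next
      case a_not: False
      show ?thesis
      proof (cases "in_core c")
        case True
        then have lc: "margin c \<le> pair_dist b c + margin b" using margin_lipschitz[OF True b_in_core] pair_dist_sym by simp
        then show ?thesis using ab(2)[OF a_not] bc(1)[OF True] lc le b n[OF a_not] by linarith
      next
        case False
        then show ?thesis using ab(2)[OF a_not] bc(2)[OF False] le b n[OF a_not] n[OF False] by linarith
      qed
    qed
  qed
qed

text \<open>
  An element \<open>b\<close> outside the core may be mapped into it.  If its image were then closer to that of \<open>a\<close> than the
  margin of \<open>a\<close>, pulling back would show that the two points of \<open>b\<close> are closer than \<open>core_radius\<close>, and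
  equivariance of the bracket would put \<open>b\<close> into the core already.  This is the case that makes
  \<open>core_dist\<close> monotone under the dynamics.
\<close>

lemma margin_le_pair_dist_outside:
  assumes X: "a \<in> X \<times> X" "b \<in> X \<times> X" and a: "in_core a" and b: "\<not> in_core b"
    and fb: "in_core (map_prod f f b)"
  shows "margin a \<le> pair_dist (map_prod f f a) (map_prod f f b)"
proof (rule ccontr)
  assume *: "\<not> ?thesis"
  obtain v w v' w' where ab: "a = (v, w)" "b = (v', w')" by (cases a, cases b)
  have mem: "v \<in> X" "w \<in> X" "v' \<in> X" "w' \<in> X" using X ab by auto
  have "pair_dist a b \<le> pair_dist (map_prod f f a) (map_prod f f b)"
    using leaf_dist_le_f mem by (auto simp: pair_dist_def ab intro: add_mono)
  then have less: "pair_dist a b < margin a" using * by simp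
  then have "pair_dist a b < E" using margin_bounds[of a] core_radius_less_E by linarith
  from d_change[OF this] have vw: "d v' w' < core_radius"
    using less a by (auto simp: margin_def ab)
  moreover have "br v' w' = w'"
  proof -
    have s: "br (f v') (f w') = f w'" "d (f v') (f w') < core_radius" using fb by (auto simp: in_core_def ab)
    have "br v' w' = g (f (br v' w'))"
      using gf br_in[of v' w'] mem vw core_radius_less_E by simp
    also have "f (br v' w') = f w'"
      using br_f[of v' w'] s mem vw core_radius_less_E by simp
    finally show ?thesis by (simp add: gf mem)
  qed
  ultimately show False using b by (simp add: in_core_def ab)
qed

lemma core_dist_mono:
  assumes "a \<in> X \<times> X" "b \<in> X \<times> X"
  shows "core_dist a b \<le> core_dist (map_prod f f a) (map_prod f f b)"
proof -
  let ?a = "map_prod f f a" and ?b = "map_prod f f b"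
  have n: "\<not> in_core x \<Longrightarrow> margin x = 0" for x by (simp add: margin_def)
  have le0: "pair_dist a b \<le> pair_dist ?a ?b"
    using leaf_dist_le_f assms by (auto simp: pair_dist_def intro: add_mono)
  consider "in_core a" "in_core b" | "in_core a" "\<not> in_core b" | "\<not> in_core a" "in_core b" | "\<not> in_core a" "\<not> in_core b" by blast
  then show ?thesis
  proof cases
    case 1
    then show ?thesis using in_core_f[of a] in_core_f[of b] assms le0 by (auto simp: core_dist_def min_def)
  next
    case 2
    then show ?thesis
      using in_core_f[of a] assms margin_le_pair_dist_outside[OF assms] margin_bounds[of ?b] n[of b]
      by (auto simp: core_dist_def min_def)
  next
    case 3
    then show ?thesis
      using in_core_f[of b] assms margin_le_pair_dist_outside[OF assms(2,1)] margin_bounds[of ?a] n[of a] pair_dist_sym[of ?a ?b]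
      by (auto simp: core_dist_def min_def)
  next
    case 4
    then show ?thesis using n core_dist_nonneg by (simp add: core_dist_def)
  qed
qed

subsection \<open>The groupoid metric\<close>

lemma Phi_in: "a \<in> X \<times> X \<Longrightarrow> Phi n a \<in> X \<times> X"
  using funpow_f_in by (auto simp: Phi_def)

lemma fst_Phi [simp]: "fst (Phi n a) = (f ^^ n) (fst a)" by (simp add: Phi_def)
lemma snd_Phi [simp]: "snd (Phi n a) = (f ^^ n) (snd a)" by (simp add: Phi_def)

lemma Phi_Suc: "Phi (Suc n) a = map_prod f f (Phi n a)"
  by (cases a) (simp add: Phi_def)

lemma Phi_Suc': "Phi (Suc n) a = Phi n (map_prod f f a)"
  by (cases a) (simp add: Phi_def funpow_swap1)

lemma Phi_add: "Phi (k + n) a = Phi k (Phi n a)"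
  by (cases a) (simp add: Phi_def funpow_add)

lemma core_dist_Phi_mono:
  assumes "a \<in> X \<times> X" "b \<in> X \<times> X" "n \<le> k"
  shows "core_dist (Phi n a) (Phi n b) \<le> core_dist (Phi k a) (Phi k b)"
  using assms(3)
proof (induction k rule: dec_induct)
  case (step k)
  then show ?case using core_dist_mono[of "Phi k a" "Phi k b"] Phi_in assms by (auto simp: Phi_Suc)
qed simp

lemma in_core_Phi:
  assumes "a \<in> X \<times> X" "in_core (Phi n a)" "n \<le> k"
  shows "in_core (Phi k a) \<and> margin (Phi n a) \<le> margin (Phi k a)"
  using assms(3)
proof (induction k rule: dec_induct)
  case (step k)
  then show ?case using in_core_f[of "Phi k a"] Phi_in assms by (auto simp: Phi_Suc)
qed (use assms in auto)

lemma groupoid_dist_bdd: "bdd_above (range (\<lambda>n. core_dist (Phi n a) (Phi n b) / lam ^ n))"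
proof (rule bdd_aboveI2)
  fix n
  have "core_dist (Phi n a) (Phi n b) / lam ^ n \<le> core_dist (Phi n a) (Phi n b) / 1"
    using lam_pow_ge_1 core_dist_nonneg by (intro divide_left_mono) auto
  then show "core_dist (Phi n a) (Phi n b) / lam ^ n \<le> 2 * core_radius" using core_dist_le[of "Phi n a" "Phi n b"] by simp
qed

lemma core_dist_le_groupoid_dist: "core_dist (Phi n a) (Phi n b) \<le> lam ^ n * groupoid_dist a b"
proof -
  have "core_dist (Phi n a) (Phi n b) / lam ^ n \<le> groupoid_dist a b"
    unfolding groupoid_dist_def by (rule cSUP_upper[OF _ groupoid_dist_bdd]) simp
  then show ?thesis by (simp add: divide_le_eq mult.commute)
qed

lemma groupoid_dist_le: assumes "\<And>n. core_dist (Phi n a) (Phi n b) \<le> lam ^ n * c" shows "groupoid_dist a b \<le> c"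
  unfolding groupoid_dist_def
  by (rule cSUP_least) (use assms in \<open>auto simp: divide_le_eq mult.commute\<close>)

lemma groupoid_dist_nonneg: "0 \<le> groupoid_dist a b"
  using core_dist_le_groupoid_dist[of 0 a b] core_dist_nonneg[of "Phi 0 a" "Phi 0 b"] by simp

lemma groupoid_dist_bounded: "groupoid_dist a b \<le> 2 * core_radius"
proof (rule groupoid_dist_le)
  fix n
  have "1 * (2 * core_radius) \<le> lam ^ n * (2 * core_radius)"
    using lam_pow_ge_1 core_radius_pos by (intro mult_right_mono) auto
  then show "core_dist (Phi n a) (Phi n b) \<le> lam ^ n * (2 * core_radius)" using core_dist_le[of "Phi n a" "Phi n b"] by simp
qed

lemma groupoid_dist_sym: "groupoid_dist a b = groupoid_dist b a" by (simp add: groupoid_dist_def core_dist_sym)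

lemma groupoid_dist_tri:
  assumes "a \<in> X \<times> X" "b \<in> X \<times> X" "c \<in> X \<times> X"
  shows "groupoid_dist a c \<le> groupoid_dist a b + groupoid_dist b c"
proof (rule groupoid_dist_le)
  fix n
  have "core_dist (Phi n a) (Phi n c) \<le> core_dist (Phi n a) (Phi n b) + core_dist (Phi n b) (Phi n c)"
    by (rule core_dist_tri) (use Phi_in assms in auto)
  also have "\<dots> \<le> lam ^ n * groupoid_dist a b + lam ^ n * groupoid_dist b c" by (intro add_mono core_dist_le_groupoid_dist)
  finally show "core_dist (Phi n a) (Phi n c) \<le> lam ^ n * (groupoid_dist a b + groupoid_dist b c)" by (simp add: distrib_left)
qed

lemma groupoid_dist_self: assumes "a \<in> X \<times> X" shows "groupoid_dist a a = 0"
proof -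
  have "groupoid_dist a a \<le> 0"
  proof (rule groupoid_dist_le)
    fix n
    have "pair_dist (Phi n a) (Phi n a) = 0" using assms funpow_f_in by (auto simp: pair_dist_def)
    then show "core_dist (Phi n a) (Phi n a) \<le> lam ^ n * 0"
      using margin_bounds[of "Phi n a"] by (auto simp: core_dist_def margin_def)
  qed
  then show ?thesis using groupoid_dist_nonneg[of a a] by simp
qed

lemma groupoid_dist_eq_0_imp_eq:
  assumes X: "a \<in> X \<times> X" "b \<in> X \<times> X" and in_core: "in_core (Phi j a)" "in_core (Phi k b)" and zero: "groupoid_dist a b = 0"
  shows "a = b"
proof -
  let ?n = "max j k"
  have s: "in_core (Phi ?n a)" "in_core (Phi ?n b)" using in_core_Phi[of a j ?n] in_core_Phi[of b k ?n] X in_core by auto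
  have "core_dist (Phi ?n a) (Phi ?n b) \<le> 0" using core_dist_le_groupoid_dist[of ?n a b] zero by simp
  then have "pair_dist (Phi ?n a) (Phi ?n b) \<le> 0"
    using margin_pos[OF s(1)] margin_pos[OF s(2)] s by (auto simp: core_dist_def min_def split: if_splits)
  then have "leaf_dist ((f ^^ ?n) (fst a)) ((f ^^ ?n) (fst b)) = 0"
      "leaf_dist ((f ^^ ?n) (snd a)) ((f ^^ ?n) (snd b)) = 0"
    using leaf_dist_nonneg[of "(f ^^ ?n) (fst a)" "(f ^^ ?n) (fst b)"]
      leaf_dist_nonneg[of "(f ^^ ?n) (snd a)" "(f ^^ ?n) (snd b)"]
    unfolding pair_dist_def fst_Phi snd_Phi by linarith+
  moreover have "leaf_dist (fst a) (fst b) \<le> leaf_dist ((f ^^ ?n) (fst a)) ((f ^^ ?n) (fst b))"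
      "leaf_dist (snd a) (snd b) \<le> leaf_dist ((f ^^ ?n) (snd a)) ((f ^^ ?n) (snd b))"
    using X by (auto intro!: leaf_dist_le_funpow)
  ultimately have "leaf_dist (fst a) (fst b) = 0" "leaf_dist (snd a) (snd b) = 0"
    using leaf_dist_nonneg[of "fst a" "fst b"] leaf_dist_nonneg[of "snd a" "snd b"] by linarith+
  then show ?thesis using X by (auto simp: prod_eq_iff)
qed

lemma groupoid_dist_metric:
  assumes "S \<subseteq> X \<times> X" "\<And>a. a \<in> S \<Longrightarrow> \<exists>n. in_core (Phi n a)"
  shows "Metric_space S groupoid_dist"
proof
  show "groupoid_dist a b = 0 \<longleftrightarrow> a = b" if "a \<in> S" "b \<in> S" for a b
  proof
    have X: "a \<in> X \<times> X" "b \<in> X \<times> X" using assms(1) that by auto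
    assume "groupoid_dist a b = 0"
    moreover obtain j k where "in_core (Phi j a)" "in_core (Phi k b)" using assms(2) \<open>a \<in> S\<close> \<open>b \<in> S\<close> by metis
    ultimately show "a = b" using groupoid_dist_eq_0_imp_eq X by metis
  next
    assume "a = b"
    then show "groupoid_dist a b = 0" using groupoid_dist_self assms(1) that by auto
  qed
  show "groupoid_dist a c \<le> groupoid_dist a b + groupoid_dist b c" if "a \<in> S" "b \<in> S" "c \<in> S" for a b c
    using groupoid_dist_tri assms(1) that by blast
qed (auto simp: groupoid_dist_nonneg groupoid_dist_sym)

text \<open>
  Both estimates for \<open>f \<times> f\<close> come from shifting the index in the supremum: here the terms for the images
  are those of the original pair with index one larger, and in \<open>groupoid_dist_le_map\<close> monotonicity of
  \<open>core_dist\<close> allows passing to the next index.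
\<close>

lemma groupoid_dist_map_le:
  "groupoid_dist (map_prod f f a) (map_prod f f b) \<le> lam * groupoid_dist a b"
proof (rule groupoid_dist_le)
  fix n
  show "core_dist (Phi n (map_prod f f a)) (Phi n (map_prod f f b)) \<le> lam ^ n * (lam * groupoid_dist a b)"
    using core_dist_le_groupoid_dist[of "Suc n" a b] by (simp add: Phi_Suc' algebra_simps)
qed

lemma groupoid_dist_le_map:
  assumes "a \<in> X \<times> X" "b \<in> X \<times> X"
  shows "groupoid_dist a b \<le> groupoid_dist (map_prod f f a) (map_prod f f b)"
proof (rule groupoid_dist_le)
  fix n
  have "core_dist (Phi n a) (Phi n b) \<le> core_dist (Phi (Suc n) a) (Phi (Suc n) b)"
    using assms by (intro core_dist_Phi_mono) auto
  also have "\<dots> \<le> lam ^ n * groupoid_dist (map_prod f f a) (map_prod f f b)"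
    unfolding Phi_Suc' by (rule core_dist_le_groupoid_dist)
  finally show "core_dist (Phi n a) (Phi n b) \<le> lam ^ n * groupoid_dist (map_prod f f a) (map_prod f f b)" .
qed

lemma groupoid_dist_swap:
  assumes "a \<in> X \<times> X" "b \<in> X \<times> X"
  shows "groupoid_dist (prod.swap a) (prod.swap b) = groupoid_dist a b"
proof -
  have "Phi n (prod.swap c) = prod.swap (Phi n c)" for n c by (cases c) (simp add: Phi_def)
  moreover have "core_dist (prod.swap a) (prod.swap b) = core_dist a b" if "a \<in> X \<times> X" "b \<in> X \<times> X" for a b
    using that in_core_swap by (auto simp: core_dist_def margin_def pair_dist_def mdist_commute add.commute)
  ultimately show ?thesis using Phi_in assms by (simp add: groupoid_dist_def)
qed

subsection \<open>Comparison of the two metrics\<close>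

text \<open>
  Terms before \<open>M\<close> are bounded by the one at \<open>M\<close> through monotonicity; afterwards \<open>pair_dist\<close> grows at
  most by the factor \<open>lam\<close> which the weights remove.
\<close>

lemma groupoid_dist_le_pair_dist:
  assumes X: "a \<in> X \<times> X" "b \<in> X \<times> X" and in_core: "in_core (Phi M a)" "in_core (Phi M b)"
  shows "groupoid_dist a b \<le> pair_dist (Phi M a) (Phi M b)"
proof (rule groupoid_dist_le)
  fix n
  let ?groupoid_dist = "pair_dist (Phi M a) (Phi M b)"
  have rM: "core_dist (Phi M a) (Phi M b) \<le> ?groupoid_dist" using in_core by (simp add: core_dist_def)
  show "core_dist (Phi n a) (Phi n b) \<le> lam ^ n * ?groupoid_dist"
  proof (cases "n \<le> M")
    case True
    have "1 * ?groupoid_dist \<le> lam ^ n * ?groupoid_dist" using lam_pow_ge_1 pair_dist_nonneg by (intro mult_right_mono) auto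
    then show ?thesis using core_dist_Phi_mono[OF X True] rM by simp
  next
    case False
    then obtain k where n: "n = k + M" by (metis le_Suc_ex add.commute nat_le_linear)
    have s: "in_core (Phi n a)" "in_core (Phi n b)" using in_core_Phi[of a M n] in_core_Phi[of b M n] X in_core n by auto
    have LX: "fst (Phi M a) \<in> X" "snd (Phi M a) \<in> X" "fst (Phi M b) \<in> X" "snd (Phi M b) \<in> X"
      using X funpow_f_in by auto
    have "core_dist (Phi n a) (Phi n b) \<le> pair_dist (Phi n a) (Phi n b)" using s by (simp add: core_dist_def)
    also have "\<dots> = pair_dist (Phi k (Phi M a)) (Phi k (Phi M b))" by (simp add: n Phi_add)
    also have "\<dots> \<le> lam ^ k * ?groupoid_dist"
      unfolding pair_dist_def fst_Phi[of k] snd_Phi[of k] distrib_left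
      by (intro add_mono leaf_dist_funpow_le LX)
    also have "\<dots> \<le> lam ^ n * ?groupoid_dist"
      using pair_dist_nonneg lam_gt_1 by (intro mult_right_mono power_increasing) (auto simp: n)
    finally show ?thesis .
  qed
qed

text \<open>
  An element closer to \<open>a\<close> than the margin cannot be joined to \<open>a\<close> through the collapsed point.
\<close>

lemma groupoid_dist_local:
  assumes X: "a \<in> X \<times> X" "b \<in> X \<times> X" and in_core: "in_core (Phi M a)"
    and less: "lam ^ M * groupoid_dist a b < margin (Phi M a)"
  shows "in_core (Phi M b) \<and> pair_dist (Phi M a) (Phi M b) \<le> lam ^ M * groupoid_dist a b \<and> pair_dist (Phi M a) (Phi M b) < E"
proof -
  have r: "core_dist (Phi M a) (Phi M b) < margin (Phi M a)" using core_dist_le_groupoid_dist[of M a b] less by simp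
  have b: "in_core (Phi M b)" using r by (auto simp: core_dist_def margin_def split: if_splits)
  then have "pair_dist (Phi M a) (Phi M b) = core_dist (Phi M a) (Phi M b)"
    using r in_core margin_pos[OF b] by (auto simp: core_dist_def min_def split: if_splits)
  then show ?thesis using b core_dist_le_groupoid_dist[of M a b] r margin_bounds[of "Phi M a"] core_radius_less_E by auto
qed

lemma leaf_dist_le_pair_dist_Phi:
  assumes "a \<in> X \<times> X" "b \<in> X \<times> X"
  shows "leaf_dist (fst a) (fst b) \<le> pair_dist (Phi M a) (Phi M b)" "leaf_dist (snd a) (snd b) \<le> pair_dist (Phi M a) (Phi M b)"
  using assms leaf_dist_le_funpow[of "fst a" "fst b" M] leaf_dist_le_funpow[of "snd a" "snd b" M]
    leaf_dist_le_pair_dist[of "Phi M a" "Phi M b"]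
  by auto

lemma groupoid_dist_le_leaf_dist_snd:
  assumes X: "a \<in> X \<times> X" "b \<in> X \<times> X" and in_core: "in_core (Phi M a)" "in_core (Phi M b)"
    and less: "leaf_dist (fst (Phi M a)) (fst (Phi M b)) < E"
  shows "groupoid_dist a b \<le> 3 * lam ^ M * leaf_dist (snd a) (snd b)"
proof -
  have "groupoid_dist a b \<le> pair_dist (Phi M a) (Phi M b)" by (rule groupoid_dist_le_pair_dist[OF X in_core])
  also have "\<dots> \<le> 3 * leaf_dist (snd (Phi M a)) (snd (Phi M b))"
    using holonomy_fst[OF Phi_in Phi_in in_core less] X by (simp add: pair_dist_def)
  also have "\<dots> \<le> 3 * (lam ^ M * leaf_dist (snd a) (snd b))"
    using leaf_dist_funpow_le[of "snd a" "snd b" M] X by auto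
  finally show ?thesis by simp
qed

lemma snd_local_bilip:
  assumes X: "a \<in> X \<times> X" "b \<in> X \<times> X" and in_core: "in_core (Phi M a)"
    and less: "lam ^ M * groupoid_dist a b < margin (Phi M a)"
  shows "leaf_dist (snd a) (snd b) \<le> lam ^ M * groupoid_dist a b" "groupoid_dist a b \<le> 3 * lam ^ M * leaf_dist (snd a) (snd b)"
proof -
  note l = groupoid_dist_local[OF X in_core less]
  then show "leaf_dist (snd a) (snd b) \<le> lam ^ M * groupoid_dist a b" using leaf_dist_le_pair_dist_Phi(2)[OF X, of M] by linarith
  have "leaf_dist (fst (Phi M a)) (fst (Phi M b)) < E"
    using l leaf_dist_le_pair_dist(1)[of "Phi M a" "Phi M b"] by linarith
  then show "groupoid_dist a b \<le> 3 * lam ^ M * leaf_dist (snd a) (snd b)" using groupoid_dist_le_leaf_dist_snd X in_core l by blast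
qed

text \<open>
  Pairs at small distance are covered by the local estimate.  For the others both distances are bounded,
  so what matters is that neither is small alone: for the groupoid distance this is the lower bound
  on the margin, for the leaf distance the uniform continuity hypothesis.
\<close>

lemma snd_bilip_on:
  assumes V: "V \<subseteq> X \<times> X" and in_core: "\<And>a. a \<in> V \<Longrightarrow> in_core (Phi M a) \<and> core_radius / 2 \<le> margin (Phi M a)"
    and t: "0 < t" "\<And>a b. a \<in> V \<Longrightarrow> b \<in> V \<Longrightarrow> leaf_dist (snd a) (snd b) < t \<Longrightarrow>
        leaf_dist (fst (Phi M a)) (fst (Phi M b)) < E"
  shows "\<exists>C>0. \<forall>a\<in>V. \<forall>b\<in>V. leaf_dist (snd a) (snd b) \<le> C * groupoid_dist a b \<and> groupoid_dist a b \<le> C * leaf_dist (snd a) (snd b)"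
proof -
  define C where "C = 3 * lam ^ M + 2 * E * lam ^ M / core_radius + 2 * core_radius / t"
  have pos: "0 < 3 * lam ^ M" "0 < 2 * E * lam ^ M / core_radius" "0 < 2 * core_radius / t"
    using core_radius_pos E_pos t by auto
  have "leaf_dist (snd a) (snd b) \<le> C * groupoid_dist a b \<and> groupoid_dist a b \<le> C * leaf_dist (snd a) (snd b)"
    if ab: "a \<in> V" "b \<in> V" for a b
  proof
    have X: "a \<in> X \<times> X" "b \<in> X \<times> X" using V ab by auto
    have C: "3 * lam ^ M \<le> C" "2 * E * lam ^ M / core_radius \<le> C" "2 * core_radius / t \<le> C"
      using pos unfolding C_def by linarith+
    have CD: "c \<le> C \<Longrightarrow> c * groupoid_dist a b \<le> C * groupoid_dist a b" for c by (simp add: groupoid_dist_nonneg mult_right_mono)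
    have CDt: "c \<le> C \<Longrightarrow> c * leaf_dist (snd a) (snd b) \<le> C * leaf_dist (snd a) (snd b)" for c
      by (simp add: mult_right_mono)
    show "leaf_dist (snd a) (snd b) \<le> C * groupoid_dist a b"
    proof (cases "lam ^ M * groupoid_dist a b < margin (Phi M a)")
      case True
      have "lam ^ M * groupoid_dist a b \<le> 3 * lam ^ M * groupoid_dist a b"
        using groupoid_dist_nonneg by (intro mult_right_mono) (auto intro: less_imp_le)
      then show ?thesis
        using snd_local_bilip(1)[OF X conjunct1[OF in_core[OF ab(1)]] True] CD[OF C(1)] by linarith
    next
      case False
      then have "core_radius / 2 \<le> lam ^ M * groupoid_dist a b" using in_core ab by fastforce
      then have "E \<le> 2 * E * lam ^ M / core_radius * groupoid_dist a b"
        using core_radius_pos E_pos by (simp add: field_simps)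
      then show ?thesis using leaf_dist_le_E[of "snd a" "snd b"] CD[OF C(2)] by linarith
    qed
    show "groupoid_dist a b \<le> C * leaf_dist (snd a) (snd b)"
    proof (cases "leaf_dist (snd a) (snd b) < t")
      case True
      then have "groupoid_dist a b \<le> 3 * lam ^ M * leaf_dist (snd a) (snd b)"
        using groupoid_dist_le_leaf_dist_snd[OF X] in_core ab t(2) by blast
      then show ?thesis using CDt[OF C(1)] by linarith
    next
      case False
      then have "2 * core_radius \<le> 2 * core_radius / t * leaf_dist (snd a) (snd b)"
        using t core_radius_pos by (simp add: field_simps)
      then show ?thesis using groupoid_dist_bounded[of a b] CDt[OF C(3)] by linarith
    qed
  qed
  moreover have "0 < C" using pos unfolding C_def by linarith
  ultimately show ?thesis by blast
qed

lemma Phi_swap: "Phi n (prod.swap a) = prod.swap (Phi n a)"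
  by (cases a) (simp add: Phi_def)

lemma margin_swap: "a \<in> X \<times> X \<Longrightarrow> margin (prod.swap a) = margin a"
  using in_core_swap by (auto simp: margin_def mdist_commute)

lemma fst_bilip_on:
  assumes V: "V \<subseteq> X \<times> X" and in_core: "\<And>a. a \<in> V \<Longrightarrow> in_core (Phi M a) \<and> core_radius / 2 \<le> margin (Phi M a)"
    and t: "0 < t" "\<And>a b. a \<in> V \<Longrightarrow> b \<in> V \<Longrightarrow> leaf_dist (fst a) (fst b) < t \<Longrightarrow>
        leaf_dist (snd (Phi M a)) (snd (Phi M b)) < E"
  shows "\<exists>C>0. \<forall>a\<in>V. \<forall>b\<in>V. leaf_dist (fst a) (fst b) \<le> C * groupoid_dist a b \<and> groupoid_dist a b \<le> C * leaf_dist (fst a) (fst b)"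
proof -
  have "\<exists>C>0. \<forall>a\<in>prod.swap ` V. \<forall>b\<in>prod.swap ` V.
      leaf_dist (snd a) (snd b) \<le> C * groupoid_dist a b \<and> groupoid_dist a b \<le> C * leaf_dist (snd a) (snd b)"
  proof (rule snd_bilip_on[OF _ _ t(1)])
    show "prod.swap ` V \<subseteq> X \<times> X" using V by auto
    show "in_core (Phi M a) \<and> core_radius / 2 \<le> margin (Phi M a)" if a: "a \<in> prod.swap ` V" for a
    proof -
      obtain b where b: "b \<in> V" "a = prod.swap b" using a by blast
      then have "Phi M b \<in> X \<times> X" using Phi_in V by blast
      then show ?thesis using in_core[OF b(1)] b by (simp add: Phi_swap in_core_swap margin_swap)
    qed
  qed (use t(2) in \<open>auto simp: Phi_swap\<close>)
  then obtain C where C: "C > 0" "\<forall>a\<in>prod.swap ` V. \<forall>b\<in>prod.swap ` V.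
      leaf_dist (snd a) (snd b) \<le> C * groupoid_dist a b \<and> groupoid_dist a b \<le> C * leaf_dist (snd a) (snd b)" by blast
  show ?thesis
  proof (intro exI[of _ C] conjI ballI)
    fix a b assume ab: "a \<in> V" "b \<in> V"
    then have "groupoid_dist (prod.swap a) (prod.swap b) = groupoid_dist a b" using groupoid_dist_swap V by blast
    moreover have "prod.swap a \<in> prod.swap ` V" "prod.swap b \<in> prod.swap ` V" using ab by auto
    ultimately show "leaf_dist (fst a) (fst b) \<le> C * groupoid_dist a b" "groupoid_dist a b \<le> C * leaf_dist (fst a) (fst b)"
      using C(2) by (metis snd_swap)+
  qed (rule C(1))
qed

text \<open>
  Local injectivity of the source map: by the holonomy estimate the ranges of two such elements are at
  leaf distance at most twice that of their sources, which is \<open>0\<close>.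
\<close>

lemma groupoid_dist_close_same_source:
  assumes X: "a \<in> X \<times> X" "b \<in> X \<times> X" "b' \<in> X \<times> X" and in_core: "in_core (Phi M a)"
    and less: "lam ^ M * groupoid_dist a b < margin (Phi M a) / 2" "lam ^ M * groupoid_dist a b' < margin (Phi M a) / 2"
    and eq: "snd b = snd b'"
  shows "b = b'"
proof -
  have lt: "lam ^ M * groupoid_dist a b < margin (Phi M a)" "lam ^ M * groupoid_dist a b' < margin (Phi M a)"
    using less margin_pos[OF in_core] by linarith+
  note l = groupoid_dist_local[OF X(1,2) in_core lt(1)] and l' = groupoid_dist_local[OF X(1,3) in_core lt(2)]
  have "pair_dist (Phi M b) (Phi M b') \<le> pair_dist (Phi M b) (Phi M a) + pair_dist (Phi M a) (Phi M b')"
    using Phi_in X by (intro pair_dist_tri) auto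
  then have "pair_dist (Phi M b) (Phi M b') < E"
    using l l' less pair_dist_sym[of "Phi M b" "Phi M a"] margin_bounds[of "Phi M a"] core_radius_less_E by linarith
  then have "leaf_dist (fst (Phi M b)) (fst (Phi M b')) < E"
    using leaf_dist_le_pair_dist(1)[of "Phi M b" "Phi M b'"] by linarith
  then have "leaf_dist (fst (Phi M b)) (fst (Phi M b')) \<le> 2 * leaf_dist (snd (Phi M b)) (snd (Phi M b'))"
    using holonomy_fst[OF Phi_in Phi_in] X l l' by blast
  moreover have "leaf_dist (snd (Phi M b)) (snd (Phi M b')) = 0" using eq X(3) funpow_f_in by auto
  ultimately have "leaf_dist (fst (Phi M b)) (fst (Phi M b')) \<le> 0" by simp
  then have "leaf_dist (fst b) (fst b') \<le> 0" using leaf_dist_le_funpow[of "fst b" "fst b'" M] X by auto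
  then have "leaf_dist (fst b) (fst b') = 0" using leaf_dist_nonneg[of "fst b" "fst b'"] by simp
  then show ?thesis using X eq by (auto simp: prod_eq_iff)
qed

end

section \<open>Groupoids and their basic open sets\<close>

definition stable_groupoid :: "'a metric \<Rightarrow> ('a \<Rightarrow> 'a) \<Rightarrow> ('a \<Rightarrow> 'a) \<Rightarrow> 'a set \<Rightarrow> ('a \<times> 'a) set" where
  "stable_groupoid m f g Q = {(v, w). v \<in> stable_union m g Q \<and> w \<in> stable_union m g Q \<and>
                        w \<in> global_stable m f v}"

text \<open>
  For \<open>f = \<phi>\<close> and \<open>g = \<phi>\<inverse>\<close> these are \<open>Gs\<close> and \<open>base_s\<close>; with \<open>f\<close> and \<open>g\<close> exchanged and the bracket flipped they
  are \<open>Gu\<close> and \<open>base_u\<close>.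
\<close>

definition base_charts ::
  "'a metric \<Rightarrow> ('a \<Rightarrow> 'a) \<Rightarrow> ('a \<Rightarrow> 'a) \<Rightarrow> real \<Rightarrow> ('a \<Rightarrow> 'a \<Rightarrow> 'a) \<Rightarrow> real \<Rightarrow> 'a set \<Rightarrow> ('a \<times> 'a) set set" where
  "base_charts m f g E br e Q =
     {(\<lambda>z. ((g ^^ N) (br ((f ^^ N) z) ((f ^^ N) v)), z)) ` local_unstable m br w \<eta> | v w N \<eta>.
        (v, w) \<in> stable_groupoid m f g Q \<and>
        (f ^^ N) w \<in> local_stable m br ((f ^^ N) v) (e / 2) \<and>
        0 < \<eta> \<and> \<eta> \<le> E / 2 \<and>
        (f ^^ N) ` local_unstable m br w \<eta> \<subseteq> local_unstable m br ((f ^^ N) w) (e / 2)}"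

context smale_pair
begin

lemma global_stable_sym: "y \<in> global_stable m f x \<Longrightarrow> x \<in> X \<Longrightarrow> x \<in> global_stable m f y"
  by (simp add: global_stable_def mdist_commute)

lemma global_stable_self: "x \<in> X \<Longrightarrow> x \<in> global_stable m f x"
  by (simp add: global_stable_def funpow_f_in)

lemma global_stable_trans:
  assumes "x \<in> X" "y \<in> global_stable m f x" "z \<in> global_stable m f y"
  shows "z \<in> global_stable m f x"
proof -
  have yz: "y \<in> X" "z \<in> X" using assms by (auto simp: global_stable_def)
  have "(\<lambda>n. d ((f ^^ n) x) ((f ^^ n) y) + d ((f ^^ n) y) ((f ^^ n) z)) \<longlonglongrightarrow> 0 + 0"
    using assms unfolding global_stable_def by (intro tendsto_add) auto
  then have lim: "(\<lambda>n. d ((f ^^ n) x) ((f ^^ n) y) + d ((f ^^ n) y) ((f ^^ n) z)) \<longlonglongrightarrow> 0"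
    by simp
  have le: "d ((f ^^ n) x) ((f ^^ n) z) \<le> d ((f ^^ n) x) ((f ^^ n) y) + d ((f ^^ n) y) ((f ^^ n) z)" for n
    using assms(1) yz by (intro mdist_triangle funpow_f_in)
  have "(\<lambda>n. d ((f ^^ n) x) ((f ^^ n) z)) \<longlonglongrightarrow> 0"
    by (rule real_tendsto_sandwich[OF _ _ tendsto_const lim]) (simp_all add: le)
  then show ?thesis using yz by (simp add: global_stable_def)
qed

lemma global_stable_funpow:
  assumes "x \<in> X" "y \<in> X"
  shows "(f ^^ k) y \<in> global_stable m f ((f ^^ k) x) \<longleftrightarrow> y \<in> global_stable m f x"
proof -
  define u where "u n = d ((f ^^ n) x) ((f ^^ n) y)" for n
  have "d ((f ^^ n) ((f ^^ k) x)) ((f ^^ n) ((f ^^ k) y)) = u (n + k)" for n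
    by (simp add: u_def funpow_add)
  then have "(f ^^ k) y \<in> global_stable m f ((f ^^ k) x) \<longleftrightarrow> (\<lambda>n. u (n + k)) \<longlonglongrightarrow> 0"
    using assms funpow_f_in by (simp add: global_stable_def)
  also have "\<dots> \<longleftrightarrow> u \<longlonglongrightarrow> 0"
    using LIMSEQ_ignore_initial_segment[of u 0 k] LIMSEQ_offset[of u k 0] by blast
  also have "\<dots> \<longleftrightarrow> y \<in> global_stable m f x"
    using assms by (simp add: global_stable_def u_def[abs_def])
  finally show ?thesis .
qed

lemma stable_imp_global_stable:
  assumes "x \<in> X" "y \<in> X" "br x y = y" "d x y < E"
  shows "y \<in> global_stable m f x"
proof -
  have "(\<lambda>n. d ((f ^^ n) x) ((f ^^ n) y)) \<longlonglongrightarrow> 0"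
  proof (rule real_tendsto_sandwich[OF _ _ tendsto_const])
    show "(\<lambda>n. d x y / lam ^ n) \<longlonglongrightarrow> 0" using lam_gt_1 LIMSEQ_divide_realpow_zero by blast
  qed (simp_all add: stable_iter[OF assms])
  then show ?thesis using assms by (simp add: global_stable_def)
qed

lemma global_stable_eventually_stable:
  assumes "x \<in> X" "y \<in> global_stable m f x" "0 < k"
  shows "\<exists>N. br ((f ^^ N) x) ((f ^^ N) y) = (f ^^ N) y \<and> d ((f ^^ N) x) ((f ^^ N) y) < k"
proof -
  obtain r where r: "bracket_radius m E br r" using ex_bracket_radius by blast
  then have pos: "0 < min r k" using assms by (simp add: bracket_radius_def)
  have y: "y \<in> X" "(\<lambda>n. d ((f ^^ n) x) ((f ^^ n) y)) \<longlonglongrightarrow> 0"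
    using assms by (auto simp: global_stable_def)
  obtain N where N: "\<And>n. n \<ge> N \<Longrightarrow> d ((f ^^ n) x) ((f ^^ n) y) < min r k"
    using LIMSEQ_D[OF y(2) pos] by auto
  have "d ((f ^^ n) ((f ^^ N) x)) ((f ^^ n) ((f ^^ N) y)) \<le> r" for n
    using N[of "n + N"] by (simp add: funpow_add)
  then have "br ((f ^^ N) x) ((f ^^ N) y) = (f ^^ N) y"
    using assms(1) y(1) by (intro close_orbits_stable[OF r]) (simp_all add: funpow_f_in)
  then show ?thesis using N[of N] by auto
qed

lemma stable_union_in: "Q \<subseteq> X \<Longrightarrow> stable_union m f Q \<subseteq> X"
  by (auto simp: stable_union_def global_stable_def)

lemma stable_union_closed:
  assumes "Q \<subseteq> X" "x \<in> stable_union m f Q" "y \<in> global_stable m f x"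
  shows "y \<in> stable_union m f Q"
  using assms global_stable_trans unfolding stable_union_def by blast

end

locale base_chart = smale_pair +
  fixes e :: real and Q :: "'a set" and v w :: 'a and N :: nat and \<eta> :: real
  assumes radius: "bracket_radius m E br e"
    and Q: "Q \<subseteq> mspace m"
    and vw: "(v, w) \<in> stable_groupoid m f g Q"
    and centre: "(f ^^ N) w \<in> local_stable m br ((f ^^ N) v) (e / 2)"
    and eta: "0 < \<eta>" "\<eta> \<le> E / 2"
    and small: "(f ^^ N) ` local_unstable m br w \<eta> \<subseteq> local_unstable m br ((f ^^ N) w) (e / 2)"
begin

definition h :: "'a \<Rightarrow> 'a" where "h z = (g ^^ N) (br ((f ^^ N) z) ((f ^^ N) v))"

definition chart :: "('a \<times> 'a) set" where "chart = (\<lambda>z. (h z, z)) ` local_unstable m br w \<eta>"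

lemma vw_in: "v \<in> X" "w \<in> X"
  using vw Q smale_pair.stable_union_in[OF dual] by (auto simp: stable_groupoid_def)

lemma e_bounds: "0 < e" "e \<le> E / 2" using radius by (auto simp: bracket_radius_def)

text \<open>
  The identity \<open>zz = [hh, ww]\<close> recovers the source from the range by a formula of the same
  kind as \<open>hh = [zz, vv]\<close>, with \<open>ww\<close> in place of \<open>vv\<close>.  It makes range and source of a basic set interchangeable.
\<close>

lemma chart_point:
  assumes z: "z \<in> local_unstable m br w \<eta>"
  defines "zz \<equiv> (f ^^ N) z" and "vv \<equiv> (f ^^ N) v" and "ww \<equiv> (f ^^ N) w" and "hh \<equiv> (f ^^ N) (h z)"
  shows "z \<in> X" "h z \<in> X" "hh = br zz vv" "zz = br hh ww"
    "d zz vv \<le> E" "d hh vv \<le> E / 2" "d hh ww \<le> E" "d zz ww \<le> E / 2"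
    "br hh zz = zz" "d hh zz < E" "br hh vv = hh"
proof -
  interpret du: smale_pair m g f E lam "\<lambda>x y. br y x" by (rule dual)
  show zX: "z \<in> X" using z by (simp add: local_unstable_def)
  have X: "zz \<in> X" "vv \<in> X" "ww \<in> X" using zX vw_in funpow_f_in by (auto simp: zz_def vv_def ww_def)
  have vvww: "br vv ww = ww" "d vv ww < e / 2"
    using centre by (auto simp: local_stable_def vv_def ww_def)
  have "zz \<in> local_unstable m br ww (e / 2)" using z small by (auto simp: zz_def ww_def)
  then have zzww: "br zz ww = zz" "d ww zz < e / 2" by (auto simp: local_unstable_def)
  have le: "d zz vv \<le> e"
    using mdist_triangle[of zz m ww vv] X zzww vvww by (simp add: mdist_commute)
  then show zzvv: "d zz vv \<le> E" using e_bounds E_pos by simp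
  let ?b = "br zz vv"
  have b: "?b \<in> X" using br_in X zzvv by blast
  show hX: "h z \<in> X" using b du.funpow_f_in by (simp add: h_def zz_def vv_def)
  show hh: "hh = br zz vv" using du.funpow_gf[OF b] by (simp add: hh_def h_def zz_def vv_def)
  have bd: "d zz hh < E / 2" "d vv hh < E / 2" using radius X le by (auto simp: bracket_radius_def hh)
  show "d hh vv \<le> E / 2" using bd by (simp add: mdist_commute)
  show "d zz ww \<le> E / 2" using zzww e_bounds E_pos by (simp add: mdist_commute)
  have "d hh ww \<le> d hh zz + d zz ww" using b X by (intro mdist_triangle) (auto simp: hh)
  then show hhww: "d hh ww \<le> E" using bd zzww e_bounds E_pos by (simp add: mdist_commute)
  show "zz = br hh ww" using br_left[of zz vv ww] X zzvv hhww zzww e_bounds E_pos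
    by (simp add: hh mdist_commute)
  have "br zz hh = hh" using br_right[of zz zz vv] X zzvv bd E_pos by (simp add: hh)
  then show "br hh zz = zz" using stable_sym[of zz hh] X b bd E_pos by (simp add: hh)
  show "d hh zz < E" using bd E_pos by (simp add: mdist_commute)
  show "br hh vv = hh" using br_left[of zz vv vv] X zzvv bd E_pos by (simp add: hh mdist_commute)
qed

lemma h_centre: "h w = v"
proof -
  interpret du: smale_pair m g f E lam "\<lambda>x y. br y x" by (rule dual)
  have "br ((f ^^ N) w) ((f ^^ N) v) = (f ^^ N) v"
    using stable_sym[of "(f ^^ N) v" "(f ^^ N) w"] centre vw_in funpow_f_in e_bounds E_pos
    by (auto simp: local_stable_def)
  then show ?thesis using vw_in funpow_gf by (simp add: h_def)
qed

lemma centre_in: "w \<in> local_unstable m br w \<eta>"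
  using vw_in eta by (simp add: local_unstable_def br_idem)

lemma chart_subset: "chart \<subseteq> stable_groupoid m f g Q"
proof -
  interpret du: smale_pair m g f E lam "\<lambda>x y. br y x" by (rule dual)
  have "(h z, z) \<in> stable_groupoid m f g Q" if z: "z \<in> local_unstable m br w \<eta>" for z
  proof -
    note p = chart_point[OF z]
    have vwQ: "v \<in> stable_union m g Q" "w \<in> stable_union m g Q"
      using vw by (auto simp: stable_groupoid_def)
    have "z \<in> global_stable m g w"
      using du.stable_imp_global_stable[of w z] z vw_in eta E_pos by (auto simp: local_unstable_def)
    then have zQ: "z \<in> stable_union m g Q" using du.stable_union_closed Q vwQ by blast
    have "(f ^^ N) (h z) \<in> global_stable m g ((f ^^ N) v)"
      using p(6) E_pos
      by (intro du.stable_imp_global_stable funpow_f_in vw_in p(2,11)) (simp add: mdist_commute)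
    then have "(g ^^ N) ((f ^^ N) (h z)) \<in> global_stable m g ((g ^^ N) ((f ^^ N) v))"
      using du.global_stable_funpow[of "(f ^^ N) v" "(f ^^ N) (h z)" N]
        funpow_f_in[OF vw_in(1)] funpow_f_in[OF p(2)] by blast
    then have "h z \<in> global_stable m g v" by (simp only: funpow_gf[OF p(2)] funpow_gf[OF vw_in(1)])
    then have hQ: "h z \<in> stable_union m g Q" using du.stable_union_closed Q vwQ by blast
    have "(f ^^ N) z \<in> global_stable m f ((f ^^ N) (h z))"
      by (intro stable_imp_global_stable funpow_f_in p(1,2,9,10))
    then have "z \<in> global_stable m f (h z)" using global_stable_funpow[OF p(2,1)] by blast
    then show ?thesis using zQ hQ by (simp add: stable_groupoid_def)
  qed
  then show ?thesis by (auto simp: chart_def)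
qed

lemma chart_shrink:
  assumes "0 < \<eta>'" "\<eta>' \<le> \<eta>"
  shows "(\<lambda>z. (h z, z)) ` local_unstable m br w \<eta>' \<in> base_charts m f g E br e Q"
proof -
  have "local_unstable m br w \<eta>' \<subseteq> local_unstable m br w \<eta>"
    using assms by (auto simp: local_unstable_def)
  then have "(f ^^ N) ` local_unstable m br w \<eta>' \<subseteq> local_unstable m br ((f ^^ N) w) (e / 2)"
    using small by blast
  moreover have "\<eta>' \<le> E / 2" using assms eta by simp
  ultimately show ?thesis
    unfolding base_charts_def h_def mem_Collect_eq
    by (intro exI[of _ v] exI[of _ w] exI[of _ N] exI[of _ \<eta>'] conjI refl vw centre assms(1))
qed

end

text \<open>
  The iterate \<open>N\<close> comes from asymptotic stability.  The radius \<open>\<eta>\<close> is small enough to control all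
  iterates up to \<open>N\<close>, since the equivariance of the bracket can only be used while the images stay close.
\<close>

lemma (in smale_pair) ex_base_chart:
  assumes "bracket_radius m E br e" "Q \<subseteq> X" "(v, w) \<in> stable_groupoid m f g Q"
  shows "\<exists>N \<eta>. base_chart m f g E lam br e Q v w N \<eta>"
proof -
  interpret du: smale_pair m g f E lam "\<lambda>x y. br y x" by (rule dual)
  have e: "0 < e" "e \<le> E / 2" using assms by (auto simp: bracket_radius_def)
  have vw: "v \<in> X" "w \<in> X" "w \<in> global_stable m f v"
    using assms du.stable_union_in by (auto simp: stable_groupoid_def)
  obtain N where N: "br ((f ^^ N) v) ((f ^^ N) w) = (f ^^ N) w" "d ((f ^^ N) v) ((f ^^ N) w) < e / 2"
    using global_stable_eventually_stable[of v w "e/2"] vw e by auto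
  have "\<exists>t>0. \<forall>k\<le>N. \<forall>x\<in>X. \<forall>y\<in>X. d x y < t \<longrightarrow> d ((f ^^ k) x) ((f ^^ k) y) < e / 2" for N
  proof (induction N)
    case 0
    then show ?case using e by (intro exI[of _ "e/2"]) auto
  next
    case (Suc N)
    then obtain t where t: "t > 0" "\<forall>k\<le>N. \<forall>x\<in>X. \<forall>y\<in>X. d x y < t \<longrightarrow> d ((f ^^ k) x) ((f ^^ k) y) < e / 2"
      by blast
    obtain s where "s > 0" "\<forall>x\<in>X. \<forall>y\<in>X. d x y < s \<longrightarrow> d ((f ^^ Suc N) x) ((f ^^ Suc N) y) < e / 2"
      using funpow_f_uc[of "e/2" "Suc N"] e by (auto simp del: funpow.simps)
    then show ?case using t
      by (intro exI[of _ "min s t"]) (auto simp: le_Suc_eq simp del: funpow.simps)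
  qed
  then obtain t where t: "t > 0" "\<And>k x y. k \<le> N \<Longrightarrow> x \<in> X \<Longrightarrow> y \<in> X \<Longrightarrow> d x y < t \<Longrightarrow> d ((f ^^ k) x) ((f ^^ k) y) < e / 2"
    by metis
  define \<eta> where "\<eta> = min t (E / 2)"
  have "(f ^^ k) z \<in> local_unstable m br ((f ^^ k) w) (e / 2)"
    if z: "z \<in> local_unstable m br w \<eta>" and k: "k \<le> N" for z k
  proof -
    have zw: "z \<in> X" "d w z < \<eta>" "br z w = z" using z by (auto simp: local_unstable_def)
    then have c: "d ((f ^^ j) w) ((f ^^ j) z) < e / 2" if "j \<le> N" for j
      using t(2)[OF that vw(2) zw(1)] by (simp add: \<eta>_def)
    have "br ((f ^^ k) z) ((f ^^ k) w) = (f ^^ k) z" using k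
    proof (induction k)
      case (Suc k)
      then show ?case
        using br_f[of "(f ^^ k) z" "(f ^^ k) w"] c[of k] c[of "Suc k"] e E_pos zw vw funpow_f_in
        by (simp add: mdist_commute)
    qed (use zw in simp)
    then show ?thesis using c[OF k] zw funpow_f_in by (simp add: local_unstable_def)
  qed
  then have "base_chart m f g E lam br e Q v w N \<eta>"
    using assms N vw t E_pos funpow_f_in
    by unfold_locales (auto simp: \<eta>_def local_stable_def)
  then show ?thesis by blast
qed

section \<open>Basic sets of one structure in the metric of another\<close>

lemma (in Metric_space) mtopology_eq_topology_generated_by:
  assumes "\<And>V. V \<in> B \<Longrightarrow> openin mtopology V"
    and "\<And>a r. a \<in> M \<Longrightarrow> 0 < r \<Longrightarrow> \<exists>V\<in>B. a \<in> V \<and> V \<subseteq> mball a r"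
  shows "mtopology = topology_generated_by B"
proof (rule topology_eq[THEN iffD2], intro allI iffI)
  fix U assume U: "openin mtopology U"
  have "\<exists>V. openin (topology_generated_by B) V \<and> a \<in> V \<and> V \<subseteq> U" if a: "a \<in> U" for a
  proof -
    obtain r where "r > 0" "mball a r \<subseteq> U" "a \<in> M" using U a openin_mtopology by blast
    then show ?thesis using assms(2) topology_generated_by_Basis by (metis subset_trans)
  qed
  then show "openin (topology_generated_by B) U" by (subst openin_subopen) blast
next
  fix U assume "openin (topology_generated_by B) U"
  then have "generate_topology_on B U" by (simp add: openin_topology_generated_by_iff)
  then show "openin mtopology U"
    by induction (auto intro: assms(1))
qed

locale two_structures = A: selfsim_pair m f g E lam br + B: smale_pair m2 f g E2 lam2 br2
  for m f g E lam br m2 E2 lam2 br2 +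
  assumes unif12: "unif_finer m m2" and unif21: "unif_finer m2 m"
begin

lemma space_eq: "mspace m2 = mspace m" using unif12 by (simp add: unif_finer_def)

text \<open>
  Holonomy to a fixed leaf is uniformly continuous for the leaf distance: uniform continuity of the
  bracket gives closeness in the space, the points \<open>[y, p]\<close> and \<open>[y', p]\<close> lie on the local unstable leaf
  of \<open>p\<close>, and \<open>unstable_transfer\<close> turns this into closeness on a local leaf of the first structure.
\<close>

lemma bracket_uniform_leaf:
  assumes "0 < s"
  shows "\<exists>t>0. \<forall>p\<in>mspace m. \<forall>y\<in>mspace m. \<forall>y'\<in>mspace m.
    mdist m2 y p \<le> E2 \<longrightarrow> mdist m2 y' p \<le> E2 \<longrightarrow>
    mdist m2 (br2 y p) p \<le> E2 / 2 \<longrightarrow> mdist m2 (br2 y' p) p \<le> E2 / 2 \<longrightarrow>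
    A.leaf_dist y y' < t \<longrightarrow> A.leaf_dist (br2 y p) (br2 y' p) < s"
proof -
  have "0 < min s E" using assms A.E_pos by simp
  then obtain t1 where t1: "t1 > 0" "\<And>x y. x \<in> mspace m \<Longrightarrow> y \<in> mspace m \<Longrightarrow>
      br2 y x = y \<Longrightarrow> mdist m2 x y < t1 \<Longrightarrow> br y x = y \<and> mdist m x y < min s E"
    using unstable_transfer[OF A.smale_pair_axioms B.smale_pair_axioms unif21] by metis
  obtain t2 where t2: "t2 > 0" "\<And>x y x' y'. x \<in> mspace m \<Longrightarrow> y \<in> mspace m \<Longrightarrow> x' \<in> mspace m \<Longrightarrow> y' \<in> mspace m \<Longrightarrow>
        mdist m2 x y \<le> E2 \<Longrightarrow> mdist m2 x' y' \<le> E2 \<Longrightarrow> mdist m2 x x' < t2 \<Longrightarrow> mdist m2 y y' < t2 \<Longrightarrow>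
        mdist m2 (br2 x y) (br2 x' y') < t1"
    using B.br_uc[OF t1(1)] unfolding space_eq by metis
  obtain t3 where t3: "t3 > 0" "\<And>x y. x \<in> mspace m \<Longrightarrow> y \<in> mspace m \<Longrightarrow> mdist m x y < t3 \<Longrightarrow> mdist m2 x y < t2"
    using unif12 t2(1) unfolding unif_finer_def by metis
  show ?thesis
  proof (intro exI[of _ "min t3 E"] conjI ballI impI)
    fix p y y'
    assume X: "p \<in> mspace m" "y \<in> mspace m" "y' \<in> mspace m"
      and near: "mdist m2 y p \<le> E2" "mdist m2 y' p \<le> E2"
        "mdist m2 (br2 y p) p \<le> E2 / 2" "mdist m2 (br2 y' p) p \<le> E2 / 2"
      and close: "A.leaf_dist y y' < min t3 E"
    define x x' where "x = br2 y p" and "x' = br2 y' p"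
    have xX: "x \<in> mspace m" "x' \<in> mspace m"
      using B.br_in X near unfolding space_eq x_def x'_def by auto
    have "mdist m y y' < t3" using A.leaf_dist_less_E[of y y'] close by simp
    then have "mdist m2 y y' < t2" using t3 X by blast
    then have d: "mdist m2 x x' < t1"
      using t2(2)[of y p y' p] near X t2(1) space_eq by (simp add: x_def x'_def)
    have dE: "mdist m2 x' x \<le> E2"
      using mdist_triangle[of x' m2 p x] near xX X space_eq by (simp add: x_def x'_def mdist_commute)
    have xp: "br2 x p = x" "br2 x' p = x'"
      using B.br_left[of y p p] B.br_left[of y' p p] near X space_eq B.E_pos
      by (auto simp: x_def x'_def mdist_commute)
    have "br2 x' x = x'"
      using B.br_right[of x' x p] xp dE near X xX space_eq B.E_pos
      by (simp add: x_def[symmetric] x'_def[symmetric])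
    then show "A.leaf_dist (br2 y p) (br2 y' p) < s"
      using t1(2)[of x x'] d xX A.leaf_dist_eq_d[of x x'] by (simp add: x_def x'_def)
  qed (use t3 A.E_pos in auto)
qed

text \<open>
  At the level \<open>M = k + N\<close> the whole basic set lies in the core with a definite margin: at level \<open>N\<close> its elements
  are in stable position at distance less than \<open>E2\<close>, and \<open>k\<close> further steps contract this below any prescribed
  size.  The uniform continuity needed in both directions is \<open>bracket_uniform_leaf\<close>, applied to \<open>hh = [zz, vv]\<close> and
  to \<open>zz = [hh, ww]\<close>.
\<close>

lemma chart_bilip:
  assumes "base_chart m2 f g E2 lam2 br2 e Q v w N \<eta>"
  defines "V \<equiv> base_chart.chart m2 f g br2 v w N \<eta>"
  shows "\<exists>M C. 0 < C \<and> (\<forall>a\<in>V. a \<in> mspace m \<times> mspace m \<and> A.in_core (A.Phi M a) \<and> A.core_radius / 2 \<le> A.margin (A.Phi M a)) \<and>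
    (\<forall>a\<in>V. \<forall>b\<in>V. A.leaf_dist (snd a) (snd b) \<le> C * A.groupoid_dist a b \<and> A.groupoid_dist a b \<le> C * A.leaf_dist (snd a) (snd b) \<and>
       A.leaf_dist (fst a) (fst b) \<le> C * A.groupoid_dist a b \<and> A.groupoid_dist a b \<le> C * A.leaf_dist (fst a) (fst b))"
proof -
  interpret K: base_chart m2 f g E2 lam2 br2 e Q v w N \<eta> by fact
  note [simp] = space_eq
  let ?U = "local_unstable m2 br2 w \<eta>"
  define ww vv where "ww = (f ^^ N) w" and "vv = (f ^^ N) v"
  have wv: "ww \<in> mspace m" "vv \<in> mspace m"
    using K.vw_in A.funpow_f_in by (auto simp: ww_def vv_def)
  have "0 < A.core_radius / 2" using A.core_radius_pos by simp
  then obtain t where t: "t > 0" "\<And>x y. x \<in> mspace m \<Longrightarrow> y \<in> mspace m \<Longrightarrow>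
      br2 x y = y \<Longrightarrow> mdist m2 x y < t \<Longrightarrow> br x y = y \<and> mdist m x y < A.core_radius / 2"
    using stable_transfer[OF A.smale_pair_axioms B.smale_pair_axioms unif21] by metis
  obtain k where k: "E2 / t < lam2 ^ k" using real_arch_pow[OF B.lam_gt_1] by blast
  \<comment> \<open>\<open>N\<close> steps bring an element of the basic set into local stable position, \<open>k\<close> more into the core\<close>
  define M where "M = k + N"
  have pM: "(f ^^ M) x = (f ^^ k) ((f ^^ N) x)" for x by (simp add: M_def funpow_add)
  have V: "V = (\<lambda>z. (K.h z, z)) ` ?U" by (simp add: V_def K.chart_def)
  have VX: "V \<subseteq> mspace m \<times> mspace m" using K.chart_point(1,2) by (auto simp: V)
  have level: "A.in_core (A.Phi M a) \<and> A.core_radius / 2 \<le> A.margin (A.Phi M a)" if a: "a \<in> V" for a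
  proof -
    obtain z where z: "z \<in> ?U" "a = (K.h z, z)" using a unfolding V by auto
    note p = K.chart_point[OF z(1)]
    let ?h = "(f ^^ N) (K.h z)" and ?z = "(f ^^ N) z"
    have X: "?h \<in> mspace m" "?z \<in> mspace m"
      using p(1,2) A.funpow_f_in by auto
    have it: "mdist m2 ((f ^^ k) ?h) ((f ^^ k) ?z) \<le> mdist m2 ?h ?z / lam2 ^ k"
        "br2 ((f ^^ k) ?h) ((f ^^ k) ?z) = (f ^^ k) ?z"
      using B.stable_iter[of ?h ?z k] X p(9,10) by auto
    note it(1)
    also have "mdist m2 ?h ?z / lam2 ^ k < E2 / lam2 ^ k"
      using p(10) B.lam_gt_1 by (intro divide_strict_right_mono) auto
    also have "E2 / lam2 ^ k < t" using k t(1) B.lam_gt_1 by (simp add: field_simps)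
    finally have "br ((f ^^ k) ?h) ((f ^^ k) ?z) = (f ^^ k) ?z \<and>
        mdist m ((f ^^ k) ?h) ((f ^^ k) ?z) < A.core_radius / 2"
      using t(2) it(2) X A.funpow_f_in by blast
    then show ?thesis
      using A.core_radius_pos by (simp add: A.in_core_def A.margin_def z(2) pM)
  qed
  have "0 < E / lam ^ k" using A.E_pos by simp
  then obtain s where s: "s > 0" "\<And>p y y'. p \<in> mspace m \<Longrightarrow> y \<in> mspace m \<Longrightarrow> y' \<in> mspace m \<Longrightarrow>
    mdist m2 y p \<le> E2 \<Longrightarrow> mdist m2 y' p \<le> E2 \<Longrightarrow>
    mdist m2 (br2 y p) p \<le> E2 / 2 \<Longrightarrow> mdist m2 (br2 y' p) p \<le> E2 / 2 \<Longrightarrow>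
    A.leaf_dist y y' < s \<Longrightarrow> A.leaf_dist (br2 y p) (br2 y' p) < E / lam ^ k"
    using bracket_uniform_leaf by metis
  define \<tau> where "\<tau> = s / lam ^ N"
  have tau: "0 < \<tau>" using s(1) by (simp add: \<tau>_def)
  have up: "A.leaf_dist ((f ^^ N) x) ((f ^^ N) y) < s" if "A.leaf_dist x y < \<tau>" "x \<in> mspace m" "y \<in> mspace m" for x y
  proof -
    have "A.leaf_dist ((f ^^ N) x) ((f ^^ N) y) \<le> lam ^ N * A.leaf_dist x y" using that A.leaf_dist_funpow_le by blast
    also have "\<dots> < lam ^ N * \<tau>" using that by simp
    finally show ?thesis using A.lam_pos by (simp add: \<tau>_def)
  qed
  have upM: "A.leaf_dist ((f ^^ M) x) ((f ^^ M) y) < E"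
    if "A.leaf_dist ((f ^^ N) x) ((f ^^ N) y) < E / lam ^ k" "x \<in> mspace m" "y \<in> mspace m" for x y
  proof -
    have "A.leaf_dist ((f ^^ M) x) ((f ^^ M) y) \<le> lam ^ k * A.leaf_dist ((f ^^ N) x) ((f ^^ N) y)"
      unfolding pM using that by (intro A.leaf_dist_funpow_le A.funpow_f_in)
    also have "\<dots> < lam ^ k * (E / lam ^ k)"
      using that A.lam_pow_pos by (intro mult_strict_left_mono)
    finally show ?thesis using A.lam_pos by simp
  qed
  have "\<exists>C>0. \<forall>a\<in>V. \<forall>b\<in>V. A.leaf_dist (snd a) (snd b) \<le> C * A.groupoid_dist a b \<and> A.groupoid_dist a b \<le> C * A.leaf_dist (snd a) (snd b)"
  proof (rule A.snd_bilip_on[OF VX level tau])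
    fix a b assume ab: "a \<in> V" "b \<in> V" "A.leaf_dist (snd a) (snd b) < \<tau>"
    obtain z z' where z: "z \<in> ?U" "a = (K.h z, z)" "z' \<in> ?U" "b = (K.h z', z')"
      using ab unfolding V by auto
    note p = K.chart_point[OF z(1)] and p' = K.chart_point[OF z(3)]
    have X: "z \<in> mspace m" "z' \<in> mspace m" "K.h z \<in> mspace m" "K.h z' \<in> mspace m"
      using p(1,2) p'(1,2) by auto
    have "A.leaf_dist (br2 ((f ^^ N) z) vv) (br2 ((f ^^ N) z') vv) < E / lam ^ k"
    proof (rule s(2)[OF wv(2)])
      show "A.leaf_dist ((f ^^ N) z) ((f ^^ N) z') < s" using up ab z X by simp
      show "mdist m2 (br2 ((f ^^ N) z) vv) vv \<le> E2 / 2" using p(6) by (simp only: p(3)[symmetric] vv_def)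
      show "mdist m2 (br2 ((f ^^ N) z') vv) vv \<le> E2 / 2" using p'(6) by (simp only: p'(3)[symmetric] vv_def)
    qed (use p(5) p'(5) X A.funpow_f_in in \<open>auto simp: vv_def\<close>)
    then show "A.leaf_dist (fst (A.Phi M a)) (fst (A.Phi M b)) < E"
      using upM[OF _ X(3,4)] p(3) p'(3) by (simp add: z vv_def)
  qed
  moreover
  have "\<exists>C>0. \<forall>a\<in>V. \<forall>b\<in>V. A.leaf_dist (fst a) (fst b) \<le> C * A.groupoid_dist a b \<and> A.groupoid_dist a b \<le> C * A.leaf_dist (fst a) (fst b)"
  proof (rule A.fst_bilip_on[OF VX level tau])
    fix a b assume ab: "a \<in> V" "b \<in> V" "A.leaf_dist (fst a) (fst b) < \<tau>"
    obtain z z' where z: "z \<in> ?U" "a = (K.h z, z)" "z' \<in> ?U" "b = (K.h z', z')"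
      using ab unfolding V by auto
    note p = K.chart_point[OF z(1)] and p' = K.chart_point[OF z(3)]
    have X: "z \<in> mspace m" "z' \<in> mspace m" "K.h z \<in> mspace m" "K.h z' \<in> mspace m"
      using p(1,2) p'(1,2) by auto
    have "A.leaf_dist (br2 ((f ^^ N) (K.h z)) ww) (br2 ((f ^^ N) (K.h z')) ww) < E / lam ^ k"
    proof (rule s(2)[OF wv(1)])
      show "A.leaf_dist ((f ^^ N) (K.h z)) ((f ^^ N) (K.h z')) < s" using up ab z X by simp
      show "mdist m2 (br2 ((f ^^ N) (K.h z)) ww) ww \<le> E2 / 2" using p(8) by (simp only: p(4)[symmetric] ww_def)
      show "mdist m2 (br2 ((f ^^ N) (K.h z')) ww) ww \<le> E2 / 2" using p'(8) by (simp only: p'(4)[symmetric] ww_def)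
    qed (use p(7) p'(7) X A.funpow_f_in in \<open>auto simp: ww_def\<close>)
    then have "A.leaf_dist ((f ^^ N) z) ((f ^^ N) z') < E / lam ^ k"
      by (simp only: p(4)[symmetric] p'(4)[symmetric] ww_def)
    then show "A.leaf_dist (snd (A.Phi M a)) (snd (A.Phi M b)) < E"
      using upM[OF _ X(1,2)] by (simp add: z)
  qed
  ultimately obtain C1 C2 where C1: "0 < C1"
     "\<And>a b. a \<in> V \<Longrightarrow> b \<in> V \<Longrightarrow> A.leaf_dist (snd a) (snd b) \<le> C1 * A.groupoid_dist a b \<and> A.groupoid_dist a b \<le> C1 * A.leaf_dist (snd a) (snd b)"
    and C2: "0 < C2"
     "\<And>a b. a \<in> V \<Longrightarrow> b \<in> V \<Longrightarrow> A.leaf_dist (fst a) (fst b) \<le> C2 * A.groupoid_dist a b \<and> A.groupoid_dist a b \<le> C2 * A.leaf_dist (fst a) (fst b)"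
    by blast
  have m1: "C1 * x \<le> max C1 C2 * x" "C2 * x \<le> max C1 C2 * x" if "0 \<le> x" for x
    using that by (auto intro: mult_right_mono)
  show ?thesis
  proof (intro exI[of _ M] exI[of _ "max C1 C2"] conjI ballI)
    fix a b assume ab: "a \<in> V" "b \<in> V"
    show "A.leaf_dist (snd a) (snd b) \<le> max C1 C2 * A.groupoid_dist a b" "A.groupoid_dist a b \<le> max C1 C2 * A.leaf_dist (snd a) (snd b)"
      "A.leaf_dist (fst a) (fst b) \<le> max C1 C2 * A.groupoid_dist a b" "A.groupoid_dist a b \<le> max C1 C2 * A.leaf_dist (fst a) (fst b)"
      using C1(2)[OF ab] C2(2)[OF ab] m1[OF A.groupoid_dist_nonneg[of a b]]
        m1[OF A.leaf_dist_nonneg[of "fst a" "fst b"]] m1[OF A.leaf_dist_nonneg[of "snd a" "snd b"]] by linarith+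
  qed (use C1 level VX in auto)
qed

end

section \<open>Topologies and bi-Lipschitz structure maps\<close>

lemma bi_lipschitz_mapI:
  assumes "f \<in> mspace m1 \<rightarrow> mspace m2"
    and "\<And>a b. a \<in> mspace m1 \<Longrightarrow> b \<in> mspace m1 \<Longrightarrow> mdist m2 (f a) (f b) \<le> C * mdist m1 a b"
    and "\<And>a b. a \<in> mspace m1 \<Longrightarrow> b \<in> mspace m1 \<Longrightarrow> mdist m1 a b \<le> C * mdist m2 (f a) (f b)"
  shows "bi_lipschitz_map m1 m2 f"
proof -
  have inj: "inj_on f (mspace m1)"
  proof (rule inj_onI)
    fix a b assume ab: "a \<in> mspace m1" "b \<in> mspace m1" "f a = f b"
    moreover have "mdist m2 (f b) (f b) = 0"
      using ab(2) assms(1) by (intro mdist_zero[THEN iffD2]) auto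
    ultimately have "mdist m1 a b \<le> 0" using assms(3)[of a b] by simp
    then have "mdist m1 a b = 0" using mdist_nonneg[of m1 a b] by linarith
    then show "a = b" using ab by simp
  qed
  then show ?thesis
    unfolding bi_lipschitz_map_def Lipschitz_continuous_map_def
    using assms by (auto simp: inv_into_f_f intro!: exI[of _ C])
qed

context selfsim_pair
begin

definition groupoid_metric :: "('a \<times> 'a) set \<Rightarrow> ('a \<times> 'a) metric" where
  "groupoid_metric S = metric (S, groupoid_dist)"

definition leaf_metric :: "'a set \<Rightarrow> 'a metric" where
  "leaf_metric S = metric (S, leaf_dist)"

lemma leaf_metric_simps:
  assumes "S \<subseteq> X"
  shows "mspace (leaf_metric S) = S" "mdist (leaf_metric S) = leaf_dist"
    "mtopology_of (leaf_metric S) = Metric_space.mtopology S leaf_dist" "Metric_space S leaf_dist"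
proof -
  interpret M: Metric_space S leaf_dist using Metric_space.subspace[OF leaf_dist_metric assms] .
  show "mspace (leaf_metric S) = S" "mdist (leaf_metric S) = leaf_dist"
    "mtopology_of (leaf_metric S) = M.mtopology" "Metric_space S leaf_dist"
    by (simp_all add: leaf_metric_def mtopology_of_def M.Metric_space_axioms)
qed

lemma stable_groupoid_subset: "Q \<subseteq> X \<Longrightarrow> stable_groupoid m f g Q \<subseteq> X \<times> X"
  using smale_pair.stable_union_in[OF dual] by (auto simp: stable_groupoid_def)

lemma stable_groupoid_eventually_in_core:
  assumes "Q \<subseteq> X" "a \<in> stable_groupoid m f g Q"
  shows "\<exists>n. in_core (Phi n a)"
proof -
  obtain v w where a: "a = (v, w)" by (cases a)
  have "v \<in> X" "w \<in> global_stable m f v"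
    using assms smale_pair.stable_union_in[OF dual] by (auto simp: stable_groupoid_def a)
  then show ?thesis
    using global_stable_eventually_stable[OF _ _ core_radius_pos] by (auto simp: in_core_def a)
qed

lemma groupoid_metric_simps:
  assumes "Q \<subseteq> X"
  defines "G \<equiv> stable_groupoid m f g Q"
  shows "mspace (groupoid_metric G) = G" "mdist (groupoid_metric G) = groupoid_dist"
    "mtopology_of (groupoid_metric G) = Metric_space.mtopology G groupoid_dist" "Metric_space G groupoid_dist"
proof -
  interpret M: Metric_space G groupoid_dist
    unfolding G_def
    by (rule groupoid_dist_metric[OF stable_groupoid_subset stable_groupoid_eventually_in_core]) (use assms in auto)
  show "mspace (groupoid_metric G) = G" "mdist (groupoid_metric G) = groupoid_dist"
    "mtopology_of (groupoid_metric G) = M.mtopology" "Metric_space G groupoid_dist"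
    by (simp_all add: groupoid_metric_def mtopology_of_def M.Metric_space_axioms)
qed

lemma swap_stable_groupoid:
  assumes "Q \<subseteq> X" "a \<in> stable_groupoid m f g Q"
  shows "prod.swap a \<in> stable_groupoid m f g Q"
  using assms global_stable_sym smale_pair.stable_union_in[OF dual assms(1)]
  by (auto simp: stable_groupoid_def)

text \<open>
  Units are core elements with maximal margin, so near the diagonal the groupoid distance is
  comparable to the leaf distance without passing to an iterate.
\<close>

lemma unit_topology:
  assumes Q: "Q \<subseteq> X"
  defines "G \<equiv> stable_groupoid m f g Q" and "Y \<equiv> stable_union m g Q"
  shows "mtopology_of (leaf_metric Y) = pullback_topology Y (\<lambda>x. (x, x)) (mtopology_of (groupoid_metric G))"
proof -
  have YX: "Y \<subseteq> X" using smale_pair.stable_union_in[OF dual Q] by (simp add: Y_def)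
  interpret MY: Metric_space Y leaf_dist by (rule leaf_metric_simps[OF YX])
  interpret MG: Metric_space G groupoid_dist unfolding G_def by (rule groupoid_metric_simps[OF Q])
  have unit: "(x, x) \<in> G" if "x \<in> Y" for x
    using that YX global_stable_self by (auto simp: G_def Y_def stable_groupoid_def)
  have in_core: "in_core (Phi 0 (x, x)) \<and> margin (Phi 0 (x, x)) = core_radius" if "x \<in> Y" for x
    using that YX core_radius_pos br_idem by (auto simp: in_core_def margin_def Phi_def)
  have up: "groupoid_dist (x, x) (y, y) \<le> 2 * leaf_dist x y" if "x \<in> Y" "y \<in> Y" for x y
    using groupoid_dist_le_pair_dist[of "(x, x)" "(y, y)" 0] that YX in_core by (auto simp: pair_dist_def)
  have low: "leaf_dist x y \<le> groupoid_dist (x, x) (y, y)" if "x \<in> Y" "y \<in> Y" "groupoid_dist (x, x) (y, y) < core_radius" for x y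
    using snd_local_bilip(1)[of "(x, x)" "(y, y)" 0] that YX in_core by auto
  show ?thesis
    unfolding leaf_metric_simps(3)[OF YX] groupoid_metric_simps(3)[OF Q, folded G_def]
  proof (rule topology_eq[THEN iffD2], intro allI iffI)
    fix U assume U: "openin MY.mtopology U"
    have "\<exists>r>0. r \<le> core_radius \<and> MY.mball x r \<subseteq> U" if "x \<in> U" for x
    proof -
      obtain r where "r > 0" "MY.mball x r \<subseteq> U" using U \<open>x \<in> U\<close> MY.openin_mtopology by blast
      then show ?thesis using core_radius_pos by (intro exI[of _ "min r core_radius"]) auto
    qed
    then obtain r where r: "\<And>x. x \<in> U \<Longrightarrow> 0 < r x \<and> r x \<le> core_radius \<and> MY.mball x (r x) \<subseteq> U" by metis
    have UY: "U \<subseteq> Y" using U MY.openin_mtopology by blast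
    let ?O = "\<Union>x\<in>U. MG.mball (x, x) (r x)"
    have "openin MG.mtopology ?O" by (intro openin_Union) auto
    moreover have "U = (\<lambda>x. (x, x)) -` ?O \<inter> Y"
    proof (intro subset_antisym subsetI)
      fix x assume x: "x \<in> U"
      then have "(x, x) \<in> MG.mball (x, x) (r x)" using r[OF x] UY unit by auto
      then show "x \<in> (\<lambda>x. (x, x)) -` ?O \<inter> Y" using x UY by blast
    next
      fix y assume "y \<in> (\<lambda>x. (x, x)) -` ?O \<inter> Y"
      then obtain x where y: "y \<in> Y" "x \<in> U" "(y, y) \<in> MG.mball (x, x) (r x)" by blast
      then have "groupoid_dist (x, x) (y, y) < r x" by simp
      then have "leaf_dist x y < r x" using low[of x y] y UY r[of x] by auto
      then have "y \<in> MY.mball x (r x)" using y UY by auto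
      then show "y \<in> U" using r y by blast
    qed
    ultimately show "openin (pullback_topology Y (\<lambda>x. (x, x)) MG.mtopology) U"
      unfolding openin_pullback_topology by blast
  next
    fix U assume "openin (pullback_topology Y (\<lambda>x. (x, x)) MG.mtopology) U"
    then obtain W where W: "openin MG.mtopology W" "U = (\<lambda>x. (x, x)) -` W \<inter> Y"
      unfolding openin_pullback_topology by blast
    have "\<exists>r>0. MY.mball x r \<subseteq> U" if "x \<in> U" for x
    proof -
      have x: "(x, x) \<in> W" "x \<in> Y" using W \<open>x \<in> U\<close> by auto
      then obtain r where r: "r > 0" "MG.mball (x, x) r \<subseteq> W" using W MG.openin_mtopology by blast
      have "MY.mball x (r / 2) \<subseteq> U"
      proof
        fix y assume y: "y \<in> MY.mball x (r / 2)"
        then have "groupoid_dist (x, x) (y, y) < r" using up[of x y] by auto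
        then have "(y, y) \<in> MG.mball (x, x) r" using y unit by auto
        then show "y \<in> U" using r W y by auto
      qed
      then show ?thesis using r by (intro exI[of _ "r/2"]) auto
    qed
    then show "openin MY.mtopology U" using W by (auto simp: MY.openin_mtopology)
  qed
qed

lemma locally_bilip:
  assumes Q: "Q \<subseteq> X"
  defines "G \<equiv> stable_groupoid m f g Q" and "Y \<equiv> stable_union m g Q"
  shows "locally_bi_lipschitz_map (groupoid_metric G) (leaf_metric Y) snd"
    and "locally_bi_lipschitz_map (groupoid_metric G) (leaf_metric Y) fst"
proof -
  have YX: "Y \<subseteq> X" using smale_pair.stable_union_in[OF dual Q] by (simp add: Y_def)
  have GX: "G \<subseteq> X \<times> X" using stable_groupoid_subset[OF Q] by (simp add: G_def)
  note [simp] = groupoid_metric_simps(1,2)[OF Q, folded G_def] leaf_metric_simps(1,2)[OF YX]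
  have GY: "fst \<in> G \<rightarrow> Y" "snd \<in> G \<rightarrow> Y" by (auto simp: G_def Y_def stable_groupoid_def)
  have loc: "\<exists>l>0. \<exists>\<Lambda>\<ge>1. \<forall>b\<in>G. groupoid_dist a b < l \<longrightarrow>
      inverse \<Lambda> * groupoid_dist a b \<le> leaf_dist (snd a) (snd b) \<and> leaf_dist (snd a) (snd b) \<le> \<Lambda> * groupoid_dist a b" if a: "a \<in> G" for a
  proof -
    obtain n where n: "in_core (Phi n a)" using stable_groupoid_eventually_in_core[OF Q] a G_def by blast
    let ?l = "margin (Phi n a) / lam ^ n" and ?c = "3 * lam ^ n"
    have l: "0 < ?l" using margin_pos[OF n] by simp
    have c: "1 \<le> ?c" using lam_pow_ge_1[of n] by linarith
    have "inverse ?c * groupoid_dist a b \<le> leaf_dist (snd a) (snd b) \<and> leaf_dist (snd a) (snd b) \<le> ?c * groupoid_dist a b"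
      if b: "b \<in> G" "groupoid_dist a b < ?l" for b
    proof -
      have X: "a \<in> X \<times> X" "b \<in> X \<times> X" using GX a b by auto
      have less: "lam ^ n * groupoid_dist a b < margin (Phi n a)"
        using b lam_pow_pos[of n] by (simp add: less_divide_eq mult.commute)
      note s = snd_local_bilip[OF X n less]
      have "inverse ?c * groupoid_dist a b \<le> inverse ?c * (?c * leaf_dist (snd a) (snd b))"
        using s(2) by (intro mult_left_mono) (auto intro: less_imp_le)
      also have "\<dots> = leaf_dist (snd a) (snd b)" using lam_pos by simp
      moreover have "lam ^ n * groupoid_dist a b \<le> ?c * groupoid_dist a b"
        using groupoid_dist_nonneg[of a b] by (intro mult_right_mono) (auto intro: less_imp_le)
      ultimately show ?thesis using s(1) by linarith
    qed
    then show ?thesis using l c by blast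
  qed
  show "locally_bi_lipschitz_map (groupoid_metric G) (leaf_metric Y) snd"
    unfolding locally_bi_lipschitz_map_def using loc GY by simp
  have "\<exists>l>0. \<exists>\<Lambda>\<ge>1. \<forall>b\<in>G. groupoid_dist a b < l \<longrightarrow>
      inverse \<Lambda> * groupoid_dist a b \<le> leaf_dist (fst a) (fst b) \<and> leaf_dist (fst a) (fst b) \<le> \<Lambda> * groupoid_dist a b" if a: "a \<in> G" for a
  proof -
    have sw: "prod.swap b \<in> G" if "b \<in> G" for b using swap_stable_groupoid[OF Q] that by (simp add: G_def)
    obtain l \<Lambda> where l: "l > 0" "\<Lambda> \<ge> 1" "\<And>b. b \<in> G \<Longrightarrow> groupoid_dist (prod.swap a) b < l \<Longrightarrow>
      inverse \<Lambda> * groupoid_dist (prod.swap a) b \<le> leaf_dist (snd (prod.swap a)) (snd b) \<and>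
      leaf_dist (snd (prod.swap a)) (snd b) \<le> \<Lambda> * groupoid_dist (prod.swap a) b"
      using loc[OF sw[OF a]] by blast
    have "inverse \<Lambda> * groupoid_dist a b \<le> leaf_dist (fst a) (fst b) \<and> leaf_dist (fst a) (fst b) \<le> \<Lambda> * groupoid_dist a b"
      if b: "b \<in> G" "groupoid_dist a b < l" for b
    proof -
      have "groupoid_dist (prod.swap a) (prod.swap b) = groupoid_dist a b" using groupoid_dist_swap GX a b by blast
      then show ?thesis using l(3)[OF sw[OF b(1)]] b by simp
    qed
    then show ?thesis using l by blast
  qed
  then show "locally_bi_lipschitz_map (groupoid_metric G) (leaf_metric Y) fst"
    unfolding locally_bi_lipschitz_map_def using GY by simp
qed

lemma swap_bilip:
  assumes Q: "Q \<subseteq> X"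
  defines "G \<equiv> stable_groupoid m f g Q"
  shows "bi_lipschitz_map (groupoid_metric G) (groupoid_metric G) prod.swap"
proof (rule bi_lipschitz_mapI[where C = 1])
  note [simp] = groupoid_metric_simps(1,2)[OF Q, folded G_def]
  show "prod.swap \<in> mspace (groupoid_metric G) \<rightarrow> mspace (groupoid_metric G)"
    using swap_stable_groupoid[OF Q, folded G_def] by auto
  have GX: "G \<subseteq> X \<times> X" using stable_groupoid_subset[OF Q] by (simp add: G_def)
  fix a b assume "a \<in> mspace (groupoid_metric G)" "b \<in> mspace (groupoid_metric G)"
  then have "groupoid_dist (prod.swap a) (prod.swap b) = groupoid_dist a b" using GX by (intro groupoid_dist_swap) auto
  then show "mdist (groupoid_metric G) (prod.swap a) (prod.swap b) \<le> 1 * mdist (groupoid_metric G) a b"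
    "mdist (groupoid_metric G) a b \<le> 1 * mdist (groupoid_metric G) (prod.swap a) (prod.swap b)"
    by simp_all
qed

end

lemma (in smale_pair) global_unstable_f:
  assumes "x \<in> X" "y \<in> X"
  shows "f y \<in> global_stable m g (f x) \<longleftrightarrow> y \<in> global_stable m g x"
  using smale_pair.global_stable_funpow[OF dual, of "f x" "f y" 1] assms f_in gf by simp

lemma (in smale_pair) groupoid_invariant:
  assumes Q: "Q \<subseteq> X" "f ` Q \<subseteq> Q" "g ` Q \<subseteq> Q" and a: "a \<in> stable_groupoid m f g Q"
  shows "map_prod f f a \<in> stable_groupoid m f g Q" "map_prod g g a \<in> stable_groupoid m f g Q"
proof -
  interpret du: smale_pair m g f E lam "\<lambda>x y. br y x" by (rule dual)
  obtain v w where vw: "a = (v, w)" by (cases a)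
  have aX: "v \<in> stable_union m g Q" "w \<in> stable_union m g Q" "w \<in> global_stable m f v" "v \<in> X" "w \<in> X"
    using a du.stable_union_in[OF Q(1)] by (auto simp: stable_groupoid_def vw)
  have Y: "f x \<in> stable_union m g Q" "g x \<in> stable_union m g Q" if x: "x \<in> stable_union m g Q" for x
  proof -
    obtain q where q: "q \<in> Q" "x \<in> global_stable m g q" using x unfolding stable_union_def by blast
    have X: "q \<in> X" "x \<in> X" using q Q by (auto simp: global_stable_def)
    have "f x \<in> global_stable m g (f q)" using global_unstable_f[OF X] q by blast
    then show "f x \<in> stable_union m g Q" using q Q(2) by (auto simp: stable_union_def)
    have "g x \<in> global_stable m g (g q)" using du.global_stable_funpow[OF X, of 1] q by simp
    then show "g x \<in> stable_union m g Q" using q Q(3) by (auto simp: stable_union_def)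
  qed
  show "map_prod f f a \<in> stable_groupoid m f g Q"
    using Y aX global_stable_funpow[of v w 1] by (simp add: stable_groupoid_def vw)
  show "map_prod g g a \<in> stable_groupoid m f g Q"
    using Y aX du.global_unstable_f[of v w] by (simp add: stable_groupoid_def vw)
qed

lemma (in smale_pair) groupoid_bij:
  assumes Q: "Q \<subseteq> X" "f ` Q \<subseteq> Q" "g ` Q \<subseteq> Q"
  shows "bij_betw (map_prod f f) (stable_groupoid m f g Q) (stable_groupoid m f g Q)"
    "bij_betw (map_prod g g) (stable_groupoid m f g Q) (stable_groupoid m f g Q)"
proof -
  have X: "stable_groupoid m f g Q \<subseteq> X \<times> X"
    using smale_pair.stable_union_in[OF dual Q(1)] by (auto simp: stable_groupoid_def)
  have inv: "map_prod g g (map_prod f f a) = a" "map_prod f f (map_prod g g a) = a"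
    if "a \<in> stable_groupoid m f g Q" for a
    using that X by (auto simp: gf fg)
  show "bij_betw (map_prod f f) (stable_groupoid m f g Q) (stable_groupoid m f g Q)"
    by (rule bij_betw_byWitness[where f' = "map_prod g g"]) (use inv groupoid_invariant[OF Q] in auto)
  show "bij_betw (map_prod g g) (stable_groupoid m f g Q) (stable_groupoid m f g Q)"
    by (rule bij_betw_byWitness[where f' = "map_prod f f"]) (use inv groupoid_invariant[OF Q] in auto)
qed

context two_structures
begin

lemma union_eq: assumes "Q \<subseteq> mspace m" shows "stable_union m2 g Q = stable_union m g Q"
proof -
  have "global_stable m2 g q = global_stable m g q" if "q \<in> mspace m" for q
    using global_stable_unif_finer[OF unif12, of g q] global_stable_unif_finer[OF unif21, of g q]
      A.g_in B.g_in space_eq that by auto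
  then show ?thesis unfolding stable_union_def using assms by (intro SUP_cong) auto
qed

lemma groupoid_eq: assumes "Q \<subseteq> mspace m" shows "stable_groupoid m2 f g Q = stable_groupoid m f g Q"
proof -
  have "global_stable m2 f v = global_stable m f v" if "v \<in> mspace m" for v
    using global_stable_unif_finer[OF unif12, of f v] global_stable_unif_finer[OF unif21, of f v]
      A.f_in B.f_in space_eq that by auto
  then show ?thesis
    using union_eq[OF assms] smale_pair.stable_union_in[OF A.dual assms]
    unfolding stable_groupoid_def by blast
qed

lemma base_chartsE:
  assumes Q: "Q \<subseteq> mspace m" and e: "bracket_radius m2 E2 br2 e" and V: "V \<in> base_charts m2 f g E2 br2 e Q"
  obtains v w N \<eta> where "base_chart m2 f g E2 lam2 br2 e Q v w N \<eta>"
    "V = base_chart.chart m2 f g br2 v w N \<eta>"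
proof -
  from V obtain v w N \<eta> where *: "V = (\<lambda>z. ((g ^^ N) (br2 ((f ^^ N) z) ((f ^^ N) v)), z)) ` local_unstable m2 br2 w \<eta>"
    "(v, w) \<in> stable_groupoid m2 f g Q"
    "(f ^^ N) w \<in> local_stable m2 br2 ((f ^^ N) v) (e / 2)" "0 < \<eta>" "\<eta> \<le> E2 / 2"
    "(f ^^ N) ` local_unstable m2 br2 w \<eta> \<subseteq> local_unstable m2 br2 ((f ^^ N) w) (e / 2)"
    unfolding base_charts_def mem_Collect_eq by (elim exE conjE)
  have K: "base_chart m2 f g E2 lam2 br2 e Q v w N \<eta>"
    by unfold_locales (use * e Q space_eq in auto)
  interpret K: base_chart m2 f g E2 lam2 br2 e Q v w N \<eta> by fact
  have "V = K.chart" using *(1) by (simp add: K.chart_def K.h_def)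
  then show thesis using that K by blast
qed

lemma base_charts_bilip:
  assumes Q: "Q \<subseteq> mspace m" and e: "bracket_radius m2 E2 br2 e" and V: "V \<in> base_charts m2 f g E2 br2 e Q"
  defines "Ds \<equiv> A.groupoid_metric (stable_groupoid m f g Q)" and "D' \<equiv> A.leaf_metric (stable_union m g Q)"
  shows "bi_lipschitz_map (submetric Ds V) (submetric D' (fst ` V)) fst"
    "bi_lipschitz_map (submetric Ds V) (submetric D' (snd ` V)) snd"
proof -
  obtain v w N \<eta> where K: "base_chart m2 f g E2 lam2 br2 e Q v w N \<eta>"
    and VK: "V = base_chart.chart m2 f g br2 v w N \<eta>" by (rule base_chartsE[OF Q e V])
  have VG: "V \<subseteq> stable_groupoid m f g Q"
    using base_chart.chart_subset[OF K] groupoid_eq[OF Q] VK by simp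
  have YX: "stable_union m g Q \<subseteq> mspace m" using smale_pair.stable_union_in[OF A.dual Q] .
  note [simp] = A.groupoid_metric_simps(1,2)[OF Q] A.leaf_metric_simps(1,2)[OF YX]
  obtain C where C: "\<And>a b. a \<in> V \<Longrightarrow> b \<in> V \<Longrightarrow>
       A.leaf_dist (snd a) (snd b) \<le> C * A.groupoid_dist a b \<and> A.groupoid_dist a b \<le> C * A.leaf_dist (snd a) (snd b) \<and>
       A.leaf_dist (fst a) (fst b) \<le> C * A.groupoid_dist a b \<and> A.groupoid_dist a b \<le> C * A.leaf_dist (fst a) (fst b)"
    using chart_bilip[OF K] unfolding VK by blast
  have Y: "fst a \<in> stable_union m g Q \<and> snd a \<in> stable_union m g Q" if "a \<in> V" for a
    using VG that by (auto simp: stable_groupoid_def)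
  show "bi_lipschitz_map (submetric Ds V) (submetric D' (fst ` V)) fst"
    by (rule bi_lipschitz_mapI[where C = C]) (use C Y in \<open>auto simp: Ds_def D'_def\<close>)
  show "bi_lipschitz_map (submetric Ds V) (submetric D' (snd ` V)) snd"
    by (rule bi_lipschitz_mapI[where C = C]) (use C Y in \<open>auto simp: Ds_def D'_def\<close>)
qed

text \<open>
  Let \<open>b\<close> be close to an element \<open>a\<close> of the basic set.  Then its source is in the domain of the chart, so the
  basic set contains an element with the same source, which is close to \<open>a\<close> too; by
  \<open>groupoid_dist_close_same_source\<close> it is \<open>b\<close>.
\<close>

lemma base_chart_open:
  assumes Q: "Q \<subseteq> mspace m" and e: "bracket_radius m2 E2 br2 e" and V: "V \<in> base_charts m2 f g E2 br2 e Q"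
  shows "openin (Metric_space.mtopology (stable_groupoid m f g Q) A.groupoid_dist) V"
proof -
  obtain v w N \<eta> where K: "base_chart m2 f g E2 lam2 br2 e Q v w N \<eta>"
    and VK: "V = base_chart.chart m2 f g br2 v w N \<eta>" by (rule base_chartsE[OF Q e V])
  let ?G = "stable_groupoid m f g Q"
  interpret MG: Metric_space ?G A.groupoid_dist by (rule A.groupoid_metric_simps(4)[OF Q])
  interpret K: base_chart m2 f g E2 lam2 br2 e Q v w N \<eta> by fact
  note [simp] = space_eq
  have VG: "V \<subseteq> ?G" using K.chart_subset groupoid_eq[OF Q] VK by simp
  have GX: "?G \<subseteq> mspace m \<times> mspace m" by (rule A.stable_groupoid_subset[OF Q])
  obtain M C where C: "0 < C"
     "\<And>a. a \<in> V \<Longrightarrow> A.in_core (A.Phi M a) \<and> A.core_radius / 2 \<le> A.margin (A.Phi M a)"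
     "\<And>a b. a \<in> V \<Longrightarrow> b \<in> V \<Longrightarrow> A.groupoid_dist a b \<le> C * A.leaf_dist (snd a) (snd b)"
    using chart_bilip[OF K] unfolding VK by blast
  have "\<exists>r>0. MG.mball a r \<subseteq> V" if aV: "a \<in> V" for a
  proof -
    obtain z where z: "z \<in> local_unstable m2 br2 w \<eta>" "a = (K.h z, z)"
      using aV VK K.chart_def by auto
    have zw: "z \<in> mspace m" "mdist m2 w z < \<eta>" "br2 z w = z" using z by (auto simp: local_unstable_def)
    have w: "w \<in> mspace m" using K.vw_in by simp
    define \<kappa> where "\<kappa> = min (\<eta> - mdist m2 w z) E2"
    have "0 < \<kappa>" using zw B.E_pos by (simp add: \<kappa>_def)
    then obtain t where t: "t > 0" "\<And>x y. x \<in> mspace m2 \<Longrightarrow> y \<in> mspace m2 \<Longrightarrow>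
        br y x = y \<Longrightarrow> mdist m x y < t \<Longrightarrow> br2 y x = y \<and> mdist m2 x y < \<kappa>"
      using unstable_transfer[OF B.smale_pair_axioms A.smale_pair_axioms unif12] by metis
    have inU: "z' \<in> local_unstable m2 br2 w \<eta>" if z': "z' \<in> mspace m" "A.leaf_dist z z' < min t E" for z'
    proof -
      have "br z' z = z'" "mdist m z z' < t" using A.leaf_dist_less_E[of z z'] z' by auto
      then have zz': "br2 z' z = z'" "mdist m2 z z' < \<kappa>" using t(2)[of z z'] zw z' by auto
      have lt: "mdist m2 w z' < \<eta>"
        using mdist_triangle[of w m2 z z'] zz' w zw z' by (simp add: \<kappa>_def)
      have "br2 z' w = z'"
        using smale_pair.stable_trans[OF B.dual, of w z z'] w zw z' zz' lt K.eta B.E_pos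
        by (simp add: \<kappa>_def)
      then show ?thesis using lt z' by (simp add: local_unstable_def)
    qed
    \<comment> \<open>radius after \<open>M\<close> steps: the three bounds keep \<open>b\<close> within the margin, its source in the domain of the chart, and the chart element over that source within the margin\<close>
    define q where "q = min (A.core_radius / 8) (min (min t E) (A.core_radius / (8 * C * lam ^ M)))"
    have q: "0 < q" "q \<le> A.core_radius / 8" "q \<le> min t E" "q \<le> A.core_radius / (8 * C * lam ^ M)"
      using A.core_radius_pos t A.E_pos C(1) unfolding q_def by auto
    have "b \<in> V" if b: "b \<in> MG.mball a (q / lam ^ M)" for b
    proof -
      have bG: "b \<in> ?G" "A.groupoid_dist a b < q / lam ^ M" using b by auto
      then have less: "lam ^ M * A.groupoid_dist a b < q" by (simp add: field_simps)
      have X: "a \<in> mspace m \<times> mspace m" "b \<in> mspace m \<times> mspace m" using GX VG aV bG by auto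
      note l = C(2)[OF aV]
      have "lam ^ M * A.groupoid_dist a b < A.margin (A.Phi M a)" using less q l A.core_radius_pos by linarith
      then have D': "A.leaf_dist (snd a) (snd b) < q"
        using A.snd_local_bilip(1)[OF X] l less by fastforce
      then have "snd b \<in> local_unstable m2 br2 w \<eta>"
        using inU[of "snd b"] q(3) X z by auto
      then have b': "(K.h (snd b), snd b) \<in> V" (is "?b \<in> V") by (auto simp: VK K.chart_def)
      have "A.groupoid_dist a ?b \<le> C * A.leaf_dist (snd a) (snd b)" using C(3)[OF aV b'] by simp
      also have "\<dots> < C * q" using D' C(1) by simp
      finally have "lam ^ M * A.groupoid_dist a ?b \<le> lam ^ M * (C * q)" by simp
      also have "\<dots> \<le> lam ^ M * (C * (A.core_radius / (8 * C * lam ^ M)))"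
        using q(4) C(1) by (intro mult_left_mono less_imp_le[OF A.lam_pow_pos]) auto
      also have "\<dots> = A.core_radius / 8" using C(1) A.lam_pos by simp
      finally have "lam ^ M * A.groupoid_dist a ?b < A.margin (A.Phi M a) / 2" using l A.core_radius_pos by linarith
      moreover have "lam ^ M * A.groupoid_dist a b < A.margin (A.Phi M a) / 2" using less q l A.core_radius_pos by linarith
      moreover have "?b \<in> mspace m \<times> mspace m" using GX VG b' by blast
      ultimately have "b = ?b" using A.groupoid_dist_close_same_source[OF X] l by fastforce
      then show ?thesis using b' by simp
    qed
    then show ?thesis using q(1) by (intro exI[of _ "q / lam ^ M"]) auto
  qed
  then show ?thesis using VG by (auto simp: MG.openin_mtopology)
qed

lemma base_chart_small:
  assumes Q: "Q \<subseteq> mspace m" and e: "bracket_radius m2 E2 br2 e"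
    and a: "a \<in> stable_groupoid m f g Q" and r: "0 < r"
  shows "\<exists>V\<in>base_charts m2 f g E2 br2 e Q. a \<in> V \<and> V \<subseteq> Metric_space.mball (stable_groupoid m f g Q) A.groupoid_dist a r"
proof -
  let ?G = "stable_groupoid m f g Q"
  interpret MG: Metric_space ?G A.groupoid_dist by (rule A.groupoid_metric_simps(4)[OF Q])
  note [simp] = space_eq
  obtain v w where vw: "a = (v, w)" by (cases a)
  obtain N \<eta> where K: "base_chart m2 f g E2 lam2 br2 e Q v w N \<eta>"
    using B.ex_base_chart[OF e, of Q v w] Q a by (auto simp: groupoid_eq vw)
  interpret K: base_chart m2 f g E2 lam2 br2 e Q v w N \<eta> by fact
  obtain C where C: "0 < C"
     "\<And>a b. a \<in> K.chart \<Longrightarrow> b \<in> K.chart \<Longrightarrow> A.groupoid_dist a b \<le> C * A.leaf_dist (snd a) (snd b)"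
    using chart_bilip[OF K] by blast
  have "0 < min E (r / C)" using A.E_pos r C by simp
  then obtain t where t: "t > 0" "\<And>x y. x \<in> mspace m \<Longrightarrow> y \<in> mspace m \<Longrightarrow>
        br2 y x = y \<Longrightarrow> mdist m2 x y < t \<Longrightarrow> br y x = y \<and> mdist m x y < min E (r / C)"
    using unstable_transfer[OF A.smale_pair_axioms B.smale_pair_axioms unif21] by metis
  define \<eta>' where "\<eta>' = min \<eta> t"
  let ?V = "(\<lambda>z. (K.h z, z)) ` local_unstable m2 br2 w \<eta>'"
  have "?V \<in> base_charts m2 f g E2 br2 e Q"
    using K.eta t(1) by (intro K.chart_shrink) (auto simp: \<eta>'_def)
  moreover have "w \<in> local_unstable m2 br2 w \<eta>'"
    using K.centre_in K.eta t(1) K.vw_in by (simp add: local_unstable_def \<eta>'_def)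
  then have "(K.h w, w) \<in> ?V" by (rule imageI)
  then have "a \<in> ?V" by (simp only: K.h_centre vw)
  moreover have "?V \<subseteq> MG.mball a r"
  proof
    fix b assume "b \<in> ?V"
    then obtain z where z: "z \<in> local_unstable m2 br2 w \<eta>'" "b = (K.h z, z)" by blast
    then have zU: "z \<in> local_unstable m2 br2 w \<eta>" "z \<in> mspace m" "mdist m2 w z < t" "br2 z w = z"
      by (auto simp: local_unstable_def \<eta>'_def)
    have w: "w \<in> mspace m" using K.vw_in by simp
    have "br z w = z \<and> mdist m w z < min E (r / C)" using t(2)[OF w zU(2,4,3)] .
    then have leaf_dist: "A.leaf_dist w z < r / C" using A.leaf_dist_eq_d[OF w zU(2)] by simp
    have bK: "b \<in> K.chart" using z zU(1) by (auto simp: K.chart_def)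
    have "(K.h w, w) \<in> K.chart" unfolding K.chart_def using K.centre_in by (rule imageI)
    then have aK: "a \<in> K.chart" by (simp only: K.h_centre vw)
    have "A.groupoid_dist a b \<le> C * A.leaf_dist w z" using C(2)[OF aK bK] z vw by simp
    also have "\<dots> < C * (r / C)" using leaf_dist C(1) by (intro mult_strict_left_mono)
    also have "\<dots> = r" using C(1) by simp
    finally have "A.groupoid_dist a b < r" .
    moreover have "b \<in> ?G" using K.chart_subset bK unfolding groupoid_eq[OF Q] by (rule subsetD)
    ultimately show "b \<in> MG.mball a r" using a by simp
  qed
  ultimately show ?thesis by (intro bexI[of _ ?V] conjI)
qed

lemma groupoid_topology:
  assumes Q: "Q \<subseteq> mspace m" and e: "bracket_radius m2 E2 br2 e"
  shows "mtopology_of (A.groupoid_metric (stable_groupoid m f g Q)) = topology_generated_by (base_charts m2 f g E2 br2 e Q)"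
proof -
  interpret MG: Metric_space "stable_groupoid m f g Q" A.groupoid_dist by (rule A.groupoid_metric_simps(4)[OF Q])
  show ?thesis
    unfolding A.groupoid_metric_simps(3)[OF Q]
    by (intro MG.mtopology_eq_topology_generated_by base_chart_open[OF Q e] base_chart_small[OF Q e])
qed

end

section \<open>Snowflaking\<close>

text \<open>
  Dividing by \<open>a + b\<close> reduces the claim to \<open>t \<le> t powr p\<close> for \<open>t\<close> in the unit interval.
\<close>

lemma powr_subadditive:
  fixes a b p :: real
  assumes "0 \<le> a" "0 \<le> b" "0 < p" "p \<le> 1"
  shows "(a + b) powr p \<le> a powr p + b powr p"
proof (cases "a + b = 0")
  case False
  define s where "s = a + b"
  have s: "0 < s" using assms False by (simp add: s_def)
  have le: "x / s \<le> x powr p / s powr p" if "0 \<le> x" "x \<le> s" for x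
  proof -
    have "(x / s) powr 1 \<le> (x / s) powr p"
      using that s assms by (intro powr_mono') auto
    then show ?thesis using that s by (simp add: powr_divide)
  qed
  have "1 = a / s + b / s" using s by (simp add: s_def add_divide_distrib[symmetric])
  also have "\<dots> \<le> a powr p / s powr p + b powr p / s powr p"
    using assms by (intro add_mono le) (auto simp: s_def)
  finally show ?thesis using s by (simp add: s_def field_simps)
qed (use assms in auto)

definition snowflake :: "'a metric \<Rightarrow> real \<Rightarrow> 'a metric" where
  "snowflake m p = metric (mspace m, \<lambda>x y. mdist m x y powr p)"

lemma snowflake_simps:
  assumes "0 < p" "p \<le> 1"
  shows "mspace (snowflake m p) = mspace m" "mdist (snowflake m p) x y = mdist m x y powr p"
proof -
  interpret M: Metric_space "mspace m" "\<lambda>x y. mdist m x y powr p"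
  proof
    show "mdist m x z powr p \<le> mdist m x y powr p + mdist m y z powr p"
      if "x \<in> mspace m" "y \<in> mspace m" "z \<in> mspace m" for x y z
    proof -
      have "mdist m x z powr p \<le> (mdist m x y + mdist m y z) powr p"
        using assms mdist_triangle that by (intro powr_mono2) auto
      also have "\<dots> \<le> mdist m x y powr p + mdist m y z powr p"
        using assms by (intro powr_subadditive) auto
      finally show ?thesis .
    qed
  qed (use assms in \<open>auto simp: mdist_commute\<close>)
  show "mspace (snowflake m p) = mspace m" "mdist (snowflake m p) x y = mdist m x y powr p"
    by (simp_all add: snowflake_def)
qed

lemma powr_less_iff:
  fixes x y p :: real
  assumes "0 < p" "0 \<le> x" "0 \<le> y"
  shows "x powr p < y powr p \<longleftrightarrow> x < y" "x powr p \<le> y powr p \<longleftrightarrow> x \<le> y"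
  using assms powr_less_mono2[of p x y] powr_mono2[of p y x] powr_mono2[of p x y] powr_less_mono2[of p y x]
  by (auto simp: not_less[symmetric])

lemma powr_inverse_powr:
  fixes t p :: real
  assumes "0 < p" "0 < t"
  shows "(t powr (1 / p)) powr p = t"
  using assms by (simp add: powr_powr)

lemma snowflake_unif_finer:
  assumes "0 < p" "p \<le> 1"
  shows "unif_finer m (snowflake m p)" "unif_finer (snowflake m p) m"
proof -
  note sn = snowflake_simps[OF assms]
  show "unif_finer m (snowflake m p)"
    unfolding unif_finer_def sn
  proof (intro conjI allI impI refl)
    fix e :: real assume e: "0 < e"
    show "\<exists>t>0. \<forall>x\<in>mspace m. \<forall>y\<in>mspace m. mdist m x y < t \<longrightarrow> mdist m x y powr p < e"
      using e powr_less_mono2[OF assms(1), of _ "e powr (1 / p)"] powr_inverse_powr[OF assms(1) e]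
      by (intro exI[of _ "e powr (1 / p)"]) auto
  qed
  show "unif_finer (snowflake m p) m"
    unfolding unif_finer_def sn
  proof (intro conjI allI impI refl)
    fix e :: real assume e: "0 < e"
    show "\<exists>t>0. \<forall>x\<in>mspace m. \<forall>y\<in>mspace m. mdist m x y powr p < t \<longrightarrow> mdist m x y < e"
      using e assms by (intro exI[of _ "e powr p"]) (auto simp: powr_less_iff)
  qed
qed

lemma selfsim_snowflake:
  assumes "selfsim_pair m f g E lam br" and p: "0 < p" "p \<le> 1"
  shows "selfsim_pair (snowflake m p) f g (E powr p) (lam powr p) br"
proof -
  interpret selfsim_pair m f g E lam br by fact
  note sn = snowflake_simps[OF p]
  have dE: "mdist m x y powr p \<le> E powr p \<longleftrightarrow> mdist m x y \<le> E"
    "mdist m x y powr p < E powr p \<longleftrightarrow> mdist m x y < E" for x y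
    using powr_less_iff[OF p(1)] E_pos by auto
  have small: "mdist m x y powr p < t \<longleftrightarrow> mdist m x y < t powr (1 / p)" if "0 < t" for x y t
    using powr_less_iff(1)[OF p(1), of "mdist m x y" "t powr (1 / p)"] powr_inverse_powr[OF p(1) that]
    by simp
  have small': "mdist m x y < t \<longleftrightarrow> mdist m x y powr p < t powr p" if "0 < t" for x y t
    using powr_less_iff(1)[OF p(1), of "mdist m x y" t] that by simp
  have scale: "mdist m x y powr p \<le> inverse (lam powr p) * mdist m u v powr p"
    if "mdist m x y \<le> inverse lam * mdist m u v" for x y u v
  proof -
    have "mdist m x y powr p \<le> (inverse lam * mdist m u v) powr p"
      using that p by (intro powr_mono2) auto
    then show ?thesis using lam_pos by (simp add: powr_mult inverse_powr)
  qed
  have uc: "\<exists>t>0. \<forall>x\<in>mspace m. \<forall>y\<in>mspace m. mdist m x y powr p < t \<longrightarrow> mdist m (k x) (k y) powr p < e"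
    if e: "0 < e" and k: "\<And>e. 0 < e \<Longrightarrow> \<exists>t>0. \<forall>x\<in>mspace m. \<forall>y\<in>mspace m. mdist m x y < t \<longrightarrow> mdist m (k x) (k y) < e"
    for e :: real and k
  proof -
    have "0 < e powr (1 / p)" using e by simp
    then obtain t where t: "t > 0" "\<forall>x\<in>mspace m. \<forall>y\<in>mspace m. mdist m x y < t \<longrightarrow> mdist m (k x) (k y) < e powr (1 / p)"
      using k by blast
    then show ?thesis
      by (intro exI[of _ "t powr p"]) (auto simp: small[OF e] small'[OF t(1), symmetric])
  qed
  show ?thesis
  proof (unfold_locales, unfold sn dE)
    fix e :: real assume e: "0 < e"
    show "\<exists>t>0. \<forall>x\<in>mspace m. \<forall>y\<in>mspace m. mdist m x y powr p < t \<longrightarrow> mdist m (f x) (f y) powr p < e"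
      by (rule uc[OF e f_uc])
    show "\<exists>t>0. \<forall>x\<in>mspace m. \<forall>y\<in>mspace m. mdist m x y powr p < t \<longrightarrow> mdist m (g x) (g y) powr p < e"
      by (rule uc[OF e g_uc])
    have "0 < e powr (1 / p)" using e by simp
    then obtain t where t: "t > 0" "\<forall>x\<in>mspace m. \<forall>y\<in>mspace m. \<forall>x'\<in>mspace m. \<forall>y'\<in>mspace m.
        mdist m x y \<le> E \<longrightarrow> mdist m x' y' \<le> E \<longrightarrow> mdist m x x' < t \<longrightarrow> mdist m y y' < t \<longrightarrow>
        mdist m (br x y) (br x' y') < e powr (1 / p)"
      using br_uc by blast
    then show "\<exists>t>0. \<forall>x\<in>mspace m. \<forall>y\<in>mspace m. \<forall>x'\<in>mspace m. \<forall>y'\<in>mspace m.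
        mdist m x y \<le> E \<longrightarrow> mdist m x' y' \<le> E \<longrightarrow> mdist m x x' powr p < t \<longrightarrow> mdist m y y' powr p < t \<longrightarrow>
        mdist m (br x y) (br x' y') powr p < e"
      by (intro exI[of _ "t powr p"]) (auto simp: small[OF e] small'[OF t(1), symmetric])
  next
    fix x y assume "x \<in> mspace m" "y \<in> mspace m"
    then have "mdist m (f x) (f y) powr p \<le> (lam * mdist m x y) powr p"
      using p by (intro powr_mono2 f_lip) auto
    then show "mdist m (f x) (f y) powr p \<le> lam powr p * mdist m x y powr p"
      by (simp add: powr_mult)
  qed (use E_pos lam_gt_1 p f_in g_in gf fg br_in br_idem br_right br_left br_f
        stable_step[THEN scale] unstable_step[THEN scale] in auto)
qed

text \<open>
  The factor \<open>8\<close> is reached by the exponent \<open>ln 8 / ln lam\<close>, or by \<open>1\<close> if \<open>lam\<close> is already small.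
\<close>

lemma selfsim_small_expansion:
  assumes "selfsim_pair m f g E lam br"
  shows "\<exists>m' E' lam'. selfsim_pair m' f g E' lam' br \<and> lam' \<le> 8 \<and> unif_finer m m' \<and> unif_finer m' m"
proof -
  interpret selfsim_pair m f g E lam br by fact
  define p where "p = min 1 (ln 8 / ln lam)"
  have p: "0 < p" "p \<le> 1" using lam_gt_1 by (auto simp: p_def)
  have "lam powr p \<le> lam powr (ln 8 / ln lam)" using lam_gt_1 by (intro powr_mono) (auto simp: p_def)
  also have "\<dots> = 8" using lam_gt_1 by (simp add: powr_def)
  finally show ?thesis
    using selfsim_snowflake[OF assms p] snowflake_unif_finer[OF p] by blast
qed

section \<open>From Smale spaces to time-symmetric systems\<close>

lemma unif_finer_same_topology:
  assumes "compact_space (mtopology_of m1)" "mtopology_of m1 = mtopology_of m2"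
  shows "unif_finer m1 m2"
proof -
  have sp: "mspace m1 = mspace m2" using assms(2) topspace_mtopology_of by metis
  have "uniformly_continuous_map m1 m2 (\<lambda>x. x)"
    using assms by (intro continuous_imp_uniformly_continuous_map) simp
  then show ?thesis
    unfolding uniformly_continuous_map_def unif_finer_def using sp by (metis mdist_commute)
qed

text \<open>
  The bracket is uniformly continuous because its domain is closed in the compact square of the space.
\<close>

lemma smale_space_imp_pair:
  assumes "smale_space m \<phi> E lam br"
  shows "smale_pair m \<phi> (inv_into (mspace m) \<phi>) E lam br"
proof -
  interpret smale_space m \<phi> E lam br by fact
  let ?X = "mspace m" and ?g = "inv_into (mspace m) \<phi>" and ?T = "mtopology_of m"
  have inj: "inj_on \<phi> ?X" and surj: "\<phi> ` ?X = ?X"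
    using homeomorphic_imp_injective_map[OF homeo] homeomorphic_imp_surjective_map[OF homeo] by auto
  have fX: "\<phi> x \<in> ?X" if "x \<in> ?X" for x using surj that by blast
  have gX: "?g x \<in> ?X" if "x \<in> ?X" for x using surj that inv_into_into by metis
  have gf: "?g (\<phi> x) = x" if "x \<in> ?X" for x using inj that by simp
  have fg: "\<phi> (?g x) = x" if "x \<in> ?X" for x using surj that f_inv_into_f by metis
  have uc: "\<exists>t>0. \<forall>x\<in>?X. \<forall>y\<in>?X. mdist m x y < t \<longrightarrow> mdist m (k x) (k y) < e"
    if "continuous_map ?T ?T k" "0 < e" for k and e :: real
  proof -
    have "uniformly_continuous_map m m k"
      using continuous_imp_uniformly_continuous_map compact that(1) by blast
    then show ?thesis using that(2) unfolding uniformly_continuous_map_def by (metis mdist_commute)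
  qed
  have cf: "continuous_map ?T ?T \<phi>" using homeo homeomorphic_imp_continuous_map by blast
  have cg: "continuous_map ?T ?T ?g"
  proof -
    obtain k where k: "homeomorphic_maps ?T ?T \<phi> k" using homeo homeomorphic_map_maps by blast
    have "k y = ?g y" if "y \<in> ?X" for y
      using k gf fg gX that unfolding homeomorphic_maps_def by (metis topspace_mtopology_of)
    then show ?thesis using k unfolding homeomorphic_maps_def
      by (metis continuous_map_eq topspace_mtopology_of)
  qed
  define K where "K = {(x, y). mdist m x y \<le> E}"
  have topo: "subtopology (prod_topology ?T ?T) K = mtopology_of (submetric (prod_metric m m) K)"
    by (simp add: mtopology_of_submetric)
  have "closedin (prod_topology ?T ?T) {p \<in> topspace (prod_topology ?T ?T). (\<lambda>(x, y). mdist m x y) p \<in> {..E}}"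
    by (rule closedin_continuous_map_preimage[OF continuous_map_metric]) simp
  moreover have "{p \<in> topspace (prod_topology ?T ?T). (\<lambda>(x, y). mdist m x y) p \<in> {..E}}
      = topspace (prod_topology ?T ?T) \<inter> K" by (auto simp: K_def)
  moreover have cp: "compact_space (prod_topology ?T ?T)"
    using compact by (simp add: compact_space_prod_topology)
  ultimately have "compactin (prod_topology ?T ?T) (topspace (prod_topology ?T ?T) \<inter> K)"
    using closedin_compact_space by metis
  then have "compact_space (subtopology (prod_topology ?T ?T) K)"
    using compact_space_subtopology by (metis subtopology_restrict)
  then have ucb: "uniformly_continuous_map (submetric (prod_metric m m) K) m (\<lambda>(x, y). br x y)"
    using bracket_continuous[folded K_def]
    by (intro continuous_imp_uniformly_continuous_map) (simp add: topo[symmetric])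
  have br_in: "br x y \<in> ?X" if "x \<in> ?X" "y \<in> ?X" "mdist m x y \<le> E" for x y
    using funcset_mem[OF uniformly_continuous_map_funspace[OF ucb], of "(x, y)"] that
    by (simp add: K_def)
  show ?thesis
  proof
    fix e :: real assume e: "0 < e"
    show "\<exists>t>0. \<forall>x\<in>?X. \<forall>y\<in>?X. mdist m x y < t \<longrightarrow> mdist m (\<phi> x) (\<phi> y) < e" by (rule uc[OF cf e])
    show "\<exists>t>0. \<forall>x\<in>?X. \<forall>y\<in>?X. mdist m x y < t \<longrightarrow> mdist m (?g x) (?g y) < e" by (rule uc[OF cg e])
    let ?K = "mspace (submetric (prod_metric m m) K)"
    obtain t where t: "t > 0" "\<forall>p\<in>?K. \<forall>q\<in>?K. mdist (submetric (prod_metric m m) K) q p < t \<longrightarrow>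
        mdist m ((\<lambda>(x, y). br x y) q) ((\<lambda>(x, y). br x y) p) < e"
      using ucb e unfolding uniformly_continuous_map_def by blast
    have "mdist m (br x y) (br x' y') < e"
      if "x \<in> ?X" "y \<in> ?X" "x' \<in> ?X" "y' \<in> ?X" "mdist m x y \<le> E" "mdist m x' y' \<le> E"
        "mdist m x x' < t / 2" "mdist m y y' < t / 2" for x y x' y'
    proof -
      have "prod_dist (mdist m) (mdist m) (x, y) (x', y') \<le> mdist m x x' + mdist m y y'"
        using that by (intro Metric_space12.prod_metric_le_components[OF Metric_space12_mspace_mdist])
      then show ?thesis using t(2)[rule_format, of "(x', y')" "(x, y)"] that by (simp add: K_def)
    qed
    then show "\<exists>t>0. \<forall>x\<in>?X. \<forall>y\<in>?X. \<forall>x'\<in>?X. \<forall>y'\<in>?X. mdist m x y \<le> E \<longrightarrow> mdist m x' y' \<le> E \<longrightarrow>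
        mdist m x x' < t \<longrightarrow> mdist m y y' < t \<longrightarrow> mdist m (br x y) (br x' y') < e"
      using t(1) by (intro exI[of _ "t / 2"]) auto
  next
    fix x y assume xy: "x \<in> ?X" "y \<in> ?X" "mdist m x y < E"
    have xx: "mdist m x x < E" using mdist_zero[OF xy(1) xy(1)] eps_pos by auto
    show "mdist m (\<phi> x) (\<phi> y) \<le> inverse lam * mdist m x y" if "br x y = y"
      using stable_contraction[OF xy(1) eps_pos order_refl, of x y] xy xx that bracket_idem
      by (simp add: local_stable_def)
    show "mdist m (?g x) (?g y) \<le> inverse lam * mdist m x y" if "br y x = y"
      using unstable_contraction[OF xy(1) eps_pos order_refl, of x y] xy xx that bracket_idem
      by (simp add: local_unstable_def)
  qed (simp_all add: fX gX gf fg br_in eps_pos lambda_gt_1 bracket_idem bracket_right bracket_left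
        bracket_equivariant)
qed

lemma unif_finer_trans: "unif_finer m1 m2 \<Longrightarrow> unif_finer m2 m3 \<Longrightarrow> unif_finer m1 m3"
  unfolding unif_finer_def by (metis (no_types, lifting))

lemma bracket_radius_flip: "bracket_radius m E br e \<Longrightarrow> bracket_radius m E (\<lambda>x y. br y x) e"
  by (auto simp: bracket_radius_def mdist_commute)



section \<open>Existence of the metrics\<close>

text \<open>
  The construction is carried out with a snowflake of the given self-similar metric; topology and
  basic sets may come from any structures with the same uniformity.
\<close>

lemma groupoid_metrics:
  assumes S: "selfsim_pair m1 f g E1 lam1 br1" and B: "smale_pair m f g E lam br"
    and u: "unif_finer m m1" "unif_finer m1 m" and e: "bracket_radius m E br e"
    and Q: "Q \<subseteq> mspace m" "f ` Q \<subseteq> Q" "g ` Q \<subseteq> Q"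
  defines "G \<equiv> stable_groupoid m f g Q" and "Y \<equiv> stable_union m g Q"
    and "T \<equiv> topology_generated_by (base_charts m f g E br e Q)"
  shows "\<exists>Ds Dt. compatible_metric Ds G T \<and> compatible_metric Dt Y (pullback_topology Y (\<lambda>x. (x, x)) T) \<and>
    bi_lipschitz_map Ds Ds (map_prod f f) \<and>
    (\<forall>a\<in>G. \<forall>b\<in>G. inverse 4 * mdist Ds a b \<le> mdist Ds (map_prod f f a) (map_prod f f b) \<and>
       mdist Ds (map_prod f f a) (map_prod f f b) \<le> 8 * mdist Ds a b) \<and>
    bi_lipschitz_map Ds Ds prod.swap \<and>
    (\<forall>m3 E3 lam3 br3 e3 V. smale_pair m3 f g E3 lam3 br3 \<longrightarrow> unif_finer m m3 \<longrightarrow> unif_finer m3 m \<longrightarrow>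
       bracket_radius m3 E3 br3 e3 \<longrightarrow> V \<in> base_charts m3 f g E3 br3 e3 Q \<longrightarrow>
       bi_lipschitz_map (submetric Ds V) (submetric Dt (fst ` V)) fst \<and>
       bi_lipschitz_map (submetric Ds V) (submetric Dt (snd ` V)) snd) \<and>
    locally_bi_lipschitz_map Ds Dt fst \<and> locally_bi_lipschitz_map Ds Dt snd"
proof -
  obtain m2 E2 lam2 where S2: "selfsim_pair m2 f g E2 lam2 br1" "lam2 \<le> 8"
    and u2: "unif_finer m1 m2" "unif_finer m2 m1"
    using selfsim_small_expansion[OF S] by blast
  have um: "unif_finer m m2" "unif_finer m2 m" using u u2 unif_finer_trans by blast+
  interpret A: selfsim_pair m2 f g E2 lam2 br1 by fact
  interpret AB: two_structures m2 f g E2 lam2 br1 m E lam br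
    using S2(1) B um by (simp add: two_structures_def two_structures_axioms_def)
  have Q2: "Q \<subseteq> mspace m2" using Q(1) AB.space_eq by simp
  have G: "G = stable_groupoid m2 f g Q" and Y: "Y = stable_union m2 g Q"
    unfolding G_def Y_def by (rule AB.groupoid_eq[OF Q2] AB.union_eq[OF Q2])+
  have YX: "Y \<subseteq> mspace m2" unfolding Y by (rule smale_pair.stable_union_in[OF A.dual Q2])
  let ?Ds = "A.groupoid_metric G" and ?Dt = "A.leaf_metric Y"
  have GX: "G \<subseteq> mspace m2 \<times> mspace m2" using A.stable_groupoid_subset[OF Q2] G by simp
  have ms: "mspace ?Ds = G" "mdist ?Ds = A.groupoid_dist" "mspace ?Dt = Y"
    using A.groupoid_metric_simps[OF Q2] A.leaf_metric_simps[OF YX] G by auto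
  have T: "mtopology_of ?Ds = T" using AB.groupoid_topology[OF Q2 e] G T_def by simp
  have TY: "mtopology_of ?Dt = pullback_topology Y (\<lambda>x. (x, x)) T"
    using A.unit_topology[OF Q2] T G Y by simp
  have ff: "map_prod f f a \<in> G" if "a \<in> G" for a
    using A.groupoid_invariant(1)[OF Q2 Q(2,3)] that G by simp
  have est: "A.groupoid_dist a b \<le> A.groupoid_dist (map_prod f f a) (map_prod f f b) \<and>
      A.groupoid_dist (map_prod f f a) (map_prod f f b) \<le> 8 * A.groupoid_dist a b" if "a \<in> G" "b \<in> G" for a b
  proof
    show "A.groupoid_dist a b \<le> A.groupoid_dist (map_prod f f a) (map_prod f f b)" using GX that by (intro A.groupoid_dist_le_map) auto
    have "A.groupoid_dist (map_prod f f a) (map_prod f f b) \<le> lam2 * A.groupoid_dist a b" by (rule A.groupoid_dist_map_le)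
    also have "\<dots> \<le> 8 * A.groupoid_dist a b" using S2(2) A.groupoid_dist_nonneg by (intro mult_right_mono) auto
    finally show "A.groupoid_dist (map_prod f f a) (map_prod f f b) \<le> 8 * A.groupoid_dist a b" .
  qed
  show ?thesis
  proof (intro exI[of _ ?Ds] exI[of _ ?Dt] conjI allI impI ballI)
    show "compatible_metric ?Ds G T" "compatible_metric ?Dt Y (pullback_topology Y (\<lambda>x. (x, x)) T)"
      using ms T TY by (auto simp: compatible_metric_def)
    show "bi_lipschitz_map ?Ds ?Ds (map_prod f f)"
    proof (rule bi_lipschitz_mapI[where C = 8])
      fix a b assume ab: "a \<in> mspace ?Ds" "b \<in> mspace ?Ds"
      then show "mdist ?Ds (map_prod f f a) (map_prod f f b) \<le> 8 * mdist ?Ds a b" using est ms by simp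
      have "A.groupoid_dist a b \<le> A.groupoid_dist (map_prod f f a) (map_prod f f b)" using est ab ms by simp
      then show "mdist ?Ds a b \<le> 8 * mdist ?Ds (map_prod f f a) (map_prod f f b)"
        using A.groupoid_dist_nonneg[of "map_prod f f a" "map_prod f f b"] ms by simp
    qed (use ff ms in auto)
    show "bi_lipschitz_map ?Ds ?Ds prod.swap" using A.swap_bilip[OF Q2] G by simp
    show "locally_bi_lipschitz_map ?Ds ?Dt fst" "locally_bi_lipschitz_map ?Ds ?Dt snd"
      using A.locally_bilip[OF Q2] G Y by simp_all
  next
    fix a b assume ab: "a \<in> G" "b \<in> G"
    show "mdist ?Ds (map_prod f f a) (map_prod f f b) \<le> 8 * mdist ?Ds a b" using est ab ms by simp
    show "inverse 4 * mdist ?Ds a b \<le> mdist ?Ds (map_prod f f a) (map_prod f f b)"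
      using est[OF ab] A.groupoid_dist_nonneg[of a b] ms by simp
  next
    fix m3 E3 lam3 br3 e3 V
    assume m3: "smale_pair m3 f g E3 lam3 br3" "unif_finer m m3" "unif_finer m3 m"
      "bracket_radius m3 E3 br3 e3" "V \<in> base_charts m3 f g E3 br3 e3 Q"
    interpret AC: two_structures m2 f g E2 lam2 br1 m3 E3 lam3 br3
      using S2(1) m3 um unif_finer_trans by (auto simp: two_structures_def two_structures_axioms_def)
    show "bi_lipschitz_map (submetric ?Ds V) (submetric ?Dt (fst ` V)) fst"
      "bi_lipschitz_map (submetric ?Ds V) (submetric ?Dt (snd ` V)) snd"
      using AC.base_charts_bilip[OF Q2 m3(4,5)] G Y by simp_all
  qed
qed

lemma Gs_eq: "Gs m \<phi> Q = stable_groupoid m \<phi> (inv_into (mspace m) \<phi>) Q"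
  and unstable_union_eq: "unstable_union m \<phi> Q = stable_union m (inv_into (mspace m) \<phi>) Q"
  and base_s_eq: "base_s m \<phi> E br e Q = base_charts m \<phi> (inv_into (mspace m) \<phi>) E br e Q"
  by (simp_all add: Gs_def stable_groupoid_def unstable_union_def stable_union_def global_unstable_def
      global_stable_def base_s_def base_charts_def holonomy_s_def)

lemma Gu_eq: "Gu m \<phi> P = stable_groupoid m (inv_into (mspace m) \<phi>) \<phi> P"
  and base_u_eq: "base_u m \<phi> E br e P = base_charts m (inv_into (mspace m) \<phi>) \<phi> E (\<lambda>x y. br y x) e P"
  by (simp_all add: Gu_def stable_groupoid_def unstable_union_def stable_union_def global_unstable_def
      global_stable_def base_u_def base_charts_def holonomy_u_def local_stable_def local_unstable_def)

text \<open>
  For the inverse map, \<open>g q\<close> is the last point of the orbit of \<open>q\<close> before it returns.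
\<close>

lemma periodic_orbit_invariant:
  assumes "smale_pair m \<phi> g E lam br" "periodic_orbit m \<phi> Q"
  shows "Q \<subseteq> mspace m" "\<phi> ` Q \<subseteq> Q" "g ` Q \<subseteq> Q"
proof -
  interpret smale_pair m \<phi> g E lam br by fact
  obtain q n where q: "q \<in> mspace m" "0 < n" "(\<phi> ^^ n) q = q" "Q = range (\<lambda>k. (\<phi> ^^ k) q)"
    using assms(2) by (auto simp: periodic_orbit_def)
  show "Q \<subseteq> mspace m" using q funpow_f_in by auto
  have "\<phi> ((\<phi> ^^ k) q) = (\<phi> ^^ Suc k) q" for k by simp
  then show "\<phi> ` Q \<subseteq> Q" unfolding q(4) by blast
  have "g ((\<phi> ^^ k) q) \<in> Q" for k
  proof (cases k)
    case 0
    obtain j where j: "n = Suc j" using q(2) gr0_implies_Suc by blast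
    have "g q = g ((\<phi> ^^ Suc j) q)" using q(3) j by simp
    then have "g q = (\<phi> ^^ j) q" using q(1) by (simp add: gf funpow_f_in)
    then show ?thesis using 0 q(4) by auto
  next
    case (Suc j)
    then show ?thesis using q by (auto simp: gf funpow_f_in)
  qed
  then show "g ` Q \<subseteq> Q" using q(4) by auto
qed

theorem theorem6p1:
  fixes m :: "'a metric" and \<phi> :: "'a \<Rightarrow> 'a"
    and \<epsilon>X lamX \<epsilon>X' :: real and br :: "'a \<Rightarrow> 'a \<Rightarrow> 'a"
    and P Q :: "'a set"
  assumes "smale_space m \<phi> \<epsilon>X lamX br"
    and "bracket_radius m \<epsilon>X br \<epsilon>X'"
    and "irreducible_system m \<phi>"
    and "periodic_orbit m \<phi> P"
    and "periodic_orbit m \<phi> Q"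
  shows
    "(\<forall>m' \<in> sM m \<phi>. \<exists>(Ds :: ('a \<times> 'a) metric) (Dt :: 'a metric).
        compatible_metric Ds (Gs m \<phi> Q) (Gs_topology m \<phi> \<epsilon>X br \<epsilon>X' Q) \<and>
        compatible_metric Dt (unstable_union m \<phi> Q) (Xu_topology m \<phi> \<epsilon>X br \<epsilon>X' Q) \<and>
        bij_betw (map_prod \<phi> \<phi>) (Gs m \<phi> Q) (Gs m \<phi> Q) \<and>
        bi_lipschitz_map Ds Ds (map_prod \<phi> \<phi>) \<and>
        (\<forall>a \<in> Gs m \<phi> Q. \<forall>b \<in> Gs m \<phi> Q.
           inverse 4 * mdist Ds a b \<le> mdist Ds (map_prod \<phi> \<phi> a) (map_prod \<phi> \<phi> b) \<and>
           mdist Ds (map_prod \<phi> \<phi> a) (map_prod \<phi> \<phi> b) \<le> 8 * mdist Ds a b) \<and>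
        bi_lipschitz_map Ds Ds prod.swap \<and>
        (\<forall>V \<in> all_base_s m \<phi> Q.
           bi_lipschitz_map (submetric Ds V) (submetric Dt (fst ` V)) fst \<and>
           bi_lipschitz_map (submetric Ds V) (submetric Dt (snd ` V)) snd) \<and>
        locally_bi_lipschitz_map Ds Dt fst \<and>
        locally_bi_lipschitz_map Ds Dt snd) \<and>
     (\<forall>m' \<in> sM m \<phi>. \<exists>(Du :: ('a \<times> 'a) metric) (Dt :: 'a metric).
        compatible_metric Du (Gu m \<phi> P) (Gu_topology m \<phi> \<epsilon>X br \<epsilon>X' P) \<and>
        compatible_metric Dt (stable_union m \<phi> P) (Xs_topology m \<phi> \<epsilon>X br \<epsilon>X' P) \<and>
        bij_betw (map_prod \<phi> \<phi>) (Gu m \<phi> P) (Gu m \<phi> P) \<and>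
        (\<forall>a \<in> Gu m \<phi> P. \<forall>b \<in> Gu m \<phi> P.
           inverse 4 * mdist Du a b
             \<le> mdist Du (inv_into (Gu m \<phi> P) (map_prod \<phi> \<phi>) a)
                        (inv_into (Gu m \<phi> P) (map_prod \<phi> \<phi>) b) \<and>
           mdist Du (inv_into (Gu m \<phi> P) (map_prod \<phi> \<phi>) a)
                    (inv_into (Gu m \<phi> P) (map_prod \<phi> \<phi>) b)
             \<le> 8 * mdist Du a b) \<and>
        bi_lipschitz_map Du Du prod.swap \<and>
        (\<forall>V \<in> all_base_u m \<phi> P.
           bi_lipschitz_map (submetric Du V) (submetric Dt (fst ` V)) fst \<and>
           bi_lipschitz_map (submetric Du V) (submetric Dt (snd ` V)) snd))"
proof -
  define g where "g = inv_into (mspace m) \<phi>"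
  interpret S: smale_space m \<phi> \<epsilon>X lamX br by fact
  have B: "smale_pair m \<phi> g \<epsilon>X lamX br" unfolding g_def by (rule smale_space_imp_pair[OF assms(1)])
  interpret B: smale_pair m \<phi> g \<epsilon>X lamX br by (rule B)
  interpret Bd: smale_pair m g \<phi> \<epsilon>X lamX "\<lambda>x y. br y x" by (rule B.dual)
  note Q = periodic_orbit_invariant[OF B assms(5)] and P = periodic_orbit_invariant[OF B assms(4)]
  have hM: "mspace m3 = mspace m \<and> unif_finer m m3 \<and> unif_finer m3 m" if "m3 \<in> hM m \<phi>" for m3
  proof -
    have "mspace m3 = mspace m" "mtopology_of m3 = mtopology_of m"
      using that by (auto simp: hM_def compatible_metric_def)
    then show ?thesis using unif_finer_same_topology S.compact by metis
  qed
  have hM_pair: "smale_pair m3 \<phi> g E3 lam3 br3" if "m3 \<in> hM m \<phi>" "smale_space m3 \<phi> E3 lam3 br3" for m3 E3 lam3 br3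
    using smale_space_imp_pair[OF that(2)] hM[OF that(1)] g_def by simp
  have Vs: "\<exists>m3 E3 lam3 br3 e3. smale_pair m3 \<phi> g E3 lam3 br3 \<and> unif_finer m m3 \<and> unif_finer m3 m \<and>
      bracket_radius m3 E3 br3 e3 \<and> V \<in> base_charts m3 \<phi> g E3 br3 e3 Q" if V: "V \<in> all_base_s m \<phi> Q" for V
  proof -
    obtain m3 E3 lam3 br3 e3 where 3: "m3 \<in> hM m \<phi>" "smale_space m3 \<phi> E3 lam3 br3"
      "bracket_radius m3 E3 br3 e3" "V \<in> base_s m3 \<phi> E3 br3 e3 Q"
      using V unfolding all_base_s_def by auto
    then have "V \<in> base_charts m3 \<phi> g E3 br3 e3 Q" using hM[OF 3(1)] by (simp add: base_s_eq g_def)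
    then show ?thesis using hM_pair[OF 3(1,2)] hM[OF 3(1)] 3(3) by blast
  qed
  have Vu: "\<exists>m3 E3 lam3 br3 e3. smale_pair m3 g \<phi> E3 lam3 br3 \<and> unif_finer m m3 \<and> unif_finer m3 m \<and>
      bracket_radius m3 E3 br3 e3 \<and> V \<in> base_charts m3 g \<phi> E3 br3 e3 P" if V: "V \<in> all_base_u m \<phi> P" for V
  proof -
    obtain m3 E3 lam3 br3 e3 where 3: "m3 \<in> hM m \<phi>" "smale_space m3 \<phi> E3 lam3 br3"
      "bracket_radius m3 E3 br3 e3" "V \<in> base_u m3 \<phi> E3 br3 e3 P"
      using V unfolding all_base_u_def by auto
    then have "V \<in> base_charts m3 g \<phi> E3 (\<lambda>x y. br3 y x) e3 P" using hM[OF 3(1)] by (simp add: base_u_eq g_def)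
    then show ?thesis
      using smale_pair.dual[OF hM_pair[OF 3(1,2)]] hM[OF 3(1)] bracket_radius_flip[OF 3(3)] by blast
  qed
  have self: "\<exists>E1 lam1 br1. selfsim_pair m' \<phi> g E1 lam1 br1 \<and> selfsim_pair m' g \<phi> E1 lam1 (\<lambda>x y. br1 y x)"
    and uf: "unif_finer m m'" "unif_finer m' m" if m': "m' \<in> sM m \<phi>" for m'
  proof -
    have h: "m' \<in> hM m \<phi>" using m' by (simp add: sM_def)
    then show "unif_finer m m'" "unif_finer m' m" using hM by auto
    obtain E1 lam1 br1 where s: "smale_space m' \<phi> E1 lam1 br1" "self_similar m' \<phi> lam1"
      using m' by (auto simp: sM_def)
    have p: "smale_pair m' \<phi> g E1 lam1 br1" by (rule hM_pair[OF h s(1)])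
    have "inv_into (mspace m') \<phi> = g" using hM[OF h] by (simp add: g_def)
    then have "selfsim_pair m' \<phi> g E1 lam1 br1" "selfsim_pair m' g \<phi> E1 lam1 (\<lambda>x y. br1 y x)"
      using p smale_pair.dual[OF p] s(2)
      by (auto simp: selfsim_pair_def selfsim_pair_axioms_def self_similar_def)
    then show "\<exists>E1 lam1 br1. selfsim_pair m' \<phi> g E1 lam1 br1 \<and> selfsim_pair m' g \<phi> E1 lam1 (\<lambda>x y. br1 y x)"
      by blast
  qed
  have inv: "inv_into (Gu m \<phi> P) (map_prod \<phi> \<phi>) a = map_prod g g a" if "a \<in> Gu m \<phi> P" for a
  proof -
    have G: "Gu m \<phi> P = stable_groupoid m g \<phi> P" by (simp add: Gu_eq g_def)
    note bij = Bd.groupoid_bij[OF P(1,3,2)]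
    have "map_prod g g a \<in> Gu m \<phi> P" using Bd.groupoid_invariant(1)[OF P(1,3,2)] that G by simp
    moreover have "map_prod \<phi> \<phi> (map_prod g g a) = a"
      using that subsetD[OF B.stable_union_in[OF P(1)]] by (auto simp: G stable_groupoid_def B.fg)
    ultimately show ?thesis using bij(2) G by (metis bij_betw_imp_inj_on inv_into_f_f)
  qed
  show ?thesis
  proof (intro conjI ballI)
    fix m' assume m': "m' \<in> sM m \<phi>"
    obtain E1 lam1 br1 where s: "selfsim_pair m' \<phi> g E1 lam1 br1" using self[OF m'] by blast
    obtain Ds Dt where D: "compatible_metric Ds (Gs m \<phi> Q) (Gs_topology m \<phi> \<epsilon>X br \<epsilon>X' Q)"
        "compatible_metric Dt (unstable_union m \<phi> Q) (Xu_topology m \<phi> \<epsilon>X br \<epsilon>X' Q)"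
        "bi_lipschitz_map Ds Ds (map_prod \<phi> \<phi>)"
        "\<forall>a\<in>Gs m \<phi> Q. \<forall>b\<in>Gs m \<phi> Q. inverse 4 * mdist Ds a b \<le> mdist Ds (map_prod \<phi> \<phi> a) (map_prod \<phi> \<phi> b) \<and>
           mdist Ds (map_prod \<phi> \<phi> a) (map_prod \<phi> \<phi> b) \<le> 8 * mdist Ds a b"
        "bi_lipschitz_map Ds Ds prod.swap"
        "\<forall>m3 E3 lam3 br3 e3 V. smale_pair m3 \<phi> g E3 lam3 br3 \<longrightarrow> unif_finer m m3 \<longrightarrow> unif_finer m3 m \<longrightarrow>
          bracket_radius m3 E3 br3 e3 \<longrightarrow> V \<in> base_charts m3 \<phi> g E3 br3 e3 Q \<longrightarrow>
          bi_lipschitz_map (submetric Ds V) (submetric Dt (fst ` V)) fst \<and>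
          bi_lipschitz_map (submetric Ds V) (submetric Dt (snd ` V)) snd"
        "locally_bi_lipschitz_map Ds Dt fst" "locally_bi_lipschitz_map Ds Dt snd"
      using groupoid_metrics[OF s B uf[OF m'] assms(2) Q]
      unfolding Gs_topology_def Xu_topology_def Gs_eq unstable_union_eq base_s_eq g_def[symmetric] by blast
    show "\<exists>Ds Dt.
        compatible_metric Ds (Gs m \<phi> Q) (Gs_topology m \<phi> \<epsilon>X br \<epsilon>X' Q) \<and>
        compatible_metric Dt (unstable_union m \<phi> Q) (Xu_topology m \<phi> \<epsilon>X br \<epsilon>X' Q) \<and>
        bij_betw (map_prod \<phi> \<phi>) (Gs m \<phi> Q) (Gs m \<phi> Q) \<and>
        bi_lipschitz_map Ds Ds (map_prod \<phi> \<phi>) \<and>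
        (\<forall>a \<in> Gs m \<phi> Q. \<forall>b \<in> Gs m \<phi> Q.
           inverse 4 * mdist Ds a b \<le> mdist Ds (map_prod \<phi> \<phi> a) (map_prod \<phi> \<phi> b) \<and>
           mdist Ds (map_prod \<phi> \<phi> a) (map_prod \<phi> \<phi> b) \<le> 8 * mdist Ds a b) \<and>
        bi_lipschitz_map Ds Ds prod.swap \<and>
        (\<forall>V \<in> all_base_s m \<phi> Q.
           bi_lipschitz_map (submetric Ds V) (submetric Dt (fst ` V)) fst \<and>
           bi_lipschitz_map (submetric Ds V) (submetric Dt (snd ` V)) snd) \<and>
        locally_bi_lipschitz_map Ds Dt fst \<and>
        locally_bi_lipschitz_map Ds Dt snd"
    proof (intro exI[of _ Ds] exI[of _ Dt] conjI D(1,2,3,5,7,8))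
      show "bij_betw (map_prod \<phi> \<phi>) (Gs m \<phi> Q) (Gs m \<phi> Q)"
        using B.groupoid_bij(1)[OF Q] by (simp add: Gs_eq g_def)
      show "\<forall>V \<in> all_base_s m \<phi> Q.
           bi_lipschitz_map (submetric Ds V) (submetric Dt (fst ` V)) fst \<and>
           bi_lipschitz_map (submetric Ds V) (submetric Dt (snd ` V)) snd"
        using Vs D(6) by meson
    qed (use D(4) in blast)
  next
    fix m' assume m': "m' \<in> sM m \<phi>"
    obtain E1 lam1 br1 where s: "selfsim_pair m' g \<phi> E1 lam1 (\<lambda>x y. br1 y x)" using self[OF m'] by blast
    obtain Du Dt where D: "compatible_metric Du (Gu m \<phi> P) (Gu_topology m \<phi> \<epsilon>X br \<epsilon>X' P)"
        "compatible_metric Dt (stable_union m \<phi> P) (Xs_topology m \<phi> \<epsilon>X br \<epsilon>X' P)"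
        "\<forall>a\<in>Gu m \<phi> P. \<forall>b\<in>Gu m \<phi> P. inverse 4 * mdist Du a b \<le> mdist Du (map_prod g g a) (map_prod g g b) \<and>
           mdist Du (map_prod g g a) (map_prod g g b) \<le> 8 * mdist Du a b"
        "bi_lipschitz_map Du Du prod.swap"
        "\<forall>m3 E3 lam3 br3 e3 V. smale_pair m3 g \<phi> E3 lam3 br3 \<longrightarrow> unif_finer m m3 \<longrightarrow> unif_finer m3 m \<longrightarrow>
          bracket_radius m3 E3 br3 e3 \<longrightarrow> V \<in> base_charts m3 g \<phi> E3 br3 e3 P \<longrightarrow>
          bi_lipschitz_map (submetric Du V) (submetric Dt (fst ` V)) fst \<and>
          bi_lipschitz_map (submetric Du V) (submetric Dt (snd ` V)) snd"
      using groupoid_metrics[OF s B.dual uf[OF m'] bracket_radius_flip[OF assms(2)] P(1,3,2)]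
      unfolding Gu_topology_def Xs_topology_def Gu_eq base_u_eq g_def[symmetric] by blast
    show "\<exists>Du Dt.
        compatible_metric Du (Gu m \<phi> P) (Gu_topology m \<phi> \<epsilon>X br \<epsilon>X' P) \<and>
        compatible_metric Dt (stable_union m \<phi> P) (Xs_topology m \<phi> \<epsilon>X br \<epsilon>X' P) \<and>
        bij_betw (map_prod \<phi> \<phi>) (Gu m \<phi> P) (Gu m \<phi> P) \<and>
        (\<forall>a \<in> Gu m \<phi> P. \<forall>b \<in> Gu m \<phi> P.
           inverse 4 * mdist Du a b
             \<le> mdist Du (inv_into (Gu m \<phi> P) (map_prod \<phi> \<phi>) a)
                        (inv_into (Gu m \<phi> P) (map_prod \<phi> \<phi>) b) \<and>
           mdist Du (inv_into (Gu m \<phi> P) (map_prod \<phi> \<phi>) a)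
                    (inv_into (Gu m \<phi> P) (map_prod \<phi> \<phi>) b)
             \<le> 8 * mdist Du a b) \<and>
        bi_lipschitz_map Du Du prod.swap \<and>
        (\<forall>V \<in> all_base_u m \<phi> P.
           bi_lipschitz_map (submetric Du V) (submetric Dt (fst ` V)) fst \<and>
           bi_lipschitz_map (submetric Du V) (submetric Dt (snd ` V)) snd)"
    proof (intro exI[of _ Du] exI[of _ Dt] conjI D(1,2,4))
      show "bij_betw (map_prod \<phi> \<phi>) (Gu m \<phi> P) (Gu m \<phi> P)"
        using Bd.groupoid_bij(2)[OF P(1,3,2)] by (simp add: Gu_eq g_def)
      show "\<forall>V \<in> all_base_u m \<phi> P.
           bi_lipschitz_map (submetric Du V) (submetric Dt (fst ` V)) fst \<and>
           bi_lipschitz_map (submetric Du V) (submetric Dt (snd ` V)) snd"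
        using Vu D(5) by meson
    qed (use D(3) inv in simp)
  qed
qed

end
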